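(* Let $\mathcal B\in\Pi^d$, $1<p<\infty$, $q=p/(p-1)$, $u\in L^p(Q)$ and $\tilde u\in L^q(Q)$. Then $\tilde u\in\partial PV_{\mathcal B}(u)$ if and only if both of the following hold: 1. $u\in BV_{\mathcal B}(Q)$; 2. there exists $v\in W_0^q[\mathcal B](Q;\mathbb R^K)$ such that $\|v\|_{L^\infty(Q)}\le1$, $\tilde u=\mathcal B^*v$, and $$PV_{\mathcal B}(u)=\int_Qu\,\mathcal B^*v\,dx.$$
   Context: Let $d,N\ge1$ be integers and $Q=(0,1)^N$. For $1\le h\le d$, $H^hu\in\mathcal D'(Q;\mathbb R^{N^h})$ is the array of all $h$-th order distributional partial derivatives of $u$. Put $K=\sum_{h=1}^dN^h$, so $\mathbb R^K=\bigoplus_{h=1}^d\mathbb R^{N^h}$. $\Pi^d$ is the set of operators $\mathcal B$ given by real matrices $B^h\in\mathbb R^{N^h\times N^h}$, $1\le h\le d$, through $\mathcal Bu=(B^1H^1u,\dots,B^dH^du)\in\mathcal D'(Q;\mathbb R^K)$. $\mathcal B^*$ is the formal adjoint: $\langle\mathcal B^*v,\phi\rangle=\langle v,\mathcal B\phi\rangle$ for $\phi\in C_c^\infty(Q)$. For $u\in L^1(Q)$, $PV_{\mathcal B}(u)=\sup\{\int_Qu\,\mathcal B^*\varphi\,dx:\varphi\in C_c^\infty(Q;\mathbb R^K),\ |\varphi|\le1\}\in[0,+\infty]$ (Euclidean norm on $\mathbb R^K$), and $BV_{\mathcal B}(Q)=\{u\in L^1(Q):PV_{\mathcal B}(u)<+\infty\}$.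 For $v\in L^q(Q;\mathbb R^K)$, $\mathcal B^*v\in L^q(Q)$ means that there is $w\in L^q(Q)$, denoted $\mathcal B^*v$, with $\int_Q\mathcal B\phi\cdot v\,dx=\int_Q\phi\,w\,dx$ for all $\phi\in C_c^\infty(Q)$. $W^q[\mathcal B](Q;\mathbb R^K)=\{v\in L^q(Q;\mathbb R^K):\mathcal B^*v\in L^q(Q)\}$ with norm given by $\|v\|^q=\|v\|_{L^q}^q+\|\mathcal B^*v\|_{L^q}^q$, and $W_0^q[\mathcal B](Q;\mathbb R^K)$ is the closure of $C_c^\infty(Q;\mathbb R^K)$ in this norm. $\|v\|_{L^\infty(Q)}$ is the essential supremum of the Euclidean norm $|v(x)|$. $\partial PV_{\mathcal B}(u)$ is the subdifferential of $PV_{\mathcal B}$ regarded as a function $L^p(Q)\to[0,+\infty]$: $\tilde u\in L^q(Q)$ belongs to it iff $PV_{\mathcal B}(u)<+\infty$ and $\int_Q(w-u)\tilde u\,dx+PV_{\mathcal B}(u)\le PV_{\mathcal B}(w)$ for all $w\in L^p(Q)$. *)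

theory Defs
  imports "HOL-Analysis.Analysis" "HOL-Probability.Essential_Supremum"
begin

text \<open>The dimension N is the cardinality of the finite type 'n.\<close>

definition Q_cube :: "(real^'n::finite) set" where
  "Q_cube = {x. \<forall>i. 0 < x $ i \<and> x $ i < 1}"

abbreviation Q_measure :: "(real^'n::finite) measure" where
  "Q_measure \<equiv> lebesgue_on Q_cube"


section \<open>Test functions\<close>

definition partial_deriv :: "'n \<Rightarrow> (real^'n \<Rightarrow> real) \<Rightarrow> real^'n::finite \<Rightarrow> real" where
  "partial_deriv i f x = frechet_derivative f (at x) (axis i 1)"

text \<open>The list [i1, ..., ih] stands for the entry (i1, ..., ih) of an array of h-th order
  partial derivatives; there are N to the power h lists of length h.\<close>

fun partial_derivs :: "'n list \<Rightarrow> (real^'n \<Rightarrow> real) \<Rightarrow> real^'n::finite \<Rightarrow> real" where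
  "partial_derivs [] f = f"
| "partial_derivs (i # is) f = partial_deriv i (partial_derivs is f)"

text \<open>Differentiability of all iterated partial derivatives makes all of them continuous,
  so this is the usual class of infinitely differentiable functions.\<close>

definition smooth :: "(real^'n::finite \<Rightarrow> real) \<Rightarrow> bool" where
  "smooth f \<longleftrightarrow> (\<forall>is x. partial_derivs is f differentiable (at x))"

text \<open>Elements of \<open>C\<^sub>c\<^sup>\<infinity>(Q)\<close> are represented by their extension by zero to the whole space.\<close>

definition test_function :: "(real^'n::finite \<Rightarrow> real) \<Rightarrow> bool" where
  "test_function f \<longleftrightarrow>
     smooth f \<and> compact (closure {x. f x \<noteq> 0}) \<and> closure {x. f x \<noteq> 0} \<subseteq> Q_cube"


section \<open>Fields with values in \<open>\<real>\<^sup>K\<close>\<close>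

text \<open>The coordinates of \<open>\<real>\<^sup>K\<close> are indexed by the lists over 'n of length between 1 and d.
  A vector of \<open>\<real>\<^sup>K\<close> is a function on lists of which only the values on \<^term>\<open>K_index d\<close> matter.\<close>

definition K_index :: "nat \<Rightarrow> 'n::finite list set" where
  "K_index d = {\<alpha>. 1 \<le> length \<alpha> \<and> length \<alpha> \<le> d}"

definition K_norm :: "nat \<Rightarrow> ('n::finite list \<Rightarrow> real) \<Rightarrow> real" where
  "K_norm d a = L2_set a (K_index d)"

definition K_inner :: "nat \<Rightarrow> ('n::finite list \<Rightarrow> real) \<Rightarrow> ('n list \<Rightarrow> real) \<Rightarrow> real" where
  "K_inner d a b = (\<Sum>\<alpha>\<in>K_index d. a \<alpha> * b \<alpha>)"

type_synonym 'n field = "real^'n \<Rightarrow> 'n list \<Rightarrow> real"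

definition test_field :: "nat \<Rightarrow> 'n::finite field \<Rightarrow> bool" where
  "test_field d \<phi> \<longleftrightarrow> (\<forall>\<alpha>\<in>K_index d. test_function (\<lambda>x. \<phi> x \<alpha>))"


section \<open>The operator and its formal adjoint\<close>

text \<open>The matrix \<open>B\<^sup>h\<close> has the entries \<open>B h \<alpha> \<beta>\<close>, where \<open>\<alpha>\<close> and \<open>\<beta>\<close> have length h; other
  values of \<open>B\<close> are never used.\<close>

type_synonym 'n coeffs = "nat \<Rightarrow> 'n list \<Rightarrow> 'n list \<Rightarrow> real"

definition op_B :: "'n::finite coeffs \<Rightarrow> (real^'n \<Rightarrow> real) \<Rightarrow> 'n field" where
  "op_B B \<phi> x \<alpha> =
     (\<Sum>\<beta> | length \<beta> = length \<alpha>. B (length \<alpha>) \<alpha> \<beta> * partial_derivs \<beta> \<phi> x)"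

text \<open>The distribution obtained by applying the formal adjoint to \<open>v\<close> is represented by the
  function \<open>w\<close>.\<close>

definition is_adjoint :: "nat \<Rightarrow> 'n::finite coeffs \<Rightarrow> 'n field \<Rightarrow> (real^'n \<Rightarrow> real) \<Rightarrow> bool" where
  "is_adjoint d B v w \<longleftrightarrow>
     (\<forall>\<phi>. test_function \<phi> \<longrightarrow>
        (\<integral>x. K_inner d (op_B B \<phi> x) (v x) \<partial>Q_measure) = (\<integral>x. \<phi> x * w x \<partial>Q_measure))"

text \<open>The representing integrable function, when there is one, is unique up to null sets. For
  a test field it is almost everywhere equal to the function given by the differential operator
  with the transposed matrices and the signs \<open>(-1)\<^sup>h\<close>.\<close>

definition adjoint_B :: "nat \<Rightarrow> 'n::finite coeffs \<Rightarrow> 'n field \<Rightarrow> real^'n \<Rightarrow> real" where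
  "adjoint_B d B v = (SOME w. integrable Q_measure w \<and> is_adjoint d B v w)"


section \<open>Function spaces\<close>

definition in_L :: "real \<Rightarrow> (real^'n::finite \<Rightarrow> real) \<Rightarrow> bool" where
  "in_L p f \<longleftrightarrow>
     f \<in> borel_measurable Q_measure \<and> integrable Q_measure (\<lambda>x. \<bar>f x\<bar> powr p)"

definition L_norm :: "real \<Rightarrow> (real^'n::finite \<Rightarrow> real) \<Rightarrow> real" where
  "L_norm p f = (\<integral>x. \<bar>f x\<bar> powr p \<partial>Q_measure) powr (1 / p)"

definition in_L_field :: "nat \<Rightarrow> real \<Rightarrow> 'n::finite field \<Rightarrow> bool" where
  "in_L_field d q v \<longleftrightarrow>
     (\<forall>\<alpha>\<in>K_index d. (\<lambda>x. v x \<alpha>) \<in> borel_measurable Q_measure) \<and>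
     integrable Q_measure (\<lambda>x. K_norm d (v x) powr q)"

definition W_space :: "nat \<Rightarrow> real \<Rightarrow> 'n::finite coeffs \<Rightarrow> 'n field set" where
  "W_space d q B = {v. in_L_field d q v \<and> (\<exists>w. in_L q w \<and> is_adjoint d B v w)}"

definition W_norm :: "nat \<Rightarrow> real \<Rightarrow> 'n::finite coeffs \<Rightarrow> 'n field \<Rightarrow> real" where
  "W_norm d q B v =
     (L_norm q (\<lambda>x. K_norm d (v x)) powr q + L_norm q (adjoint_B d B v) powr q) powr (1 / q)"

definition W0_space :: "nat \<Rightarrow> real \<Rightarrow> 'n::finite coeffs \<Rightarrow> 'n field set" where
  "W0_space d q B =
     {v \<in> W_space d q B.
        \<forall>e>0. \<exists>\<phi>. test_field d \<phi> \<and> W_norm d q B (\<lambda>x \<alpha>. v x \<alpha> - \<phi> x \<alpha>) < e}"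

definition Linf_norm :: "nat \<Rightarrow> 'n::finite field \<Rightarrow> ereal" where
  "Linf_norm d v = esssup Q_measure (\<lambda>x. ereal (K_norm d (v x)))"


section \<open>The total variation functional and its subdifferential\<close>

definition PV :: "nat \<Rightarrow> 'n::finite coeffs \<Rightarrow> (real^'n \<Rightarrow> real) \<Rightarrow> ereal" where
  "PV d B u =
     (SUP \<phi>\<in>{\<phi>. test_field d \<phi> \<and> (\<forall>x. K_norm d (\<phi> x) \<le> 1)}.
        ereal (\<integral>x. u x * adjoint_B d B \<phi> x \<partial>Q_measure))"

definition BV_space :: "nat \<Rightarrow> 'n::finite coeffs \<Rightarrow> (real^'n \<Rightarrow> real) set" where
  "BV_space d B = {u. in_L 1 u \<and> PV d B u < \<infinity>}"

definition subdiff_PV ::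
  "nat \<Rightarrow> 'n::finite coeffs \<Rightarrow> real \<Rightarrow> real \<Rightarrow> (real^'n \<Rightarrow> real) \<Rightarrow> (real^'n \<Rightarrow> real) set" where
  "subdiff_PV d B p q u =
     {u'. in_L q u' \<and> PV d B u < \<infinity> \<and>
        (\<forall>w. in_L p w \<longrightarrow>
           ereal (\<integral>x. (w x - u x) * u' x \<partial>Q_measure) + PV d B u \<le> PV d B w)}"

end

theory Submission
  imports Defs
begin

text \<open>Write \<open>C\<close> for the convex set of all \<open>\<B>\<^sup>*\<phi>\<close> with a test field \<open>\<phi>\<close>, \<open>\<bar>\<phi>\<bar> \<le> 1\<close>, so that \<open>PV\<close> is the support
  function of \<open>C\<close>. By positive homogeneity, \<open>u'\<close> is a subgradient at \<open>u\<close> iff \<open>PV u = \<integral> u u'\<close> is finite and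
  \<open>\<integral> w u' \<le> PV w\<close> for all \<open>w\<close>.

  If this holds, then \<open>u'\<close> lies in the \<open>L\<^sup>q\<close>-closure of \<open>C\<close>: otherwise the point of the closure nearest
  to \<open>u'\<close> would produce a separating \<open>w\<close>. Among the fields \<open>\<phi>\<close> with \<open>\<B>\<^sup>*\<phi>\<close> close to \<open>u'\<close>, those of almost minimal
  \<open>L\<^sup>2\<close> norm form a Cauchy sequence by the parallelogram identity; their limit is the required \<open>v\<close>.

  Conversely, the fields approximating \<open>v \<in> W\<^sub>0\<^sup>q[\<B>]\<close> need not satisfy \<open>\<bar>\<phi>\<bar> \<le> 1\<close>. Instead \<open>v\<close> is contracted
  towards the centre of the cube by a factor \<open>t < 1\<close> and then mollified, where the components of order \<open>h\<close>
  are multiplied by \<open>t\<^sup>h\<close>. This preserves \<open>\<bar>v\<bar> \<le> 1\<close> and, by the weights \<open>t\<^sup>h\<close>, turns \<open>\<B>\<^sup>*v\<close> into its own contraction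
  and mollification, although \<open>\<B>\<close> mixes derivatives of different orders. Membership in \<open>W\<^sub>0\<close> is what allows
  \<open>v\<close> to be extended by zero.\<close>

section \<open>Smooth functions and test functions\<close>

text \<open>Why an energy is minimised: many fields can have nearly the same adjoint, and a sequence
  of them with \<bar>\<phi>\<bar> \<le> 1 is merely bounded. Weak compactness would give some limit,
  but membership in W0 asks for convergence in norm, for the fields and their adjoints together.
  Minimising a Hilbert norm selects fields that converge strongly. Why the cube is contracted:
  mollification alone would push supports across the boundary. Cutting v off near the boundary fails
  for d \<ge> 2, since the adjoint of a product with a cutoff contains lower order derivatives of v,
  over which the adjoint of v gives no control. A contraction towards the centre creates the margin
  without multiplying v by anything that varies. Why W0 is used as it is: moving the smoothing to
  the other factor turns a test function into a smooth function that need not vanish at the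
  boundary. The adjoint identity must therefore hold against all smooth functions, and this stronger
  identity is what limits of test fields inherit.\<close>

lemma partial_derivs_append: "partial_derivs (xs @ ys) f = partial_derivs xs (partial_derivs ys f)"
  by (induction xs) auto

lemma smooth_differentiable: "smooth f \<Longrightarrow> partial_derivs is f differentiable (at x)"
  by (simp add: smooth_def)

lemma smooth_differentiable0: "smooth f \<Longrightarrow> f differentiable (at x)"
  using smooth_differentiable[of f "[]"] by simp

lemma smooth_partial_derivs: "smooth f \<Longrightarrow> smooth (partial_derivs is f)"
  by (simp add: smooth_def flip: partial_derivs_append)

lemma smooth_partial_deriv: "smooth f \<Longrightarrow> smooth (partial_deriv i f)"
  using smooth_partial_derivs[of f "[i]"] by simp

text \<open>Smoothness is the greatest class of differentiable functions that is stable under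
  partial derivatives. To prove it one exhibits an invariant class, and no closed formula for
  iterated derivatives is required.\<close>

lemma smooth_coinduct [consumes 1, case_names differentiable partial]:
  assumes "P f"
    and "\<And>f x. P f \<Longrightarrow> f differentiable (at x)"
    and "\<And>f i. P f \<Longrightarrow> P (partial_deriv i f)"
  shows "smooth f"
proof -
  have "P (partial_derivs is f)" for "is"
    by (induction "is") (use assms in auto)
  with assms(2) show ?thesis by (auto simp: smooth_def)
qed

lemma smooth_continuous_on: "smooth f \<Longrightarrow> continuous_on S f"
  by (simp add: continuous_at_imp_continuous_on differentiable_imp_continuous_within smooth_differentiable0)

section \<open>Rules of differentiation and the algebra of smooth functions\<close>

lemma partial_deriv_eqI:
  "(f has_derivative D) (at x) \<Longrightarrow> partial_deriv i f x = D (axis i 1)"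
  unfolding partial_deriv_def by (metis frechet_derivative_at)

lemma differentiable_has_derivative:
  "f differentiable (at x) \<Longrightarrow> (f has_derivative frechet_derivative f (at x)) (at x)"
  by (simp add: frechet_derivative_works)

lemma partial_deriv_const [simp]: "partial_deriv i (\<lambda>x. c) = (\<lambda>x. 0)"
  by (rule ext, rule partial_deriv_eqI[where D = "\<lambda>h. 0"]) simp

lemma partial_deriv_add:
  assumes "\<And>x. f differentiable (at x)" "\<And>x. g differentiable (at x)"
  shows "partial_deriv i (\<lambda>x. f x + g x) = (\<lambda>x. partial_deriv i f x + partial_deriv i g x)"
  by (rule ext, rule partial_deriv_eqI[OF has_derivative_add[OF assms[THEN differentiable_has_derivative],
        folded partial_deriv_def], THEN trans]) (simp add: partial_deriv_def)

lemma partial_deriv_mult: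
  assumes "\<And>x. f differentiable (at x)" "\<And>x. g differentiable (at x)"
  shows "partial_deriv i (\<lambda>x. f x * g x) = (\<lambda>x. f x * partial_deriv i g x + partial_deriv i f x * g x)"
  by (rule ext, rule partial_deriv_eqI[OF has_derivative_mult[OF assms[THEN differentiable_has_derivative],
        folded partial_deriv_def], THEN trans]) (simp add: partial_deriv_def)

lemma smooth_const: "smooth (\<lambda>x. c)"
  by (rule smooth_coinduct[where P = "\<lambda>f. \<exists>c. f = (\<lambda>x. c)"]) auto

text \<open>The derivative of a product is a sum of products, so products alone form no invariant
  class for \<open>smooth_coinduct\<close>. The closure under both operations is one, and this takes
  the place of the Leibniz formula.\<close>

inductive_set smooth_hull :: "(real^'n::finite \<Rightarrow> real) set" where
  base: "smooth f \<Longrightarrow> f \<in> smooth_hull"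
| add: "f \<in> smooth_hull \<Longrightarrow> g \<in> smooth_hull \<Longrightarrow> (\<lambda>x. f x + g x) \<in> smooth_hull"
| mult: "f \<in> smooth_hull \<Longrightarrow> g \<in> smooth_hull \<Longrightarrow> (\<lambda>x. f x * g x) \<in> smooth_hull"

lemma smooth_hull_step:
  assumes "f \<in> smooth_hull"
  shows "(\<forall>x. f differentiable (at x)) \<and> (\<forall>i. partial_deriv i f \<in> smooth_hull)"
  using assms
proof induction
  case (base f)
  then show ?case by (simp add: smooth_differentiable0 smooth_hull.base smooth_partial_deriv)
next
  case (add f g)
  then show ?case by (auto simp: partial_deriv_add intro: smooth_hull.intros)
next
  case (mult f g)
  then show ?case by (auto simp: partial_deriv_mult intro!: smooth_hull.intros(2,3))
qed

lemma smooth_hull_imp_smooth: "f \<in> smooth_hull \<Longrightarrow> smooth f"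
  by (erule smooth_coinduct) (auto simp: smooth_hull_step)

lemma smooth_add: "smooth f \<Longrightarrow> smooth g \<Longrightarrow> smooth (\<lambda>x. f x + g x)"
  by (rule smooth_hull_imp_smooth) (intro smooth_hull.add smooth_hull.base)

lemma smooth_mult: "smooth f \<Longrightarrow> smooth g \<Longrightarrow> smooth (\<lambda>x. f x * g x)"
  by (rule smooth_hull_imp_smooth) (intro smooth_hull.mult smooth_hull.base)

lemma smooth_sum: "(\<And>a. a \<in> A \<Longrightarrow> smooth (f a)) \<Longrightarrow> smooth (\<lambda>x. \<Sum>a\<in>A. f a x)"
  by (induction A rule: infinite_finite_induct) (auto intro: smooth_add smooth_const)

lemma smooth_prod: "(\<And>a. a \<in> A \<Longrightarrow> smooth (f a)) \<Longrightarrow> smooth (\<lambda>x. \<Prod>a\<in>A. f a x)"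
  by (induction A rule: infinite_finite_induct) (auto intro: smooth_mult smooth_const)

lemma partial_derivs_add:
  assumes "smooth f" "smooth g"
  shows "partial_derivs is (\<lambda>x. f x + g x) = (\<lambda>x. partial_derivs is f x + partial_derivs is g x)"
  using assms by (induction "is") (auto simp: partial_deriv_add smooth_differentiable)

lemma partial_derivs_cmult:
  assumes "smooth f"
  shows "partial_derivs is (\<lambda>x. c * f x) = (\<lambda>x. c * partial_derivs is f x)"
  using assms by (induction "is") (auto simp: partial_deriv_mult smooth_differentiable)

lemma test_function_smooth: "test_function f \<Longrightarrow> smooth f"
  by (simp add: test_function_def)

lemma support_subset_test:
  assumes "test_function f" "smooth g" "{x. g x \<noteq> 0} \<subseteq> closure {x. f x \<noteq> 0}"
  shows "test_function g"
proof -
  have "closure {x. g x \<noteq> 0} \<subseteq> closure {x. f x \<noteq> 0}"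
    using assms(3) by (simp add: closure_minimal)
  moreover from this have "compact (closure {x. g x \<noteq> 0})"
    using assms(1) compact_Int_closed[of "closure {x. f x \<noteq> 0}" "closure {x. g x \<noteq> 0}"]
    by (simp add: test_function_def inf.absorb2)
  ultimately show ?thesis
    using assms unfolding test_function_def by blast
qed

lemma test_function_of_compact_support:
  assumes "smooth f" "compact S" "S \<subseteq> Q_cube" "\<And>x. f x \<noteq> 0 \<Longrightarrow> x \<in> S"
  shows "test_function f"
proof -
  have "closure {x. f x \<noteq> 0} \<subseteq> S"
    using assms by (intro closure_minimal) (auto intro: compact_imp_closed)
  moreover from this have "compact (closure {x. f x \<noteq> 0})"
    using assms(2) compact_Int_closed[of S "closure {x. f x \<noteq> 0}"]
    by (simp add: inf.absorb2)
  ultimately show ?thesis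
    using assms unfolding test_function_def by blast
qed

lemma test_function_mult: "test_function f \<Longrightarrow> smooth g \<Longrightarrow> test_function (\<lambda>x. f x * g x)"
proof (rule support_subset_test[of f])
  assume "test_function f" "smooth g"
  then show "smooth (\<lambda>x. f x * g x)" by (simp add: smooth_mult test_function_smooth)
  have "{x. f x * g x \<noteq> 0} \<subseteq> {x. f x \<noteq> 0}" by auto
  then show "{x. f x * g x \<noteq> 0} \<subseteq> closure {x. f x \<noteq> 0}" by (rule order_trans) (rule closure_subset)
qed

lemma test_function_zero: "test_function (\<lambda>x. 0)"
  by (simp add: test_function_def smooth_const)

lemma test_function_add:
  assumes "test_function f" "test_function g" shows "test_function (\<lambda>x. f x + g x)"
proof (rule test_function_of_compact_support[where S = "closure {x. f x \<noteq> 0} \<union> closure {x. g x \<noteq> 0}"])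
  show "x \<in> closure {x. f x \<noteq> 0} \<union> closure {x. g x \<noteq> 0}" if "f x + g x \<noteq> 0" for x
  proof -
    have "f x \<noteq> 0 \<or> g x \<noteq> 0" using that by auto
    then show ?thesis
      using closure_subset[of "{x. f x \<noteq> 0}"] closure_subset[of "{x. g x \<noteq> 0}"] by blast
  qed
qed (use assms in \<open>simp_all add: test_function_def smooth_add compact_Un\<close>)

lemma test_function_cmult: "test_function f \<Longrightarrow> test_function (\<lambda>x. c * f x)"
  using test_function_mult[of f "\<lambda>x. c"] by (simp add: mult.commute smooth_const)

lemma test_function_sum: "(\<And>a. a \<in> A \<Longrightarrow> test_function (f a)) \<Longrightarrow> test_function (\<lambda>x. \<Sum>a\<in>A. f a x)"
  by (induction A rule: infinite_finite_induct) (auto intro: test_function_add test_function_zero)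

lemma partial_deriv_support:
  assumes "x \<notin> closure {x. f x \<noteq> 0}"
  shows "partial_deriv i f x = 0"
proof -
  have "(f has_derivative (\<lambda>h. 0)) (at x)"
  proof (rule has_derivative_transform_within_open)
    show "((\<lambda>x. 0) has_derivative (\<lambda>h. 0)) (at x)" by simp
    show "open (- closure {x. f x \<noteq> 0})" by (rule open_Compl) (rule closed_closure)
    show "x \<in> - closure {x. f x \<noteq> 0}" using assms by simp
    show "0 = f y" if "y \<in> - closure {x. f x \<noteq> 0}" for y
      using that closure_subset[of "{x. f x \<noteq> 0}"] by auto
  qed
  then show ?thesis by (rule partial_deriv_eqI)
qed

lemma test_function_partial_deriv:
  assumes "test_function f" shows "test_function (partial_deriv i f)"
proof (rule support_subset_test[OF assms])
  show "smooth (partial_deriv i f)" by (simp add: assms smooth_partial_deriv test_function_smooth)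
  show "{x. partial_deriv i f x \<noteq> 0} \<subseteq> closure {x. f x \<noteq> 0}"
    using partial_deriv_support[of _ f i] by blast
qed

lemma test_function_partial_derivs: "test_function f \<Longrightarrow> test_function (partial_derivs is f)"
  by (induction "is") (auto intro: test_function_partial_deriv)

lemma test_function_eq_0: "test_function f \<Longrightarrow> x \<notin> Q_cube \<Longrightarrow> f x = 0"
  using closure_subset[of "{x. f x \<noteq> 0}"] by (auto simp: test_function_def subset_iff)

section \<open>Uniform bounds: boundedness, Lipschitz and Taylor estimates\<close>

lemma smooth_bounded_on_compact:
  assumes "smooth f" "compact S" obtains C where "C \<ge> 0" "\<And>x. x \<in> S \<Longrightarrow> \<bar>f x\<bar> \<le> C"
proof -
  have "compact (f ` S)" using assms smooth_continuous_on compact_continuous_image by blast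
  then have "bounded (f ` S)" by (rule compact_imp_bounded)
  then obtain C where "\<And>x. x \<in> S \<Longrightarrow> \<bar>f x\<bar> \<le> C" by (auto simp: bounded_iff)
  then show ?thesis using that[of "max C 0"] by fastforce
qed

lemma test_function_bounded:
  assumes "test_function f" obtains C where "C \<ge> 0" "\<And>x. \<bar>f x\<bar> \<le> C"
proof -
  obtain C where C: "C \<ge> 0" "\<And>x. x \<in> closure {x. f x \<noteq> 0} \<Longrightarrow> \<bar>f x\<bar> \<le> C"
    using assms smooth_bounded_on_compact[of f "closure {x. f x \<noteq> 0}"] by (auto simp: test_function_def)
  have "\<bar>f x\<bar> \<le> C" for x using C closure_subset[of "{x. f x \<noteq> 0}"] by (cases "f x = 0") auto
  then show ?thesis using that C by blast
qed

lemma frechet_eq_sum_partial: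
  fixes f :: "real^'n::finite \<Rightarrow> real"
  assumes "f differentiable (at x)"
  shows "frechet_derivative f (at x) h = (\<Sum>i\<in>UNIV. h $ i * partial_deriv i f x)"
proof -
  interpret linear "frechet_derivative f (at x)"
    using assms linear_frechet_derivative by blast
  have "frechet_derivative f (at x) h = frechet_derivative f (at x) (\<Sum>i\<in>UNIV. h $ i *\<^sub>R axis i 1)"
    using basis_expansion[of h] by (simp add: scalar_mult_eq_scaleR)
  also have "\<dots> = (\<Sum>i\<in>UNIV. h $ i * partial_deriv i f x)"
    by (simp add: sum scale partial_deriv_def)
  finally show ?thesis .
qed

text \<open>The partial derivatives are test functions and hence bounded on the whole space; the
  mean value inequality does the rest.\<close>

lemma test_function_lipschitz:
  fixes f :: "real^'n::finite \<Rightarrow> real"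
  assumes "test_function f"
  obtains L where "L \<ge> 0" "\<And>x y. \<bar>f x - f y\<bar> \<le> L * norm (x - y)"
proof -
  have "\<forall>i. \<exists>C\<ge>0. \<forall>x. \<bar>partial_deriv i f x\<bar> \<le> C"
    by (meson test_function_bounded[OF test_function_partial_deriv[OF assms]])
  then obtain C where C: "\<And>i. C i \<ge> 0" "\<And>i x. \<bar>partial_deriv i f x\<bar> \<le> C i" by metis
  have d: "f differentiable (at x)" for x
    using assms by (simp add: smooth_differentiable0 test_function_smooth)
  have "\<bar>frechet_derivative f (at x) h\<bar> \<le> (\<Sum>i\<in>UNIV. C i) * norm h" for x h
  proof -
    have "\<bar>frechet_derivative f (at x) h\<bar> \<le> (\<Sum>i\<in>UNIV. \<bar>h $ i * partial_deriv i f x\<bar>)"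
      unfolding frechet_eq_sum_partial[OF d] by (rule sum_abs)
    also have "\<dots> \<le> (\<Sum>i\<in>UNIV. C i * norm h)"
      unfolding abs_mult mult.commute[of "\<bar>h $ _\<bar>"]
      by (intro sum_mono mult_mono) (use C component_le_norm_cart[of h] in auto)
    finally show ?thesis by (simp add: sum_distrib_right)
  qed
  then have "onorm (frechet_derivative f (at x)) \<le> (\<Sum>i\<in>UNIV. C i)" for x
    by (intro onorm_bound) (auto simp: C sum_nonneg)
  then have "norm (f x - f y) \<le> (\<Sum>i\<in>UNIV. C i) * norm (x - y)" for x y
    using differentiable_bound[of UNIV f "\<lambda>x. frechet_derivative f (at x)" "\<Sum>i\<in>UNIV. C i" x y]
      d[THEN differentiable_has_derivative] by auto
  then show ?thesis using that[of "\<Sum>i\<in>UNIV. C i"] C by (auto simp: sum_nonneg)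
qed

text \<open>The gradient is itself Lipschitz, so the remainder is quadratic with a constant
  independent of x. This uniformity is what later allows differentiation under the integral
  sign.\<close>

lemma test_function_taylor:
  fixes f :: "real^'n::finite \<Rightarrow> real"
  assumes "test_function f"
  obtains L where "L \<ge> 0"
    "\<And>x h. \<bar>f (x + h) - f x - frechet_derivative f (at x) h\<bar> \<le> L * (norm h)\<^sup>2"
proof -
  have "\<forall>i. \<exists>C\<ge>0. \<forall>x y. \<bar>partial_deriv i f x - partial_deriv i f y\<bar> \<le> C * norm (x - y)"
    by (meson test_function_lipschitz[OF test_function_partial_deriv[OF assms]])
  then obtain C where C: "\<And>i. C i \<ge> 0"
      "\<And>i x y. \<bar>partial_deriv i f x - partial_deriv i f y\<bar> \<le> C i * norm (x - y)" by metis
  have L0: "(\<Sum>i\<in>UNIV. C i) \<ge> 0" by (simp add: C(1) sum_nonneg)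
  have d: "f differentiable (at x)" for x
    using assms by (simp add: smooth_differentiable0 test_function_smooth)
  define L where "L = (\<Sum>i\<in>UNIV. C i)"
  have "\<bar>frechet_derivative f (at x) h - frechet_derivative f (at y) h\<bar> \<le> L * norm (x - y) * norm h" for x y h
  proof -
    have "\<bar>frechet_derivative f (at x) h - frechet_derivative f (at y) h\<bar>
        = \<bar>\<Sum>i\<in>UNIV. h $ i * (partial_deriv i f x - partial_deriv i f y)\<bar>"
      unfolding frechet_eq_sum_partial[OF d] by (simp add: right_diff_distrib sum_subtractf)
    also have "\<dots> \<le> (\<Sum>i\<in>UNIV. \<bar>h $ i * (partial_deriv i f x - partial_deriv i f y)\<bar>)"
      by (rule sum_abs)
    also have "\<dots> \<le> (\<Sum>i\<in>UNIV. norm h * (C i * norm (x - y)))"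
      unfolding abs_mult by (intro sum_mono mult_mono) (use C component_le_norm_cart[of h] in auto)
    also have "\<dots> = L * norm (x - y) * norm h"
      by (simp add: L_def sum_distrib_right sum_distrib_left mult_ac)
    finally show ?thesis .
  qed
  then have on: "onorm (frechet_derivative f (at x) - frechet_derivative f (at y)) \<le> L * norm (x - y)" for x y
    using L0 by (intro onorm_bound) (auto simp: L_def)
  have "norm (f (x + h) - f x - frechet_derivative f (at x) h) \<le> norm (x + h - x) * (L * norm h)" for x h
  proof -
    have "norm (f (x + h) - f x - frechet_derivative f (at x) (x + h - x)) \<le> norm (x + h - x) * (L * norm h)"
    proof (rule differentiable_bound_linearization[where S = "closed_segment x (x + h)" and f' = "\<lambda>x. frechet_derivative f (at x)"])
      show "(f has_derivative frechet_derivative f (at y)) (at y within closed_segment x (x + h))" for y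
        using d differentiable_has_derivative has_derivative_at_withinI by blast
      show "onorm (frechet_derivative f (at y) - frechet_derivative f (at x)) \<le> L * norm h"
        if "y \<in> closed_segment x (x + h)" for y
      proof -
        have "norm (y - x) \<le> norm h" using segment_bound1[OF that] by simp
        then show ?thesis
          by (intro order_trans[OF on[of y x]] mult_left_mono) (use L0 in \<open>simp_all add: L_def\<close>)
      qed
      show "x + t *\<^sub>R (x + h - x) \<in> closed_segment x (x + h)" if "t \<in> {0..1}" for t
        unfolding in_segment using that by (intro exI[of _ t]) (simp add: algebra_simps)
    qed simp
    then show ?thesis by simp
  qed
  then have "\<bar>f (x + h) - f x - frechet_derivative f (at x) h\<bar> \<le> L * (norm h)\<^sup>2" for x h
    by (simp add: power2_eq_square mult_ac)
  with L0 show ?thesis using that[of L] by (simp add: L_def)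
qed

section \<open>Bump functions\<close>

text \<open>The polynomial is carried along because the functions P(1/s) exp(-1/s), extended by 0,
  form a family stable under differentiation. \<open>flat_exp 1\<close> is the usual flat
  function.\<close>

definition flat_exp :: "real poly \<Rightarrow> real \<Rightarrow> real" where
  "flat_exp P s = (if s > 0 then poly P (1 / s) * exp (- (1 / s)) else 0)"

text \<open>With y = 1/s one has d/ds = - y^2 d/dy, so P exp(-y) becomes y^2 (P - P') exp(-y), and
  \<open>[:0, 0, 1:]\<close> is y^2. At s = 0 the exponential beats every polynomial in y.\<close>

lemma flat_exp_has_derivative:
  "(flat_exp P has_real_derivative flat_exp ([:0, 0, 1:] * (P - pderiv P)) s) (at s)"
proof -
  consider "s > 0" | "s < 0" | "s = 0" by linarith
  then show ?thesis
  proof cases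
    case 1
    have "((\<lambda>s. poly P (1 / s) * exp (- (1 / s))) has_real_derivative
       (poly (pderiv P) (1 / s) * (- (1 / s\<^sup>2)) * exp (- (1 / s)) + exp (- (1 / s)) * (1 / s\<^sup>2) * poly P (1 / s))) (at s)"
      using 1 by (auto intro!: derivative_eq_intros DERIV_chain2[OF poly_DERIV] simp: power2_eq_square)
    moreover have "eventually (\<lambda>t. t > 0) (nhds s)"
      using 1 by (simp add: eventually_nhds_in_open[of "{0<..}", simplified])
    then have "eventually (\<lambda>t. poly P (1 / t) * exp (- (1 / t)) = flat_exp P t) (nhds s)"
      by eventually_elim (simp add: flat_exp_def)
    ultimately have "(flat_exp P has_real_derivative
       (poly (pderiv P) (1 / s) * (- (1 / s\<^sup>2)) * exp (- (1 / s)) + exp (- (1 / s)) * (1 / s\<^sup>2) * poly P (1 / s))) (at s)"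
      by (rule DERIV_cong_ev[OF refl _ refl, THEN iffD1, rotated])
    moreover have "(poly (pderiv P) (1 / s) * (- (1 / s\<^sup>2)) * exp (- (1 / s)) + exp (- (1 / s)) * (1 / s\<^sup>2) * poly P (1 / s))
       = flat_exp ([:0, 0, 1:] * (P - pderiv P)) s"
      using 1 by (simp add: flat_exp_def field_simps power2_eq_square)
    ultimately show ?thesis by simp
  next
    case 2
    have "eventually (\<lambda>t. t < 0) (nhds s)"
      using 2 by (simp add: eventually_nhds_in_open[of "{..<0}", simplified])
    then have "eventually (\<lambda>t. 0 = flat_exp P t) (nhds s)"
      by eventually_elim (simp add: flat_exp_def)
    moreover have "((\<lambda>t. 0) has_real_derivative 0) (at s)" by simp
    ultimately have "(flat_exp P has_real_derivative 0) (at s)"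
      by (rule DERIV_cong_ev[OF refl _ refl, THEN iffD1])
    with 2 show ?thesis by (simp add: flat_exp_def)
  next
    case 3
    have lim: "((\<lambda>y. poly Q y * exp (- y)) \<longlongrightarrow> 0) at_top" for Q :: "real poly"
    proof -
      have "((\<lambda>y. coeff Q i * (y ^ i / exp y)) \<longlongrightarrow> coeff Q i * 0) at_top" for i
        by (intro tendsto_mult tendsto_const tendsto_power_div_exp_0)
      then have "((\<lambda>y. \<Sum>i\<le>degree Q. coeff Q i * (y ^ i / exp y)) \<longlongrightarrow> (\<Sum>i\<le>degree Q. 0)) at_top"
        by (intro tendsto_sum) simp
      moreover have "(\<Sum>i\<le>degree Q. coeff Q i * (y ^ i / exp y)) = poly Q y * exp (- y)" for y :: real
        by (simp add: poly_altdef sum_distrib_left exp_minus divide_inverse mult_ac)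
      ultimately show ?thesis by simp
    qed
    \<comment> \<open>Dividing by h multiplies by y = 1/h, and \<open>pCons 0 P\<close> is the
      polynomial y P(y).\<close>
    have "((\<lambda>h. poly (pCons 0 P) (inverse h) * exp (- inverse h)) \<longlongrightarrow> 0) (at_right (0::real))"
      using filterlim_compose[OF lim filterlim_inverse_at_top_right] .
    moreover have "eventually (\<lambda>h. poly (pCons 0 P) (inverse h) * exp (- inverse h) = flat_exp P h / h) (at_right (0::real))"
      using eventually_at_right_less[of "0::real"]
      by eventually_elim (simp add: flat_exp_def field_simps)
    ultimately have r: "((\<lambda>h. flat_exp P h / h) \<longlongrightarrow> 0) (at_right (0::real))"
      using tendsto_cong by force
    have "eventually (\<lambda>h. 0 = flat_exp P h / h) (at_left (0::real))"
      by (simp add: flat_exp_def eventually_at_filter)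
    then have l: "((\<lambda>h. flat_exp P h / h) \<longlongrightarrow> 0) (at_left (0::real))"
      by (rule tendsto_cong[THEN iffD1]) simp
    have "((\<lambda>h. flat_exp P h / h) \<longlongrightarrow> 0) (at 0)"
      using l r by (simp add: filterlim_split_at_real)
    then have "((\<lambda>h. (flat_exp P (0 + h) - flat_exp P 0) / h) \<longlongrightarrow> 0) (at 0)"
      by (simp add: flat_exp_def)
    with 3 show ?thesis by (simp add: DERIV_def flat_exp_def)
  qed
qed

lemma smooth_flat_exp_affine: "smooth (\<lambda>x::real^'n::finite. flat_exp P (c * x $ i + b))"
proof -
  \<comment> \<open>The scalar \<open>a\<close> collects the inner derivatives produced by the chain
    rule, including the value 0 for directions other than \<open>i\<close>.\<close>
  define F where "F = (\<lambda>f. \<exists>a P. f = (\<lambda>x::real^'n. a * flat_exp P (c * x $ i + b)))"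
  have D: "((\<lambda>x::real^'n. a * flat_exp P (c * x $ i + b)) has_derivative
      (\<lambda>h. a * (flat_exp ([:0, 0, 1:] * (P - pderiv P)) (c * x $ i + b) * (c * h $ i)))) (at x)" for a P x
  proof -
    have "((\<lambda>x::real^'n. c * x $ i + b) has_derivative (\<lambda>h. c * h $ i)) (at x)"
      by (auto intro!: derivative_eq_intros bounded_linear_imp_has_derivative bounded_linear_vec_nth)
    from has_derivative_compose[OF this, of "flat_exp P"] flat_exp_has_derivative
    have "((\<lambda>x::real^'n. flat_exp P (c * x $ i + b)) has_derivative
      (\<lambda>h. flat_exp ([:0, 0, 1:] * (P - pderiv P)) (c * x $ i + b) * (c * h $ i))) (at x)"
      unfolding has_field_derivative_def by blast
    then show ?thesis by (rule has_derivative_mult_right)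
  qed
  have "F (\<lambda>x::real^'n. flat_exp P (c * x $ i + b))"
    unfolding F_def by (intro exI[of _ 1] exI[of _ P]) simp
  then show ?thesis
  proof (rule smooth_coinduct)
    fix f x assume "F f" then show "f differentiable (at x)"
      using D by (auto simp: F_def differentiable_def)
  next
    fix f j assume "F f"
    then obtain a P where f: "f = (\<lambda>x::real^'n. a * flat_exp P (c * x $ i + b))" by (auto simp: F_def)
    have "partial_deriv j f = (\<lambda>x. (a * (c * (axis j 1 :: real^'n) $ i)) * flat_exp ([:0, 0, 1:] * (P - pderiv P)) (c * x $ i + b))"
      unfolding f by (rule ext) (simp add: partial_deriv_eqI[OF D] del: mult_pCons_left)
    then show "F (partial_deriv j f)" unfolding F_def by blast
  qed
qed

text \<open>In each coordinate the arguments are n (x - a) - 1 and n (b - x) - 1. The offset -1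
  keeps the support at distance 1/n from the faces, while the factor n drives the values inside the
  box to 1. The expressions are expanded so that they match
  \<open>smooth_flat_exp_affine\<close>.\<close>

definition box_bump :: "real \<Rightarrow> real^'n::finite \<Rightarrow> real^'n \<Rightarrow> real^'n \<Rightarrow> real" where
  "box_bump n a b x = (\<Prod>i\<in>UNIV. flat_exp 1 (n * x $ i + (- n * a $ i - 1)) * flat_exp 1 (- n * x $ i + (n * b $ i - 1)))"

lemma smooth_box_bump: "smooth (box_bump n a b)"
  unfolding box_bump_def[abs_def] by (intro smooth_prod smooth_mult smooth_flat_exp_affine)

lemma flat_exp_1: "flat_exp 1 s = (if s > 0 then exp (- (1 / s)) else 0)"
  by (simp add: flat_exp_def)

lemma box_bump_bounds: "0 \<le> box_bump n a b x" "box_bump n a b x \<le> 1"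
  unfolding box_bump_def by (auto intro!: prod_nonneg prod_le_1 mult_le_one simp: flat_exp_1)

lemma box_bump_support:
  assumes "n > 0" "box_bump n a b x \<noteq> 0"
  shows "x \<in> cbox (a + (\<chi> i. 1 / n)) (b - (\<chi> i. 1 / n))"
proof -
  have "0 < n * x $ i + (- n * a $ i - 1)" "0 < - n * x $ i + (n * b $ i - 1)" for i
    using assms(2) by (auto simp: box_bump_def flat_exp_1 split: if_splits)
  then have "a $ i + 1 / n \<le> x $ i" "x $ i \<le> b $ i - 1 / n" for i
    using assms(1) by (simp_all add: field_simps less_imp_le)
  then show ?thesis by (simp add: mem_box_cart)
qed

lemma box_bump_tendsto:
  "(\<lambda>n. box_bump (real n) a b x) \<longlonglongrightarrow> indicat_real (box a b) x"
proof (cases "x \<in> box a b")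
  case True
  have lim: "(\<lambda>n. flat_exp 1 (real n * c - 1)) \<longlonglongrightarrow> 1" if "c > 0" for c
  proof -
    have "filterlim (\<lambda>n. real n * c - 1) at_top sequentially"
      using that by real_asymp
    then have "(\<lambda>n. exp (- (1 / (real n * c - 1)))) \<longlonglongrightarrow> 1"
      using that by real_asymp
    moreover have "eventually (\<lambda>n. real n * c - 1 > 0) sequentially"
      using that by real_asymp
    then have "eventually (\<lambda>n. exp (- (1 / (real n * c - 1))) = flat_exp 1 (real n * c - 1)) sequentially"
      by eventually_elim (simp add: flat_exp_1)
    ultimately show ?thesis using tendsto_cong by force
  qed
  have "(\<lambda>n. \<Prod>i\<in>UNIV. flat_exp 1 (real n * (x $ i - a $ i) - 1) * flat_exp 1 (real n * (b $ i - x $ i) - 1))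
     \<longlonglongrightarrow> (\<Prod>i\<in>(UNIV::'a set). 1 * 1)"
    using True by (intro tendsto_prod tendsto_mult lim) (auto simp: mem_box_cart)
  with True show ?thesis by (simp add: box_bump_def algebra_simps)
next
  case False
  have "box_bump (real n) a b x = 0" for n
  proof (rule ccontr)
    assume nz: "box_bump (real n) a b x \<noteq> 0"
    \<comment> \<open>For n = 0 all arguments are -1; this case is split off because the margin 1/n
      is meaningless there.\<close>
    moreover have "box_bump 0 a b x = 0" by (simp add: box_bump_def flat_exp_1)
    ultimately have "n \<noteq> 0" by (metis of_nat_0)
    then have "0 < 1 / real n" by simp
    moreover have "a $ i + 1 / real n \<le> x $ i \<and> x $ i \<le> b $ i - 1 / real n" for i
      using box_bump_support[OF _ nz] \<open>n \<noteq> 0\<close> by (simp add: mem_box_cart)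
    ultimately have "a $ i < x $ i \<and> x $ i < b $ i" for i
      by (smt (verit, best))
    then have "x \<in> box a b" by (simp add: mem_box_cart)
    with False show False by simp
  qed
  with False show ?thesis by simp
qed

lemma mollifier_exists:
  assumes "e > 0"
  obtains \<rho> :: "real^'n::finite \<Rightarrow> real" where "smooth \<rho>" "\<And>x. \<rho> x \<ge> 0"
    "\<And>x i. \<rho> x \<noteq> 0 \<Longrightarrow> \<bar>x $ i - c $ i\<bar> \<le> e"
    "integrable lborel \<rho>" "(\<integral>x. \<rho> x \<partial>lborel) = 1"
proof -
  \<comment> \<open>On the concentric cube of half side e/2 every argument of
    \<open>flat_exp\<close> exceeds n (e/2) - 1 = 1, so the bump is positive on a set of positive
    measure and can be normalised.\<close>
  define n where "n = 4 / e"
  have n: "n > 0" using assms by (simp add: n_def)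
  define E where "E = ((\<chi> i. e) :: real^'n)"
  define f where "f = box_bump n (c - E) (c + E)"
  have f: "smooth f" "\<And>x. f x \<ge> 0" by (simp_all add: f_def smooth_box_bump box_bump_bounds)
  have supp: "x \<in> cbox (c - E) (c + E)" if "f x \<noteq> 0" for x
  proof -
    have "x \<in> cbox (c - E + (\<chi> i. 1 / n)) (c + E - (\<chi> i. 1 / n))"
      using that by (intro box_bump_support n) (simp add: f_def)
    then show ?thesis using n by (simp add: mem_box_cart) (smt (verit, best) divide_pos_pos)
  qed
  have int: "integrable lborel f"
  proof -
    have "integrable lborel (\<lambda>x. indicator (cbox (c - E) (c + E)) x *\<^sub>R f x)"
      by (intro borel_integrable_compact smooth_continuous_on f compact_cbox)
    moreover have "(\<lambda>x. indicator (cbox (c - E) (c + E)) x *\<^sub>R f x) = f"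
    proof (rule ext)
      show "indicator (cbox (c - E) (c + E)) x *\<^sub>R f x = f x" for x
        by (cases "f x = 0") (auto dest: supp)
    qed
    ultimately show ?thesis by simp
  qed
  have pos: "f x > 0" if "x \<in> box (c - (\<chi> i. e / 2)) (c + (\<chi> i. e / 2))" for x
  proof -
    have "0 < n * x $ i + (- n * (c - E) $ i - 1)" "0 < - n * x $ i + (n * (c + E) $ i - 1)" for i
    proof -
      have "c $ i - e / 2 < x $ i" "x $ i < c $ i + e / 2" using that by (auto simp: mem_box_cart)
      then have "e / 2 < x $ i - c $ i + e" "e / 2 < c $ i + e - x $ i" by auto
      then have "n * (e / 2) < n * (x $ i - c $ i + e)" "n * (e / 2) < n * (c $ i + e - x $ i)" using n by auto
      moreover have "n * (e / 2) = 2" using assms by (simp add: n_def)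
      ultimately show "0 < n * x $ i + (- n * (c - E) $ i - 1)" "0 < - n * x $ i + (n * (c + E) $ i - 1)"
        by (auto simp: E_def algebra_simps)
    qed
    then show ?thesis unfolding f_def box_bump_def by (auto intro!: prod_pos simp: flat_exp_1)
  qed
  have "(\<integral>x. f x \<partial>lborel) \<noteq> 0"
  proof
    assume "(\<integral>x. f x \<partial>lborel) = 0"
    then have "AE x in lborel. f x = 0"
      using integral_nonneg_eq_0_iff_AE[OF int] f(2) by auto
    then have "AE x in lborel. (x :: real^'n) \<notin> box (c - (\<chi> i. e / 2)) (c + (\<chi> i. e / 2))"
      by eventually_elim (use pos in force)
    then have "emeasure lborel (box (c - (\<chi> i. e / 2)) (c + (\<chi> i. e / 2)) :: (real^'n) set) = 0"
      by (subst (asm) AE_iff_measurable[OF _ refl]) auto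
    moreover have "((c + (\<chi> i. e / 2)) - (c - (\<chi> i. e / 2)) :: real^'n) \<bullet> b = e" if "b \<in> Basis" for b
      using that by (auto simp: Basis_vec_def inner_axis)
    then have "(\<Prod>b\<in>Basis. ((c + (\<chi> i. e / 2)) - (c - (\<chi> i. e / 2)) :: real^'n) \<bullet> b) > 0"
      using assms by (intro prod_pos) auto
    moreover have "(c - (\<chi> i. e / 2) :: real^'n) \<bullet> b \<le> (c + (\<chi> i. e / 2)) \<bullet> b" if "b \<in> Basis" for b
      using that assms by (auto simp: Basis_vec_def inner_axis inner_diff_left inner_add_left)
    ultimately show False
      by (subst (asm) emeasure_lborel_box) (simp_all add: ennreal_eq_0_iff)
  qed
  moreover have "(\<integral>x. f x \<partial>lborel) \<ge> 0" using f by (simp add: integral_nonneg)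
  ultimately have I: "(\<integral>x. f x \<partial>lborel) > 0" by simp
  define \<rho> where "\<rho> x = (1 / (\<integral>x. f x \<partial>lborel)) * f x" for x
  show ?thesis
  proof (rule that[of \<rho>])
    show "smooth \<rho>" unfolding \<rho>_def[abs_def] using f smooth_mult smooth_const by blast
    show "\<rho> x \<ge> 0" for x using f I by (simp add: \<rho>_def)
    show "\<bar>x $ i - c $ i\<bar> \<le> e" if "\<rho> x \<noteq> 0" for x i
    proof -
      have "c $ i - e \<le> x $ i \<and> x $ i \<le> c $ i + e"
        using supp[of x] that by (auto simp: \<rho>_def E_def mem_box_cart)
      then show ?thesis by linarith
    qed
    show "integrable lborel \<rho>" unfolding \<rho>_def[abs_def] using int by simp
    show "(\<integral>x. \<rho> x \<partial>lborel) = 1" unfolding \<rho>_def using I by simp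
  qed
qed

section \<open>Integration by parts\<close>

lemma Q_cube_eq_box: "Q_cube = box 0 (1 :: real^'n::finite)"
  by (auto simp: Q_cube_def mem_box_cart)

lemma Q_cube_subset: "Q_cube \<subseteq> cbox 0 (1 :: real^'n::finite)"
  by (simp add: Q_cube_eq_box box_subset_cbox)

lemma Q_cube_measurable [measurable]: "Q_cube \<in> sets lebesgue" "Q_cube \<in> sets borel"
  by (simp_all add: Q_cube_eq_box)

lemma finite_measure_Q: "finite_measure (Q_measure :: (real^'n::finite) measure)"
  by (intro finite_measure_lebesgue_on) (simp add: Q_cube_eq_box)

lemma borel_measurable_Q: "f \<in> borel_measurable borel \<Longrightarrow> f \<in> borel_measurable Q_measure"
  by (rule measurable_restrict_space1) (simp add: measurable_completion)

lemma id_measurable_Q: "(\<lambda>x. x) \<in> Q_measure \<rightarrow>\<^sub>M borel"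
  by (rule measurable_restrict_space1) (simp add: measurable_completion)

lemma smooth_borel_measurable: "smooth f \<Longrightarrow> f \<in> borel_measurable borel"
  by (simp add: borel_measurable_continuous_onI smooth_continuous_on)

lemma smooth_measurable_Q: "smooth f \<Longrightarrow> f \<in> borel_measurable Q_measure"
  by (simp add: borel_measurable_Q smooth_borel_measurable)

text \<open>\<open>Q_measure\<close> restricts the completed Lebesgue measure. Translations and
  affine substitutions are carried out in \<open>lborel\<close>, and this is the bridge for Borel
  functions that vanish off the cube.\<close>

lemma integral_Q_eq_lborel:
  fixes f :: "real^'n::finite \<Rightarrow> real"
  assumes "f \<in> borel_measurable borel" "\<And>x. x \<notin> Q_cube \<Longrightarrow> f x = 0"
  shows "(\<integral>x. f x \<partial>Q_measure) = (\<integral>x. f x \<partial>lborel)"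
    and "integrable Q_measure f \<longleftrightarrow> integrable lborel f"
proof -
  have eq: "(\<lambda>x. indicator Q_cube x *\<^sub>R f x) = f"
    by (rule ext) (use assms(2) in \<open>auto simp: indicator_def\<close>)
  have "(\<integral>x. f x \<partial>Q_measure) = (\<integral>x. indicator Q_cube x *\<^sub>R f x \<partial>lebesgue)"
    by (rule integral_restrict_space) simp
  with eq assms(1) show "(\<integral>x. f x \<partial>Q_measure) = (\<integral>x. f x \<partial>lborel)" by (simp add: integral_completion)
  have "integrable Q_measure f \<longleftrightarrow> integrable lebesgue (\<lambda>x. indicator Q_cube x *\<^sub>R f x)"
    by (rule integrable_restrict_space) simp
  with eq assms(1) show "integrable Q_measure f \<longleftrightarrow> integrable lborel f" by (simp add: integrable_completion)
qed

lemma test_function_integrable_lborel: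
  assumes "test_function f" shows "integrable lborel f"
proof -
  have "integrable lborel (\<lambda>x. indicator (closure {x. f x \<noteq> 0}) x *\<^sub>R f x)"
    using assms by (intro borel_integrable_compact smooth_continuous_on) (auto simp: test_function_def)
  moreover have "(\<lambda>x. indicator (closure {x. f x \<noteq> 0}) x *\<^sub>R f x) = f"
    by (rule ext) (use closure_subset[of "{x. f x \<noteq> 0}"] in \<open>auto simp: indicator_def subset_iff\<close>)
  ultimately show ?thesis by simp
qed

lemma test_function_integral_Q: "test_function f \<Longrightarrow> (\<integral>x. f x \<partial>Q_measure) = (\<integral>x. f x \<partial>lborel)"
  by (intro integral_Q_eq_lborel) (auto simp: smooth_borel_measurable test_function_smooth test_function_eq_0)

lemma test_function_integrable: "test_function f \<Longrightarrow> integrable Q_measure f"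
  by (subst integral_Q_eq_lborel(2))
    (auto simp: smooth_borel_measurable test_function_smooth test_function_eq_0 test_function_integrable_lborel)

lemma lborel_integral_translate:
  fixes f :: "'a::euclidean_space \<Rightarrow> real"
  assumes [measurable]: "f \<in> borel_measurable borel"
  shows "(\<integral>x. f (c + x) \<partial>lborel) = (\<integral>x. f x \<partial>lborel)"
proof -
  have "(\<integral>x. f x \<partial>lborel) = (\<integral>x. f x \<partial>distr lborel borel ((+) c))"
    by (simp add: lborel_distr_plus)
  also have "\<dots> = (\<integral>x. f (c + x) \<partial>lborel)"
    by (subst integral_distr) auto
  finally show ?thesis by simp
qed

lemma lborel_integrable_translate:
  fixes f :: "'a::euclidean_space \<Rightarrow> real"
  assumes "integrable lborel f"
  shows "integrable lborel (\<lambda>x. f (c + x))"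
proof -
  have "integrable (distr lborel borel ((+) c)) f" using assms by (simp add: lborel_distr_plus)
  then show ?thesis by (subst (asm) integrable_distr_eq) (use assms in auto)
qed

text \<open>The difference quotients have integral 0 by translation invariance.\<close>

lemma integral_partial_deriv_eq_0:
  fixes f :: "real^'n::finite \<Rightarrow> real"
  assumes f: "test_function f"
  shows "(\<integral>x. partial_deriv i f x \<partial>lborel) = 0"
proof -
  obtain L where L: "L \<ge> 0" "\<And>x y. \<bar>f x - f y\<bar> \<le> L * norm (x - y)"
    using test_function_lipschitz[OF f] by blast
  define h where "h n = inverse (real (Suc n))" for n
  have h: "h n > 0" "h n \<le> 1" for n by (simp_all add: h_def field_simps)
  define D where "D n x = (f (h n *\<^sub>R axis i 1 + x) - f x) / h n" for n x
  have [measurable]: "f \<in> borel_measurable borel"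
    by (simp add: f smooth_borel_measurable test_function_smooth)
  have bm: "partial_deriv i f \<in> borel_measurable lborel"
    by (simp add: f smooth_borel_measurable smooth_partial_deriv test_function_smooth)
  have D0: "(\<integral>x. D n x \<partial>lborel) = 0" for n
  proof -
    have "(\<integral>x. D n x \<partial>lborel) = ((\<integral>x. f (h n *\<^sub>R axis i 1 + x) \<partial>lborel) - (\<integral>x. f x \<partial>lborel)) / h n"
      unfolding D_def using test_function_integrable_lborel[OF f]
      by (simp add: lborel_integrable_translate)
    then show ?thesis by (simp add: lborel_integral_translate)
  qed
  have "(\<lambda>n. \<integral>x. D n x \<partial>lborel) \<longlonglongrightarrow> (\<integral>x. partial_deriv i f x \<partial>lborel)"
  \<comment> \<open>The box from -1 to 1 contains the cube and all its shifts by at most 1 in the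
    negative i-th direction, hence the supports of all the difference quotients.\<close>
  proof (rule integral_dominated_convergence[where w = "\<lambda>x. indicator (cbox (- 1) 1) x *\<^sub>R L"])
    show "AE x in lborel. (\<lambda>n. D n x) \<longlonglongrightarrow> partial_deriv i f x"
    proof (rule AE_I2)
      fix x
      have "(f has_derivative frechet_derivative f (at x)) (at x)"
        by (simp add: differentiable_has_derivative f smooth_differentiable0 test_function_smooth)
      then have "((\<lambda>t. f (x + t *\<^sub>R axis i 1)) has_real_derivative partial_deriv i f x) (at 0)"
      proof -
        assume d: "(f has_derivative frechet_derivative f (at x)) (at x)"
        have "((\<lambda>t. x + t *\<^sub>R axis i 1) has_derivative (\<lambda>t. t *\<^sub>R axis i 1)) (at 0)"
          by (auto intro!: derivative_eq_intros)
        from has_derivative_compose[OF this, of f "frechet_derivative f (at x)"] d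
        have "((\<lambda>t. f (x + t *\<^sub>R axis i 1)) has_derivative (\<lambda>t. frechet_derivative f (at x) (t *\<^sub>R axis i 1))) (at 0)"
          by simp
        moreover have "frechet_derivative f (at x) (t *\<^sub>R axis i 1) = partial_deriv i f x * t" for t
          using linear_frechet_derivative[OF differentiableI[OF d]]
          by (simp add: partial_deriv_def linear_scale)
        ultimately show ?thesis by (simp add: has_field_derivative_def)
      qed
      then have lim: "(\<lambda>t. (f (x + t *\<^sub>R axis i 1) - f x) / t) \<midarrow>0\<rightarrow> partial_deriv i f x"
        by (simp add: DERIV_def)
      have "filterlim h (at 0) sequentially"
      proof -
        have "h \<longlonglongrightarrow> 0" unfolding h_def by (rule LIMSEQ_inverse_real_of_nat)
        then show ?thesis using h(1) by (simp add: filterlim_at less_imp_neq[symmetric])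
      qed
      from filterlim_compose[OF lim this] show "(\<lambda>n. D n x) \<longlonglongrightarrow> partial_deriv i f x"
        by (simp add: D_def add.commute)
    qed
    show "AE x in lborel. norm (D n x) \<le> indicator (cbox (- 1) 1) x *\<^sub>R L" for n
    proof (rule AE_I2)
      fix x
      have "\<bar>D n x\<bar> \<le> L"
        using L(2)[of "h n *\<^sub>R axis i 1 + x" x] h[of n]
        by (simp add: D_def norm_axis_1 field_simps)
      moreover have "D n x = 0" if "x \<notin> cbox (- 1) 1"
      proof -
        have "x \<notin> Q_cube" using that by (auto simp: Q_cube_def mem_box_cart) (smt (verit))+
        moreover have "h n *\<^sub>R axis i 1 + x \<notin> Q_cube"
        proof
          assume q: "h n *\<^sub>R axis i 1 + x \<in> Q_cube"
          have "-1 \<le> x $ j \<and> x $ j \<le> 1" for j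
            using q[unfolded Q_cube_def, simplified, rule_format, of j] h[of n]
            by (cases "i = j") (auto simp: axis_def)
          with that show False by (auto simp: mem_box_cart)
        qed
        ultimately show ?thesis by (simp add: D_def test_function_eq_0[OF f])
      qed
      ultimately show "norm (D n x) \<le> indicator (cbox (- 1) 1) x *\<^sub>R L"
        by (cases "x \<in> cbox (- 1) 1") auto
    qed
    show "integrable lborel (\<lambda>x. indicator (cbox (- 1) 1) x *\<^sub>R L)"
      by (intro borel_integrable_compact) auto
    show "D n \<in> borel_measurable lborel" for n unfolding D_def by measurable
  qed (rule bm)
  then show ?thesis using D0 by (simp add: LIMSEQ_const_iff)
qed

lemma integration_by_parts:
  assumes f: "test_function f" and g: "smooth g"
  shows "(\<integral>x. f x * partial_deriv i g x \<partial>Q_measure) = - (\<integral>x. partial_deriv i f x * g x \<partial>Q_measure)"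
proof -
  have d: "\<And>x. f differentiable (at x)" "\<And>x. g differentiable (at x)"
    using f g by (auto simp: smooth_differentiable0 test_function_smooth)
  have t: "test_function (\<lambda>x. f x * partial_deriv i g x)" "test_function (\<lambda>x. partial_deriv i f x * g x)"
    using f g by (auto intro: test_function_mult test_function_partial_deriv smooth_partial_deriv)
  have "0 = (\<integral>x. f x * partial_deriv i g x + partial_deriv i f x * g x \<partial>lborel)"
    using integral_partial_deriv_eq_0[OF test_function_mult[OF f g], of i] by (simp add: partial_deriv_mult d)
  also have "\<dots> = (\<integral>x. f x * partial_deriv i g x \<partial>lborel) + (\<integral>x. partial_deriv i f x * g x \<partial>lborel)"
    using t by (intro Bochner_Integration.integral_add test_function_integrable_lborel)
  finally show ?thesis using t[THEN test_function_integral_Q] by simp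
qed

text \<open>The outermost derivative of g is moved first and becomes the innermost one on f, so the
  list arrives reversed.\<close>

lemma integration_by_parts_iterated:
  assumes "test_function f" "smooth g"
  shows "(\<integral>x. f x * partial_derivs \<beta> g x \<partial>Q_measure)
    = (-1) ^ length \<beta> * (\<integral>x. partial_derivs (rev \<beta>) f x * g x \<partial>Q_measure)"
  using assms
proof (induction \<beta> arbitrary: f)
  case (Cons i \<beta>)
  have "(\<integral>x. f x * partial_derivs (i # \<beta>) g x \<partial>Q_measure)
     = - (\<integral>x. partial_deriv i f x * partial_derivs \<beta> g x \<partial>Q_measure)"
    using integration_by_parts[OF Cons.prems(1) smooth_partial_derivs[OF Cons.prems(2)]] by simp
  also have "\<dots> = - ((-1) ^ length \<beta> * (\<integral>x. partial_derivs (rev \<beta>) (partial_deriv i f) x * g x \<partial>Q_measure))"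
    using Cons by (simp add: test_function_partial_deriv)
  finally show ?case by (simp add: partial_derivs_append)
qed simp

section \<open>Uniqueness of the adjoint\<close>

text \<open>Bumps supported strictly inside the box are test functions bounded by 1 and tend to its
  indicator, so dominated convergence applies with bound \<bar>f\<bar>.\<close>

lemma integral_box_eq_0:
  fixes f :: "real^'n::finite \<Rightarrow> real"
  assumes f: "integrable Q_measure f"
    and 0: "\<And>\<phi>. test_function \<phi> \<Longrightarrow> (\<integral>x. \<phi> x * f x \<partial>Q_measure) = 0"
  shows "(\<integral>x. indicator (box a b) x * f x \<partial>Q_measure) = 0"
proof -
  \<comment> \<open>Clipping the box to the unit cube leaves its indicator unchanged on the cube and
    moves the supports of the bumps into it.\<close>
  define a' where "a' = ((\<chi> i. max (a $ i) 0) :: real^'n)"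
  define b' where "b' = ((\<chi> i. min (b $ i) 1) :: real^'n)"
  have box: "indicat_real (box a' b') x = indicat_real (box a b) x" if "x \<in> Q_cube" for x
    using that by (auto simp: indicator_def mem_box_cart Q_cube_def a'_def b'_def)
  have t: "test_function (box_bump (real (Suc n)) a' b')" for n
  proof (rule test_function_of_compact_support)
    show "cbox (a' + (\<chi> i. 1 / real (Suc n))) (b' - (\<chi> i. 1 / real (Suc n))) \<subseteq> Q_cube"
    proof
      fix x assume x: "x \<in> cbox (a' + (\<chi> i. 1 / real (Suc n))) (b' - (\<chi> i. 1 / real (Suc n)))"
      have "0 < 1 / real (Suc n)" by simp
      moreover have "0 \<le> a' $ i" "b' $ i \<le> 1" for i by (auto simp: a'_def b'_def)
      moreover have "a' $ i + 1 / real (Suc n) \<le> x $ i" "x $ i \<le> b' $ i - 1 / real (Suc n)" for i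
        using x by (auto simp: mem_box_cart)
      ultimately have "0 < x $ i \<and> x $ i < 1" for i
        by (smt (verit, best))
      then show "x \<in> Q_cube" by (simp add: Q_cube_def)
    qed
  qed (auto simp: smooth_box_bump dest: box_bump_support[rotated])
  have "(\<lambda>n. \<integral>x. box_bump (real (Suc n)) a' b' x * f x \<partial>Q_measure) \<longlonglongrightarrow> (\<integral>x. indicator (box a' b') x * f x \<partial>Q_measure)"
  proof (rule integral_dominated_convergence[where w = "\<lambda>x. \<bar>f x\<bar>"])
    show "(\<lambda>x. box_bump (real (Suc n)) a' b' x * f x) \<in> borel_measurable Q_measure" for n
      by (intro borel_measurable_times smooth_measurable_Q smooth_box_bump borel_measurable_integrable[OF f])
    show "AE x in Q_measure. (\<lambda>n. box_bump (real (Suc n)) a' b' x * f x) \<longlonglongrightarrow> indicator (box a' b') x * f x"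
      by (intro AE_I2 tendsto_mult_right LIMSEQ_Suc box_bump_tendsto)
    show "AE x in Q_measure. norm (box_bump (real (Suc n)) a' b' x * f x) \<le> \<bar>f x\<bar>" for n
      by (intro AE_I2) (auto simp: abs_mult box_bump_bounds intro!: mult_left_le_one_le)
    show "(\<lambda>x. indicator (box a' b') x * f x) \<in> borel_measurable Q_measure"
      by (intro borel_measurable_times borel_measurable_Q borel_measurable_integrable[OF f]) auto
  qed (use f in auto)
  then have "(\<integral>x. indicator (box a' b') x * f x \<partial>Q_measure) = 0"
    using 0[OF t] by (simp add: LIMSEQ_const_iff)
  moreover have "(\<integral>x. indicator (box a' b') x * f x \<partial>Q_measure) = (\<integral>x. indicator (box a b) x * f x \<partial>Q_measure)"
    by (intro Bochner_Integration.integral_cong) (auto simp: box)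
  ultimately show ?thesis by simp
qed

text \<open>This is the fundamental lemma of the calculus of variations. The set function given by
  integrating f vanishes on boxes, which are stable under intersection and generate the Borel sets,
  so it vanishes identically.\<close>

lemma AE_eq_0_of_test_integrals:
  fixes f :: "real^'n::finite \<Rightarrow> real"
  assumes f: "integrable Q_measure f"
    and 0: "\<And>\<phi>. test_function \<phi> \<Longrightarrow> (\<integral>x. \<phi> x * f x \<partial>Q_measure) = 0"
  shows "AE x in Q_measure. f x = 0"
proof -
  define F where "F x = indicator Q_cube x *\<^sub>R f x" for x
  have F: "integrable lebesgue F"
    using f by (subst (asm) integrable_restrict_space) (auto simp: F_def[abs_def])
  \<comment> \<open>Boxes generate only the Borel sets, so the Lebesgue measurable extension of f is
    replaced by a Borel version.\<close>
  then obtain g where g: "g \<in> borel_measurable lborel" and ae: "AE x in lborel. F x = g x"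
    using completion_ex_borel_measurable_real[of F lborel] by auto
  from ae have ae': "AE x in lebesgue. F x = g x" by (rule AE_completion)
  have gl: "g \<in> borel_measurable lebesgue" using g by (rule measurable_completion)
  have "integrable lebesgue g"
    using F ae' gl borel_measurable_integrable[OF F] by (metis integrable_cong_AE_imp)
  then have gi: "integrable lborel g" using g by (simp add: integrable_completion)
  have set: "(LINT x:A|lborel. g x) = (\<integral>x. indicator A x * f x \<partial>Q_measure)" if A: "A \<in> sets borel" for A
  proof -
    have [measurable]: "indicat_real A \<in> borel_measurable lebesgue"
      using A by (intro measurable_completion) simp
    have "(LINT x:A|lborel. g x) = (\<integral>x. indicator A x *\<^sub>R g x \<partial>lebesgue)"
      unfolding set_lebesgue_integral_def using A g by (subst integral_completion) auto
    also have "\<dots> = (\<integral>x. indicator A x *\<^sub>R F x \<partial>lebesgue)"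
      by (rule integral_cong_AE) (use gl F ae' in \<open>auto elim: AE_mp\<close>)
    also have "\<dots> = (\<integral>x. indicator Q_cube x *\<^sub>R (indicator A x * f x) \<partial>lebesgue)"
      by (simp add: F_def mult_ac)
    also have "\<dots> = (\<integral>x. indicator A x * f x \<partial>Q_measure)"
      by (rule integral_restrict_space[symmetric]) simp
    finally show ?thesis .
  qed
  have si: "set_integrable lborel A g" if "A \<in> sets borel" for A
    unfolding set_integrable_def by (rule integrable_mult_indicator) (use that gi in simp_all)
  have all: "(LINT x:A|lborel. g x) = 0" if "A \<in> sets borel" for A
  proof -
    have 1: "Int_stable (range (\<lambda>(a, b). box a b :: (real^'n) set))"
      unfolding Int_stable_def by (auto simp: box_Int_box)
    have 2: "A \<in> sigma_sets UNIV (range (\<lambda>(a, b). box a b :: (real^'n) set))"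
      using that by (simp add: borel_eq_box)
    show ?thesis
    proof (rule sigma_sets_induct_disjoint[OF 1 _ 2, where P = "\<lambda>A. (LINT x:A|lborel. g x) = 0"])
      fix A assume "A \<in> range (\<lambda>(a, b). box a b :: (real^'n) set)"
      then show "(LINT x:A|lborel. g x) = 0" using integral_box_eq_0[OF f 0] set by auto
    next
      fix A assume compl: "A \<in> sigma_sets UNIV (range (\<lambda>(a, b). box a b :: (real^'n) set))" "(LINT x:A|lborel. g x) = 0"
      then have m: "A \<in> sets borel" by (simp add: borel_eq_box)
      \<comment> \<open>Complements require the integral over the whole space to vanish; it equals
        the integral over the cube, which is itself a box.\<close>
      have "(LINT x:UNIV|lborel. g x) = (\<integral>x. indicator UNIV x * f x \<partial>Q_measure)" by (rule set) simp
      also have "\<dots> = (\<integral>x. indicator (box 0 1) x * f x \<partial>Q_measure)"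
        by (intro Bochner_Integration.integral_cong) (auto simp flip: Q_cube_eq_box)
      also have "\<dots> = 0" using f 0 by (rule integral_box_eq_0)
      also have "(LINT x:UNIV|lborel. g x) = (LINT x:A|lborel. g x) + (LINT x:UNIV - A|lborel. g x)"
        by (subst set_integral_Un[symmetric])
          (use m in \<open>auto intro!: si\<close>)
      finally show "(LINT x:UNIV - A|lborel. g x) = 0" using compl by simp
    next
      fix A :: "nat \<Rightarrow> (real^'n) set"
      assume union: "disjoint_family A" "range A \<subseteq> sigma_sets UNIV (range (\<lambda>(a, b). box a b :: (real^'n) set))"
        "\<And>i. (LINT x:A i|lborel. g x) = 0"
      then have m: "A i \<in> sets lborel" for i by (auto simp: borel_eq_box)
      have "(LINT x:(\<Union>i. A i)|lborel. g x) = (\<Sum>i. LINT x:A i|lborel. g x)"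
        by (rule lebesgue_integral_countable_add)
          (use m union(1) in \<open>auto simp: disjoint_family_on_def intro!: si\<close>)
      with union show "(LINT x:(\<Union>i. A i)|lborel. g x) = 0" by simp
    qed (simp_all add: set_lebesgue_integral_def)
  qed
  have "AE x in lborel. g x = 0" by (rule density_unique_real[OF gi]) (simp_all add: all)
  then have "AE x in lebesgue. g x = 0" by (rule AE_completion)
  with ae' have "AE x in lebesgue. F x = 0" by eventually_elim simp
  then have "AE x in lebesgue. x \<in> Q_cube \<longrightarrow> f x = 0"
    by eventually_elim (auto simp: F_def)
  then show ?thesis by (subst AE_restrict_space_iff) auto
qed

lemma finite_K_index [simp]: "finite (K_index d :: 'n::finite list set)"
proof -
  have "K_index d \<subseteq> {xs :: 'n list. set xs \<subseteq> UNIV \<and> length xs \<le> d}" by (auto simp: K_index_def)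
  then show ?thesis by (rule finite_subset) (rule finite_lists_length_le, simp)
qed

lemma finite_lists_length [simp]: "finite {\<beta> :: 'n::finite list. length \<beta> = h}"
  using finite_lists_length_eq[of "UNIV :: 'n set" h] by simp

section \<open>Well-definedness of the adjoint and its explicit form on test fields\<close>

lemma adjoint_unique:
  assumes "integrable Q_measure w" "is_adjoint d B v w" "integrable Q_measure w'" "is_adjoint d B v w'"
  shows "AE x in Q_measure. w x = w' x"
proof -
  have "AE x in Q_measure. w x - w' x = 0"
  proof (rule AE_eq_0_of_test_integrals)
    fix \<phi> :: "real^'a \<Rightarrow> real" assume t: "test_function \<phi>"
    obtain C where C: "\<And>x. \<bar>\<phi> x\<bar> \<le> C" using test_function_bounded[OF t] by blast
    have i: "integrable Q_measure (\<lambda>x. \<phi> x * f x)" if "integrable Q_measure f" for f :: "real^'a \<Rightarrow> real"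
    proof (rule Bochner_Integration.integrable_bound)
      show "integrable Q_measure (\<lambda>x. C * f x)" using that by simp
      show "(\<lambda>x. \<phi> x * f x) \<in> borel_measurable Q_measure"
        by (intro borel_measurable_times smooth_measurable_Q test_function_smooth t borel_measurable_integrable that)
      have "\<bar>\<phi> x\<bar> \<le> \<bar>C\<bar>" for x using C[of x] by linarith
      then show "AE x in Q_measure. norm (\<phi> x * f x) \<le> norm (C * f x)"
        by (intro AE_I2) (simp add: abs_mult mult_right_mono)
    qed
    show "(\<integral>x. \<phi> x * (w x - w' x) \<partial>Q_measure) = 0"
      using assms t i by (simp add: is_adjoint_def right_diff_distrib)
  qed (use assms in simp)
  then show ?thesis by simp
qed

text \<open>As soon as one integrable representative is known, the choice made in
  \<open>adjoint_B\<close> is determined up to a null set. Later computations exchange it for a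
  concrete representative in this way.\<close>

lemma adjoint_B_eq:
  assumes "integrable Q_measure w" "is_adjoint d B v w"
  shows "AE x in Q_measure. adjoint_B d B v x = w x"
    and "integrable Q_measure (adjoint_B d B v)" "is_adjoint d B v (adjoint_B d B v)"
proof -
  have *: "integrable Q_measure (adjoint_B d B v) \<and> is_adjoint d B v (adjoint_B d B v)"
    unfolding adjoint_B_def by (rule someI[of _ w]) (use assms in simp)
  then show "integrable Q_measure (adjoint_B d B v)" "is_adjoint d B v (adjoint_B d B v)" by auto
  with assms show "AE x in Q_measure. adjoint_B d B v x = w x" by (intro adjoint_unique)
qed

text \<open>The formal adjoint as a genuine differential operator: smooth everywhere and linear
  pointwise, whereas \<open>adjoint_B\<close> is only known almost everywhere. The signs and the
  reversed lists come from \<open>integration_by_parts_iterated\<close>.\<close>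

definition test_adjoint :: "nat \<Rightarrow> 'n::finite coeffs \<Rightarrow> 'n field \<Rightarrow> real^'n \<Rightarrow> real" where
  "test_adjoint d B \<phi> x = (\<Sum>\<alpha>\<in>K_index d. \<Sum>\<beta> | length \<beta> = length \<alpha>.
      ((-1) ^ length \<beta> * B (length \<alpha>) \<alpha> \<beta>) * partial_derivs (rev \<beta>) (\<lambda>y. \<phi> y \<alpha>) x)"

lemma test_function_test_adjoint: "test_field d \<phi> \<Longrightarrow> test_function (test_adjoint d B \<phi>)"
  unfolding test_adjoint_def[abs_def] test_field_def
  by (intro test_function_sum test_function_cmult test_function_partial_derivs) auto

lemma test_adjoint_linear:
  assumes "test_field d \<phi>" "test_field d \<psi>"
  shows "test_adjoint d B (\<lambda>x \<alpha>. a * \<phi> x \<alpha> + b * \<psi> x \<alpha>) x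
    = a * test_adjoint d B \<phi> x + b * test_adjoint d B \<psi> x"
proof -
  have "partial_derivs \<beta> (\<lambda>y. a * \<phi> y \<alpha> + b * \<psi> y \<alpha>) x
      = a * partial_derivs \<beta> (\<lambda>y. \<phi> y \<alpha>) x + b * partial_derivs \<beta> (\<lambda>y. \<psi> y \<alpha>) x"
    if "\<alpha> \<in> K_index d" for \<alpha> \<beta>
  proof -
    have s: "smooth (\<lambda>y. \<phi> y \<alpha>)" "smooth (\<lambda>y. \<psi> y \<alpha>)"
      using assms that by (auto simp: test_field_def intro: test_function_smooth)
    have "smooth (\<lambda>y. a * \<phi> y \<alpha>)" "smooth (\<lambda>y. b * \<psi> y \<alpha>)"
      using s by (auto intro: smooth_mult[OF smooth_const])
    with s show ?thesis by (simp add: partial_derivs_add partial_derivs_cmult)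
  qed
  then show ?thesis
    by (simp add: test_adjoint_def sum_distrib_left sum.distrib distrib_left mult_ac cong: sum.cong)
qed

lemma smooth_op_B: "smooth \<Phi> \<Longrightarrow> smooth (\<lambda>x. op_B B \<Phi> x \<alpha>)"
  unfolding op_B_def by (intro smooth_sum smooth_mult smooth_const smooth_partial_derivs)

text \<open>The compact support of \<phi> absorbs all boundary terms, so \<Phi> may be any smooth
  function. This generality is what survives in the closure W0.\<close>

lemma integral_op_B_test_field:
  assumes \<phi>: "test_field d \<phi>" and \<Phi>: "smooth \<Phi>"
  shows "(\<integral>x. K_inner d (op_B B \<Phi> x) (\<phi> x) \<partial>Q_measure) = (\<integral>x. \<Phi> x * test_adjoint d B \<phi> x \<partial>Q_measure)"
proof -
  have t: "test_function (\<lambda>x. \<phi> x \<alpha>)" if "\<alpha> \<in> K_index d" for \<alpha>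
    using \<phi> that by (simp add: test_field_def)
  have i1: "integrable Q_measure (\<lambda>x. \<phi> x \<alpha> * partial_derivs \<beta> \<Phi> x)" if "\<alpha> \<in> K_index d" for \<alpha> \<beta>
    by (intro test_function_integrable test_function_mult t that smooth_partial_derivs \<Phi>)
  have i2: "integrable Q_measure (\<lambda>x. partial_derivs \<gamma> (\<lambda>y. \<phi> y \<alpha>) x * \<Phi> x)" if "\<alpha> \<in> K_index d" for \<alpha> \<gamma>
    by (intro test_function_integrable test_function_mult test_function_partial_derivs t that \<Phi>)
  have "(\<integral>x. K_inner d (op_B B \<Phi> x) (\<phi> x) \<partial>Q_measure)
      = (\<integral>x. (\<Sum>\<alpha>\<in>K_index d. \<Sum>\<beta> | length \<beta> = length \<alpha>. B (length \<alpha>) \<alpha> \<beta> * (\<phi> x \<alpha> * partial_derivs \<beta> \<Phi> x)) \<partial>Q_measure)"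
    by (simp add: K_inner_def op_B_def sum_distrib_right sum_distrib_left mult_ac)
  also have "\<dots> = (\<Sum>\<alpha>\<in>K_index d. \<Sum>\<beta> | length \<beta> = length \<alpha>.
        B (length \<alpha>) \<alpha> \<beta> * (\<integral>x. \<phi> x \<alpha> * partial_derivs \<beta> \<Phi> x \<partial>Q_measure))"
    by (subst Bochner_Integration.integral_sum, intro Bochner_Integration.integrable_sum integrable_mult_right i1, assumption)
      (simp add: i1 Bochner_Integration.integral_sum)
  also have "\<dots> = (\<Sum>\<alpha>\<in>K_index d. \<Sum>\<beta> | length \<beta> = length \<alpha>.
        ((-1) ^ length \<beta> * B (length \<alpha>) \<alpha> \<beta>) * (\<integral>x. partial_derivs (rev \<beta>) (\<lambda>y. \<phi> y \<alpha>) x * \<Phi> x \<partial>Q_measure))"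
    by (intro sum.cong refl) (simp add: integration_by_parts_iterated[OF t \<Phi>])
  also have "\<dots> = (\<integral>x. (\<Sum>\<alpha>\<in>K_index d. \<Sum>\<beta> | length \<beta> = length \<alpha>.
        ((-1) ^ length \<beta> * B (length \<alpha>) \<alpha> \<beta>) * (partial_derivs (rev \<beta>) (\<lambda>y. \<phi> y \<alpha>) x * \<Phi> x)) \<partial>Q_measure)"
    by (subst Bochner_Integration.integral_sum, intro Bochner_Integration.integrable_sum integrable_mult_right i2, assumption)
      (simp add: i2 Bochner_Integration.integral_sum)
  also have "\<dots> = (\<integral>x. \<Phi> x * test_adjoint d B \<phi> x \<partial>Q_measure)"
    by (simp add: test_adjoint_def sum_distrib_left mult_ac)
  finally show ?thesis .
qed

lemma is_adjoint_test_adjoint: "test_field d \<phi> \<Longrightarrow> is_adjoint d B \<phi> (test_adjoint d B \<phi>)"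
  by (simp add: is_adjoint_def integral_op_B_test_field test_function_smooth)

lemma adjoint_B_test_field:
  "test_field d \<phi> \<Longrightarrow> AE x in Q_measure. adjoint_B d B \<phi> x = test_adjoint d B \<phi> x"
  by (intro adjoint_B_eq(1) is_adjoint_test_adjoint test_function_integrable test_function_test_adjoint)

section \<open>Smoothness of parameter integrals\<close>

text \<open>Two instances are used below: the smoothing operator \<open>T\<close> with s = 1 and its
  transpose \<open>P\<close> with s = t. The powers of s produced by differentiation become the
  weights of the contraction.\<close>

context
  fixes M :: "'b measure" and m :: "'b \<Rightarrow> real" and b :: "'b \<Rightarrow> real^'n::finite" and s :: real
  assumes m: "integrable M m" and b: "b \<in> M \<rightarrow>\<^sub>M borel"
begin

lemma parameter_integrable:
  assumes "test_function \<kappa>"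
  shows "integrable M (\<lambda>y. \<kappa> (s *\<^sub>R x + b y) * m y)"
proof -
  obtain C where C: "\<And>x. \<bar>\<kappa> x\<bar> \<le> C" using test_function_bounded[OF assms] by blast
  have [measurable]: "\<kappa> \<in> borel_measurable borel"
    by (simp add: assms smooth_borel_measurable test_function_smooth)
  note b[measurable]
  have [measurable]: "m \<in> borel_measurable M" using m by simp
  show ?thesis
  proof (rule Bochner_Integration.integrable_bound)
    show "integrable M (\<lambda>y. C * m y)" using m by simp
    have "\<bar>\<kappa> x\<bar> \<le> \<bar>C\<bar>" for x using C[of x] by linarith
    then show "AE y in M. norm (\<kappa> (s *\<^sub>R x + b y) * m y) \<le> norm (C * m y)"
      by (intro AE_I2) (simp add: abs_mult mult_right_mono)
  qed measurable
qed

text \<open>Integrating the uniform Taylor estimate against m bounds the remainder by a constant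
  times the square of the norm of h.\<close>

lemma parameter_integral_has_derivative:
  assumes \<kappa>: "test_function \<kappa>"
  shows "((\<lambda>x. \<integral>y. \<kappa> (s *\<^sub>R x + b y) * m y \<partial>M) has_derivative
    (\<lambda>h. \<Sum>i\<in>UNIV. h $ i * (s * (\<integral>y. partial_deriv i \<kappa> (s *\<^sub>R x + b y) * m y \<partial>M)))) (at x)"
proof -
  define F where "F x = (\<integral>y. \<kappa> (s *\<^sub>R x + b y) * m y \<partial>M)" for x
  define D where "D h = (\<Sum>i\<in>UNIV. h $ i * (s * (\<integral>y. partial_deriv i \<kappa> (s *\<^sub>R x + b y) * m y \<partial>M)))" for h
  obtain L where L: "L \<ge> 0" "\<And>x h. \<bar>\<kappa> (x + h) - \<kappa> x - frechet_derivative \<kappa> (at x) h\<bar> \<le> L * (norm h)\<^sup>2"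
    using test_function_taylor[OF \<kappa>] by blast
  define I where "I = (\<integral>y. \<bar>m y\<bar> \<partial>M)"
  have I: "I \<ge> 0" by (simp add: I_def)
  have i: "integrable M (\<lambda>y. partial_deriv i \<kappa> (s *\<^sub>R x + b y) * m y)" for i
    by (intro parameter_integrable test_function_partial_deriv \<kappa>)
  have bound: "\<bar>F (x + h) - F x - D h\<bar> \<le> L * s\<^sup>2 * I * (norm h)\<^sup>2" for h
  proof -
    let ?R = "\<lambda>y. \<kappa> (s *\<^sub>R x + b y + s *\<^sub>R h) - \<kappa> (s *\<^sub>R x + b y) - frechet_derivative \<kappa> (at (s *\<^sub>R x + b y)) (s *\<^sub>R h)"
    have fr: "frechet_derivative \<kappa> (at z) (s *\<^sub>R h) = (\<Sum>i\<in>UNIV. h $ i * (s * partial_deriv i \<kappa> z))" for z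
      by (subst frechet_eq_sum_partial) (simp_all add: \<kappa> smooth_differentiable0 test_function_smooth mult_ac)
    have D: "D h = (\<integral>y. frechet_derivative \<kappa> (at (s *\<^sub>R x + b y)) (s *\<^sub>R h) * m y \<partial>M)"
      unfolding D_def fr sum_distrib_right using i by (simp add: mult.assoc)
    have iD: "integrable M (\<lambda>y. frechet_derivative \<kappa> (at (s *\<^sub>R x + b y)) (s *\<^sub>R h) * m y)"
      unfolding fr sum_distrib_right using i by (simp add: mult.assoc)
    have i1: "integrable M (\<lambda>y. \<kappa> (s *\<^sub>R x + b y) * m y)" "integrable M (\<lambda>y. \<kappa> (s *\<^sub>R (x + h) + b y) * m y)"
      by (intro parameter_integrable \<kappa>)+
    have "F (x + h) - F x - D h = (\<integral>y. \<kappa> (s *\<^sub>R (x + h) + b y) * m y - \<kappa> (s *\<^sub>R x + b y) * m y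
       - frechet_derivative \<kappa> (at (s *\<^sub>R x + b y)) (s *\<^sub>R h) * m y \<partial>M)"
      using i1 iD by (simp add: F_def D)
    also have "\<dots> = (\<integral>y. ?R y * m y \<partial>M)"
      by (simp add: algebra_simps)
    finally have "\<bar>F (x + h) - F x - D h\<bar> = \<bar>\<integral>y. ?R y * m y \<partial>M\<bar>" by simp
    also have "\<dots> \<le> (\<integral>y. \<bar>?R y * m y\<bar> \<partial>M)"
      by (rule integral_abs_bound)
    also have "\<dots> \<le> (\<integral>y. L * (norm (s *\<^sub>R h))\<^sup>2 * \<bar>m y\<bar> \<partial>M)"
    proof (rule integral_mono)
      have "integrable M (\<lambda>y. \<kappa> (s *\<^sub>R (x + h) + b y) * m y - \<kappa> (s *\<^sub>R x + b y) * m y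
       - frechet_derivative \<kappa> (at (s *\<^sub>R x + b y)) (s *\<^sub>R h) * m y)"
        using i1 iD by (intro Bochner_Integration.integrable_diff)
      then have "integrable M (\<lambda>y. ?R y * m y)" by (simp add: algebra_simps)
      then show "integrable M (\<lambda>y. \<bar>?R y * m y\<bar>)" by (rule integrable_abs)
      show "integrable M (\<lambda>y. L * (norm (s *\<^sub>R h))\<^sup>2 * \<bar>m y\<bar>)" using m by simp
      show "\<bar>?R y * m y\<bar> \<le> L * (norm (s *\<^sub>R h))\<^sup>2 * \<bar>m y\<bar>" for y
        unfolding abs_mult by (intro mult_right_mono L(2)) simp
    qed
    also have "\<dots> = L * s\<^sup>2 * I * (norm h)\<^sup>2" using m by (simp add: I_def power_mult_distrib)
    finally show ?thesis .
  qed
  \<comment> \<open>Adding 1 makes the constant positive, so that e / C is a valid radius.\<close>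
  define C where "C = L * s\<^sup>2 * I + 1"
  have C: "C > 0" using L I by (simp add: C_def add_nonneg_pos)
  have "(F has_derivative D) (at x)"
    unfolding has_derivative_at_alt
  proof (intro conjI allI impI)
    show "bounded_linear D" unfolding D_def
      by (intro bounded_linear_sum bounded_linear_mult_left[THEN bounded_linear_compose] bounded_linear_vec_nth)
    fix e :: real assume e: "e > 0"
    show "\<exists>d>0. \<forall>y. norm (y - x) < d \<longrightarrow> norm (F y - F x - D (y - x)) \<le> e * norm (y - x)"
    proof (intro exI[of _ "e / C"] conjI allI impI)
      show "e / C > 0" using e C by simp
      fix y assume y: "norm (y - x) < e / C"
      have "norm (F y - F x - D (y - x)) \<le> (L * s\<^sup>2 * I) * (norm (y - x))\<^sup>2"
        using bound[of "y - x"] by simp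
      also have "\<dots> \<le> (C * norm (y - x)) * norm (y - x)"
        by (simp add: C_def power2_eq_square distrib_right)
      also have "\<dots> \<le> e * norm (y - x)"
        using y C by (intro mult_right_mono) (auto simp: field_simps)
      finally show "norm (F y - F x - D (y - x)) \<le> e * norm (y - x)" .
    qed
  qed
  then show ?thesis by (simp add: F_def[abs_def] D_def[abs_def])
qed

lemma parameter_integral_partial_deriv:
  assumes "test_function \<kappa>"
  shows "partial_deriv i (\<lambda>x. \<integral>y. \<kappa> (s *\<^sub>R x + b y) * m y \<partial>M)
    = (\<lambda>x. s * (\<integral>y. partial_deriv i \<kappa> (s *\<^sub>R x + b y) * m y \<partial>M))"
  by (rule ext, rule partial_deriv_eqI[OF parameter_integral_has_derivative[OF assms], THEN trans])
    (simp add: axis_def if_distrib[of "\<lambda>x. x * _"] cong: if_cong)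

lemma smooth_parameter_integral:
  assumes "test_function \<kappa>"
  shows "smooth (\<lambda>x. \<integral>y. \<kappa> (s *\<^sub>R x + b y) * m y \<partial>M)"
proof -
  \<comment> \<open>The scalar \<open>c\<close> absorbs the factor s that each differentiation
    produces.\<close>
  define P where "P = (\<lambda>f. \<exists>\<kappa> c. test_function \<kappa> \<and> f = (\<lambda>x. c * (\<integral>y. \<kappa> (s *\<^sub>R x + b y) * m y \<partial>M)))"
  have d: "(\<lambda>x. \<integral>y. \<kappa> (s *\<^sub>R x + b y) * m y \<partial>M) differentiable (at x)" if "test_function \<kappa>" for \<kappa> x
    using parameter_integral_has_derivative[OF that] by (rule differentiableI)
  have "P (\<lambda>x. \<integral>y. \<kappa> (s *\<^sub>R x + b y) * m y \<partial>M)"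
    unfolding P_def by (intro exI[of _ \<kappa>] exI[of _ 1]) (simp add: assms)
  then show ?thesis
  proof (rule smooth_coinduct)
    show "f differentiable (at x)" if "P f" for f x
      using that d by (auto simp: P_def)
    show "P (partial_deriv i f)" if "P f" for f i
    proof -
      obtain \<kappa> c where \<kappa>: "test_function \<kappa>" "f = (\<lambda>x. c * (\<integral>y. \<kappa> (s *\<^sub>R x + b y) * m y \<partial>M))"
        using \<open>P f\<close> unfolding P_def by blast
      have "partial_deriv i f = (\<lambda>x. (c * s) * (\<integral>y. partial_deriv i \<kappa> (s *\<^sub>R x + b y) * m y \<partial>M))"
        unfolding \<kappa>(2) using d[OF \<kappa>(1)] by (simp add: partial_deriv_mult parameter_integral_partial_deriv[OF \<kappa>(1)] mult.assoc)
      with test_function_partial_deriv[OF \<kappa>(1)] show ?thesis unfolding P_def by blast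
    qed
  qed
qed

lemma parameter_integral_partial_derivs:
  assumes "test_function \<kappa>"
  shows "partial_derivs \<beta> (\<lambda>x. \<integral>y. \<kappa> (s *\<^sub>R x + b y) * m y \<partial>M)
    = (\<lambda>x. s ^ length \<beta> * (\<integral>y. partial_derivs \<beta> \<kappa> (s *\<^sub>R x + b y) * m y \<partial>M))"
proof (induction \<beta>)
  case (Cons i \<beta>)
  have t: "test_function (partial_derivs \<beta> \<kappa>)" using assms by (rule test_function_partial_derivs)
  show ?case
    by (simp add: Cons partial_deriv_mult smooth_differentiable0[OF smooth_parameter_integral[OF t]]
        parameter_integral_partial_deriv[OF t] mult.assoc mult.left_commute)
qed simp

end

section \<open>Inequalities for powers\<close>

text \<open>With exponent q - 1 this is the derivative of \<bar>x\<bar>^q / q, and applied pointwise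
  it is the duality map from L^q to L^p.\<close>

definition signed_powr :: "real \<Rightarrow> real \<Rightarrow> real" where
  "signed_powr x r = sgn x * \<bar>x\<bar> powr r"

lemma abs_signed_powr: "\<bar>signed_powr x r\<bar> = \<bar>x\<bar> powr r"
  by (simp add: signed_powr_def abs_mult sgn_if)

lemma signed_powr_mult_self: "signed_powr x (q - 1) * x = \<bar>x\<bar> powr q"
proof -
  have "signed_powr x (q - 1) * x = \<bar>x\<bar> powr (q - 1) * \<bar>x\<bar>"
    by (simp add: signed_powr_def sgn_if)
  also have "\<dots> = \<bar>x\<bar> powr q"
    by (cases "x = 0") (simp_all add: powr_diff)
  finally show ?thesis .
qed

lemma isCont_signed_powr:
  assumes "r > 0" shows "isCont (\<lambda>x. signed_powr x r) x"
proof -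
  have eq: "(\<lambda>x. signed_powr x r) = (\<lambda>x. max x 0 powr r - max (- x) 0 powr r)"
    by (rule ext) (auto simp: signed_powr_def sgn_if)
  have "continuous_on UNIV (\<lambda>x::real. max x 0 powr r - max (- x) 0 powr r)"
    using assms by (intro continuous_intros continuous_on_powr') auto
  then show ?thesis unfolding eq by (simp add: continuous_on_eq_continuous_at)
qed

lemma abs_add_powr_le:
  fixes a b :: real assumes "q \<ge> 0"
  shows "\<bar>a + b\<bar> powr q \<le> 2 powr q * (\<bar>a\<bar> powr q + \<bar>b\<bar> powr q)"
proof -
  have "\<bar>a + b\<bar> powr q \<le> (2 * max \<bar>a\<bar> \<bar>b\<bar>) powr q"
    using assms by (intro powr_mono2) auto
  also have "\<dots> = 2 powr q * max \<bar>a\<bar> \<bar>b\<bar> powr q" by (simp add: powr_mult)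
  also have "\<dots> \<le> 2 powr q * (\<bar>a\<bar> powr q + \<bar>b\<bar> powr q)"
    by (intro mult_left_mono) (auto simp: max_def)
  finally show ?thesis .
qed

text \<open>If a exceeds e, then (a/e)^(q-1) \<ge> 1. With a free e this controls L^1 by L^q on a
  finite measure: e is chosen first, then the size of the q-th power.\<close>

lemma le_add_powr:
  fixes a :: real assumes "q > 1" "e > 0" "a \<ge> 0"
  shows "a \<le> e + e powr (1 - q) * a powr q"
proof (cases "a \<le> e")
  case False
  then have "a > e" by simp
  have "1 = e powr (1 - q) * e powr (q - 1)" using assms by (simp flip: powr_add)
  also have "\<dots> \<le> e powr (1 - q) * a powr (q - 1)"
    using \<open>a > e\<close> assms by (intro mult_left_mono powr_mono2) auto
  finally have "1 * a \<le> e powr (1 - q) * a powr (q - 1) * a" using assms by (intro mult_right_mono) auto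
  also have "\<dots> = e powr (1 - q) * a powr q"
    using assms \<open>a > e\<close> by (simp add: powr_diff)
  finally show ?thesis using assms by simp
qed (use assms in \<open>simp add: add_increasing2\<close>)

text \<open>The graph of \<bar>x\<bar>^q lies above its tangent at y; after multiplication by q this
  is Young's inequality with exponents q and q/(q-1).\<close>

lemma powr_tangent:
  fixes x y :: real assumes "q > 1"
  shows "\<bar>y\<bar> powr q + q * (signed_powr y (q - 1) * (x - y)) \<le> \<bar>x\<bar> powr q"
proof -
  have "\<bar>x\<bar> * \<bar>y\<bar> powr (q - 1) \<le> \<bar>x\<bar> powr q / q + (\<bar>y\<bar> powr (q - 1)) powr (q / (q - 1)) / (q / (q - 1))"
    using assms by (intro Youngs_inequality) (auto simp: field_simps)
  also have "(\<bar>y\<bar> powr (q - 1)) powr (q / (q - 1)) = \<bar>y\<bar> powr q"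
    using assms by (simp add: powr_powr)
  finally have "q * (\<bar>x\<bar> * \<bar>y\<bar> powr (q - 1)) \<le> q * (\<bar>x\<bar> powr q / q + \<bar>y\<bar> powr q / (q / (q - 1)))"
    using assms by (intro mult_left_mono) auto
  also have "\<dots> = \<bar>x\<bar> powr q + (q - 1) * \<bar>y\<bar> powr q"
    using assms by (simp add: distrib_left)
  finally have *: "q * (\<bar>x\<bar> * \<bar>y\<bar> powr (q - 1)) \<le> \<bar>x\<bar> powr q + (q - 1) * \<bar>y\<bar> powr q" .
  have "signed_powr y (q - 1) * x \<le> \<bar>signed_powr y (q - 1)\<bar> * \<bar>x\<bar>"
    by (metis abs_ge_self abs_mult)
  then have "q * (signed_powr y (q - 1) * x) \<le> q * (\<bar>x\<bar> * \<bar>y\<bar> powr (q - 1))"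
    using assms by (intro mult_left_mono) (auto simp: abs_signed_powr mult.commute)
  with * have "q * (signed_powr y (q - 1) * x) \<le> \<bar>x\<bar> powr q + (q - 1) * \<bar>y\<bar> powr q" by linarith
  moreover have "q * (signed_powr y (q - 1) * (x - y)) = q * (signed_powr y (q - 1) * x) - q * \<bar>y\<bar> powr q"
    by (simp add: right_diff_distrib signed_powr_mult_self)
  ultimately show ?thesis by (simp add: left_diff_distrib)
qed

text \<open>Convexity with weights 1 - t and t at the points y/(1-t) and (x-y)/t, whose mean is x.
  The first coefficient tends to 1 as t tends to 0, so small perturbations of y cost little.\<close>

lemma powr_split:
  fixes x y :: real assumes "q > 1" "0 < t" "t < 1"
  shows "\<bar>x\<bar> powr q \<le> (1 - t) powr (1 - q) * \<bar>y\<bar> powr q + t powr (1 - q) * \<bar>x - y\<bar> powr q"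
proof -
  define A B where "A = y / (1 - t)" and "B = (x - y) / t"
  have x: "x = (1 - t) * A + t * B" using assms by (simp add: A_def B_def)
  have 1: "s * \<bar>z / s\<bar> powr q = s powr (1 - q) * \<bar>z\<bar> powr q" if "s > 0" for s z :: real
    using that by (simp add: powr_divide powr_diff abs_divide)
  have "\<bar>x\<bar> powr q = (1 - t) * (\<bar>x\<bar> powr q + q * (signed_powr x (q - 1) * (A - x)))
       + t * (\<bar>x\<bar> powr q + q * (signed_powr x (q - 1) * (B - x)))"
  proof -
    have "(1 - t) * (A - x) + t * (B - x) = 0" using x by (simp add: algebra_simps)
    then have "q * signed_powr x (q - 1) * ((1 - t) * (A - x) + t * (B - x)) = 0" by simp
    then show ?thesis by (simp add: algebra_simps)
  qed
  also have "\<dots> \<le> (1 - t) * \<bar>A\<bar> powr q + t * \<bar>B\<bar> powr q"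
    using assms by (intro add_mono mult_left_mono powr_tangent) auto
  also have "\<dots> = (1 - t) powr (1 - q) * \<bar>y\<bar> powr q + t powr (1 - q) * \<bar>x - y\<bar> powr q"
    unfolding A_def B_def using 1[of "1 - t" y] 1[of t "x - y"] assms by simp
  finally show ?thesis .
qed

text \<open>The gap vanishes at s = 1 and is strictly decreasing below it, since x < (1 + x)/2
  there.\<close>

lemma powr_midpoint_strict:
  fixes s q :: real assumes "q > 1" "0 \<le> s" "s < 1"
  shows "((1 + s) / 2) powr q < (1 + s powr q) / 2"
proof -
  define f where "f s = (1 + s powr q) / 2 - ((1 + s) / 2) powr q" for s
  have "f 1 < f s"
  proof (rule DERIV_neg_imp_decreasing_open[OF assms(3)])
    fix x assume x: "s < x" "x < 1"
    have "(f has_real_derivative (q * x powr (q - 1)) / 2 - (q * ((1 + x) / 2) powr (q - 1)) * (1 / 2)) (at x)"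
      unfolding f_def using x assms by (auto intro!: derivative_eq_intros simp: field_simps)
    moreover have "x powr (q - 1) < ((1 + x) / 2) powr (q - 1)"
      using x assms by (intro powr_less_mono2) auto
    then have "(q * x powr (q - 1)) / 2 - (q * ((1 + x) / 2) powr (q - 1)) * (1 / 2) < 0"
      using assms by simp
    ultimately show "\<exists>y. DERIV f x :> y \<and> y < 0" by blast
  next
    show "continuous_on {s..1} f"
      unfolding f_def using assms by (intro continuous_intros continuous_on_powr') auto
  qed
  then show ?thesis by (simp add: f_def)
qed

text \<open>A form of uniform convexity of \<open>L\<^sup>q\<close> that is valid for all \<open>q > 1\<close>. By homogeneity
  only \<open>a = 1\<close> and \<open>\<bar>b\<bar> \<le> 1\<close> matter, and there it follows from compactness.\<close>

lemma uniform_convexity_powr: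
  fixes q e :: real assumes q: "q > 1" and e: "e > 0"
  obtains K where "K \<ge> 0" "\<And>a b. \<bar>a - b\<bar> powr q \<le> e * (\<bar>a\<bar> powr q + \<bar>b\<bar> powr q)
     + K * ((\<bar>a\<bar> powr q + \<bar>b\<bar> powr q) / 2 - \<bar>(a + b) / 2\<bar> powr q)"
proof -
  \<comment> \<open>The convexity gap at the midpoint of the pair (1, r).\<close>
  define g where "g r = (1 + \<bar>r\<bar> powr q) / 2 - \<bar>(1 + r) / 2\<bar> powr q" for r :: real
  have cont: "continuous_on S g" for S
    unfolding g_def using q by (intro continuous_intros continuous_on_powr') auto
  have g_nonneg: "g r \<ge> 0" if "\<bar>r\<bar> \<le> 1" for r
  proof -
    have "\<bar>(1 + r) / 2\<bar> powr q \<le> ((1 + \<bar>r\<bar>) / 2) powr q"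
      using q by (intro powr_mono2) auto
    also have "\<dots> \<le> (1 + \<bar>r\<bar> powr q) / 2"
      using powr_midpoint_strict[OF q, of "\<bar>r\<bar>"] that by (cases "\<bar>r\<bar> = 1") auto
    finally show ?thesis by (simp add: g_def)
  qed
  have g_pos: "g r > 0" if "\<bar>r\<bar> \<le> 1" "r \<noteq> 1" for r
  proof (cases "r = -1")
    case True
    with q show ?thesis by (simp add: g_def)
  next
    case False
    with that have r: "\<bar>r\<bar> < 1" by auto
    have "\<bar>(1 + r) / 2\<bar> powr q \<le> ((1 + \<bar>r\<bar>) / 2) powr q"
      using q by (intro powr_mono2) auto
    also have "\<dots> < (1 + \<bar>r\<bar> powr q) / 2"
      using powr_midpoint_strict[OF q, of "\<bar>r\<bar>"] r by auto
    finally show ?thesis by (simp add: g_def)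
  qed
  \<comment> \<open>The ratios not yet covered by the term with e. The value r = 1 is excluded from
    this compact set, so the gap has a positive minimum \<delta> on it; since \<bar>1 - r\<bar>^q
    \<le> 2^q, the constant K = 2^q / \<delta> suffices.\<close>
  define S where "S = {r \<in> {-1..1}. e \<le> \<bar>1 - r\<bar> powr q}"
  have "compact S"
  proof -
    have "closed {r \<in> {-1..1::real}. e \<le> \<bar>1 - r\<bar> powr q}"
      using q by (intro closed_Collect_le continuous_closed_preimage continuous_intros continuous_on_powr'
        continuous_on_closed_Collect_le) auto
    then have "closed S" by (simp add: S_def)
    moreover have "bounded S" by (rule bounded_subset[of "{-1..1}"]) (auto simp: S_def)
    ultimately show ?thesis by (simp add: compact_eq_bounded_closed)
  qed
  obtain \<delta> where \<delta>: "\<delta> > 0" "\<And>r. r \<in> S \<Longrightarrow> \<delta> \<le> g r"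
  proof (cases "S = {}")
    case True
    then show ?thesis using that[of 1] by simp
  next
    case False
    then obtain r0 where r0: "r0 \<in> S" "\<And>r. r \<in> S \<Longrightarrow> g r0 \<le> g r"
      using continuous_attains_inf[OF \<open>compact S\<close> _ cont] by blast
    have "r0 \<noteq> 1" using r0(1) e q by (auto simp: S_def)
    then have "g r0 > 0" using r0(1) by (intro g_pos) (auto simp: S_def)
    with r0 show ?thesis using that by blast
  qed
  define K where "K = 2 powr q / \<delta>"
  have K: "K \<ge> 0" using \<delta> by (simp add: K_def)
  have one: "\<bar>1 - r\<bar> powr q \<le> e * (1 + \<bar>r\<bar> powr q) + K * g r" if r: "\<bar>r\<bar> \<le> 1" for r
  proof (cases "r \<in> S")
    case True
    have "\<bar>1 - r\<bar> powr q \<le> 2 powr q" using r q by (intro powr_mono2) auto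
    also have "\<dots> = K * \<delta>" using \<delta> by (simp add: K_def)
    also have "\<dots> \<le> K * g r" using K \<delta>(2)[OF True] by (rule mult_left_mono[rotated])
    finally show ?thesis using e by (simp add: add_increasing)
  next
    case False
    then have "\<bar>1 - r\<bar> powr q \<le> e" using r by (auto simp: S_def)
    also have "\<dots> \<le> e * (1 + \<bar>r\<bar> powr q)" using e by simp
    finally show ?thesis using K g_nonneg[OF r] by (simp add: add_increasing2)
  qed
  have le: "\<bar>a - b\<bar> powr q \<le> e * (\<bar>a\<bar> powr q + \<bar>b\<bar> powr q)
     + K * ((\<bar>a\<bar> powr q + \<bar>b\<bar> powr q) / 2 - \<bar>(a + b) / 2\<bar> powr q)" if ab: "\<bar>b\<bar> \<le> \<bar>a\<bar>" for a b
  proof (cases "a = 0")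
    case False
    define r where "r = b / a"
    have b: "b = a * r" using False by (simp add: r_def)
    have "\<bar>r\<bar> \<le> 1" using ab False by (simp add: r_def abs_divide)
    then have "\<bar>a\<bar> powr q * \<bar>1 - r\<bar> powr q \<le> \<bar>a\<bar> powr q * (e * (1 + \<bar>r\<bar> powr q) + K * g r)"
      by (intro mult_left_mono one) auto
    moreover have "\<bar>a - b\<bar> powr q = \<bar>a\<bar> powr q * \<bar>1 - r\<bar> powr q"
    proof -
      have "\<bar>a - b\<bar> = \<bar>a\<bar> * \<bar>1 - r\<bar>" unfolding b by (simp flip: abs_mult add: right_diff_distrib)
      then show ?thesis by (simp add: powr_mult)
    qed
    moreover have "\<bar>(a + b) / 2\<bar> powr q = \<bar>a\<bar> powr q * \<bar>(1 + r) / 2\<bar> powr q"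
    proof -
      have "\<bar>(a + b) / 2\<bar> = \<bar>a\<bar> * \<bar>(1 + r) / 2\<bar>" unfolding b by (simp flip: abs_mult add: distrib_left)
      then show ?thesis by (simp only: powr_mult abs_ge_zero)
    qed
    moreover have "\<bar>b\<bar> powr q = \<bar>a\<bar> powr q * \<bar>r\<bar> powr q" unfolding b by (simp add: abs_mult powr_mult)
    ultimately show ?thesis by (simp add: g_def algebra_simps)
  qed (use ab q in simp)
  show ?thesis
  proof (rule that[OF K])
    fix a b :: real
    show "\<bar>a - b\<bar> powr q \<le> e * (\<bar>a\<bar> powr q + \<bar>b\<bar> powr q)
     + K * ((\<bar>a\<bar> powr q + \<bar>b\<bar> powr q) / 2 - \<bar>(a + b) / 2\<bar> powr q)"
      using le[of b a] le[of a b] by (cases "\<bar>b\<bar> \<le> \<bar>a\<bar>") (simp_all add: abs_minus_commute add.commute)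
  qed
qed

section \<open>Convergence in \<open>L\<^sup>q\<close> of a finite measure\<close>

definition Lq :: "'a measure \<Rightarrow> real \<Rightarrow> ('a \<Rightarrow> real) \<Rightarrow> bool" where
  "Lq M q f \<longleftrightarrow> f \<in> borel_measurable M \<and> integrable M (\<lambda>x. \<bar>f x\<bar> powr q)"

lemma Lq_measurable: "Lq M q f \<Longrightarrow> f \<in> borel_measurable M"
  by (simp add: Lq_def)

lemma Lq_integrable: "Lq M q f \<Longrightarrow> integrable M (\<lambda>x. \<bar>f x\<bar> powr q)"
  by (simp add: Lq_def)

lemma Lq_cmult: "Lq M q f \<Longrightarrow> Lq M q (\<lambda>x. c * f x)"
  by (auto simp: Lq_def abs_mult powr_mult intro!: borel_measurable_times)

lemma Lq_abs: "Lq M q f \<Longrightarrow> Lq M q (\<lambda>x. \<bar>f x\<bar>)"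
  by (auto simp: Lq_def intro!: borel_measurable_abs)

lemma Lq_add:
  assumes "Lq M q f" "Lq M q g" "q \<ge> 0" shows "Lq M q (\<lambda>x. f x + g x)"
proof -
  have [measurable]: "f \<in> borel_measurable M" "g \<in> borel_measurable M" using assms by (auto simp: Lq_def)
  have "integrable M (\<lambda>x. \<bar>f x + g x\<bar> powr q)"
  proof (rule Bochner_Integration.integrable_bound)
    show "integrable M (\<lambda>x. 2 powr q * (\<bar>f x\<bar> powr q + \<bar>g x\<bar> powr q))"
      using assms by (simp add: Lq_def)
    show "AE x in M. norm (\<bar>f x + g x\<bar> powr q) \<le> norm (2 powr q * (\<bar>f x\<bar> powr q + \<bar>g x\<bar> powr q))"
      using abs_add_powr_le[OF assms(3)] by (intro AE_I2) simp
  qed measurable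
  then show ?thesis by (simp add: Lq_def)
qed

lemma Lq_diff: "Lq M q f \<Longrightarrow> Lq M q g \<Longrightarrow> q \<ge> 0 \<Longrightarrow> Lq M q (\<lambda>x. f x - g x)"
  using Lq_add[of M q f "\<lambda>x. - 1 * g x"] Lq_cmult[of M q g "- 1"] by simp

lemma integrable_mult_Lq:
  assumes f: "Lq M p f" and g: "Lq M q g" and pq: "p > 1" "q > 1" "1 / p + 1 / q = 1"
  shows "integrable M (\<lambda>x. f x * g x)"
proof (rule Bochner_Integration.integrable_bound)
  show "integrable M (\<lambda>x. \<bar>f x\<bar> powr p / p + \<bar>g x\<bar> powr q / q)"
    using f g by (simp add: Lq_def)
  show "(\<lambda>x. f x * g x) \<in> borel_measurable M"
    by (intro borel_measurable_times Lq_measurable[OF f] Lq_measurable[OF g])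
  have "\<bar>f x\<bar> * \<bar>g x\<bar> \<le> \<bar>f x\<bar> powr p / p + \<bar>g x\<bar> powr q / q" for x
    using pq by (intro Youngs_inequality) auto
  then show "AE x in M. norm (f x * g x) \<le> norm (\<bar>f x\<bar> powr p / p + \<bar>g x\<bar> powr q / q)"
    using pq by (intro AE_I2) (simp add: abs_mult abs_of_nonneg)
qed

context finite_measure
begin

lemma Lq_bounded:
  assumes [measurable]: "f \<in> borel_measurable M" and "AE x in M. \<bar>f x\<bar> \<le> C" "q \<ge> 0" shows "Lq M q f"
proof -
  have "integrable M (\<lambda>x. \<bar>f x\<bar> powr q)"
  proof (rule integrable_const_bound)
    show "AE x in M. norm (\<bar>f x\<bar> powr q) \<le> C powr q"
      using assms(2) by eventually_elim (use assms(3) in \<open>simp add: powr_mono2\<close>)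
  qed measurable
  then show ?thesis by (simp add: Lq_def)
qed

lemma Lq_imp_integrable:
  assumes "Lq M q f" "q > 1" shows "integrable M f"
proof (rule Bochner_Integration.integrable_bound)
  show "integrable M (\<lambda>x. 1 + \<bar>f x\<bar> powr q)" "f \<in> borel_measurable M" using assms by (simp_all add: Lq_def)
  show "AE x in M. norm (f x) \<le> norm (1 + \<bar>f x\<bar> powr q)"
    using le_add_powr[of q 1] assms(2) by (intro AE_I2) simp
qed

lemma integral_abs_le_powr:
  assumes "Lq M q f" "q > 1" "e > 0"
  shows "(\<integral>x. \<bar>f x\<bar> \<partial>M) \<le> e * measure M (space M) + e powr (1 - q) * (\<integral>x. \<bar>f x\<bar> powr q \<partial>M)"
proof -
  have "(\<integral>x. \<bar>f x\<bar> \<partial>M) \<le> (\<integral>x. e + e powr (1 - q) * \<bar>f x\<bar> powr q \<partial>M)"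
    using assms Lq_imp_integrable[OF assms(1,2)] le_add_powr[of q e]
    by (intro integral_mono) (auto simp: Lq_def)
  also have "\<dots> = e * measure M (space M) + e powr (1 - q) * (\<integral>x. \<bar>f x\<bar> powr q \<partial>M)"
    using assms by (simp add: Lq_def mult.commute)
  finally show ?thesis .
qed

lemma Lq_small_imp_L1_small:
  assumes "q > 1" "e > 0"
  obtains \<delta> where "\<delta> > 0" "\<And>f. Lq M q f \<Longrightarrow> (\<integral>x. \<bar>f x\<bar> powr q \<partial>M) < \<delta> \<Longrightarrow> (\<integral>x. \<bar>f x\<bar> \<partial>M) < e"
proof -
  define \<mu> where "\<mu> = measure M (space M)"
  have \<mu>: "\<mu> \<ge> 0" by (simp add: \<mu>_def)
  \<comment> \<open>Makes the constant term of \<open>integral_abs_le_powr\<close> at most e/2; the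
    bound on the q-th power takes the other half. The +1 covers a measure of total mass 0.\<close>
  define s where "s = e / (2 * (\<mu> + 1))"
  have s: "s > 0" using assms \<mu> by (simp add: s_def)
  have "s * \<mu> \<le> e / 2" using assms \<mu> by (simp add: s_def field_simps)
  show ?thesis
  proof (rule that[of "e / (2 * s powr (1 - q))"])
    show "e / (2 * s powr (1 - q)) > 0" using assms s by simp
    fix f assume f: "Lq M q f" "(\<integral>x. \<bar>f x\<bar> powr q \<partial>M) < e / (2 * s powr (1 - q))"
    have "s powr (1 - q) * (\<integral>x. \<bar>f x\<bar> powr q \<partial>M) < s powr (1 - q) * (e / (2 * s powr (1 - q)))"
      using f s by (intro mult_strict_left_mono) auto
    also have "\<dots> = e / 2" using s by simp
    finally show "(\<integral>x. \<bar>f x\<bar> \<partial>M) < e"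
      using integral_abs_le_powr[OF f(1) assms(1) s] \<open>s * \<mu> \<le> e / 2\<close> by (simp add: \<mu>_def)
  qed
qed

lemma Lq_tendsto_0_imp_L1:
  assumes "\<And>n. Lq M q (f n)" "q > 1" "(\<lambda>n. \<integral>x. \<bar>f n x\<bar> powr q \<partial>M) \<longlonglongrightarrow> 0"
  shows "(\<lambda>n. \<integral>x. \<bar>f n x\<bar> \<partial>M) \<longlonglongrightarrow> 0"
proof (rule LIMSEQ_I)
  fix e :: real assume "e > 0"
  from Lq_small_imp_L1_small[OF assms(2) this] obtain \<delta>
    where \<delta>: "\<delta> > 0" "\<And>f. Lq M q f \<Longrightarrow> (\<integral>x. \<bar>f x\<bar> powr q \<partial>M) < \<delta> \<Longrightarrow> (\<integral>x. \<bar>f x\<bar> \<partial>M) < e" by blast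
  from LIMSEQ_D[OF assms(3) \<delta>(1)] obtain N where "\<And>n. n \<ge> N \<Longrightarrow> (\<integral>x. \<bar>f n x\<bar> powr q \<partial>M) < \<delta>" by force
  then show "\<exists>N. \<forall>n\<ge>N. norm ((\<integral>x. \<bar>f n x\<bar> \<partial>M) - 0) < e"
    using \<delta>(2) assms(1) by (intro exI[of _ N]) auto
qed

lemma L1_Cauchy_imp_AE_convergent:
  fixes f :: "nat \<Rightarrow> 'a \<Rightarrow> real"
  assumes "\<And>n. integrable M (f n)"
    and "\<And>e. e > 0 \<Longrightarrow> \<exists>N. \<forall>i\<ge>N. \<forall>j\<ge>N. (\<integral>x. \<bar>f i x - f j x\<bar> \<partial>M) < e"
  obtains r g where "strict_mono r" "g \<in> borel_measurable M" "AE x in M. (\<lambda>n. f (r n) x) \<longlonglongrightarrow> g x"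
proof -
  have [measurable]: "f n \<in> borel_measurable M" for n using assms(1) by simp
  have "\<And>e. e > 0 \<Longrightarrow> \<exists>N. \<forall>i\<ge>N. \<forall>j\<ge>N. (\<integral>x. norm (f i x - f j x) \<partial>M) < e" using assms(2) by simp
  then obtain r where r: "strict_mono r" "AE x in M. Cauchy (\<lambda>i. f (r i) x)"
    using cauchy_L1_AE_cauchy_subseq[of M f] assms(1) by blast
  have "(\<lambda>x. lim (\<lambda>n. f (r n) x)) \<in> borel_measurable M" by measurable
  moreover have "AE x in M. (\<lambda>n. f (r n) x) \<longlonglongrightarrow> lim (\<lambda>n. f (r n) x)"
    using r(2) by eventually_elim (simp add: Cauchy_convergent_iff convergent_LIMSEQ_iff)
  ultimately show ?thesis using that r(1) by blast
qed

lemma fatou_bound: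
  fixes f :: "nat \<Rightarrow> 'a \<Rightarrow> real"
  assumes "\<And>n. integrable M (f n)" "\<And>n x. f n x \<ge> 0" and [measurable]: "g \<in> borel_measurable M"
    and lim: "AE x in M. (\<lambda>n. f n x) \<longlonglongrightarrow> g x" and le: "\<And>n. n \<ge> N \<Longrightarrow> (\<integral>x. f n x \<partial>M) \<le> e"
  shows "integrable M g \<and> (\<integral>x. g x \<partial>M) \<le> e"
proof -
  have [measurable]: "f n \<in> borel_measurable M" for n using assms(1) by simp
  have e: "e \<ge> 0" using le[of N] assms(2) by (meson Bochner_Integration.integral_nonneg order_refl order_trans)
  have g0: "AE x in M. g x \<ge> 0"
    using lim by eventually_elim (use assms(2) in \<open>auto intro: LIMSEQ_le_const\<close>)
  have "(\<integral>\<^sup>+x. ennreal (g x) \<partial>M) = (\<integral>\<^sup>+x. liminf (\<lambda>n. ennreal (f n x)) \<partial>M)"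
  proof (rule nn_integral_cong_AE)
    show "AE x in M. ennreal (g x) = liminf (\<lambda>n. ennreal (f n x))"
      using lim
    proof eventually_elim
      case (elim x)
      then have "(\<lambda>n. ennreal (f n x)) \<longlonglongrightarrow> ennreal (g x)" by (rule tendsto_ennrealI)
      then show ?case using lim_imp_Liminf[OF sequentially_bot] by force
    qed
  qed
  also have "\<dots> \<le> liminf (\<lambda>n. \<integral>\<^sup>+x. ennreal (f n x) \<partial>M)"
    by (rule nn_integral_liminf) measurable
  also have "\<dots> \<le> liminf (\<lambda>n. ennreal e)"
  proof (rule Liminf_mono)
    show "\<forall>\<^sub>F n in sequentially. (\<integral>\<^sup>+x. ennreal (f n x) \<partial>M) \<le> ennreal e"
      using eventually_ge_at_top[of N]
    proof eventually_elim
      case (elim n)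
      then show ?case using assms(1,2) le[of n] by (subst nn_integral_eq_integral) (auto intro: ennreal_leI)
    qed
  qed
  also have "\<dots> = ennreal e" by (simp add: Liminf_const)
  finally have *: "(\<integral>\<^sup>+x. ennreal (g x) \<partial>M) \<le> ennreal e" .
  have i: "integrable M g"
    by (rule integrableI_nonneg[OF _ g0]) (use * in \<open>auto intro: le_less_trans\<close>)
  then have "ennreal (\<integral>x. g x \<partial>M) \<le> ennreal e"
    using * g0 by (simp add: nn_integral_eq_integral)
  with i e show ?thesis by (simp add: ennreal_le_iff)
qed

text \<open>An L^q Cauchy sequence is Cauchy in L^1, so a subsequence converges almost everywhere.
  Fatou along that subsequence, with the other index fixed, estimates the distance of the whole
  sequence to the limit.\<close>

lemma Lq_complete:
  assumes L: "\<And>n. Lq M q (f n)" and q: "q > 1"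
    and C: "\<And>e. e > 0 \<Longrightarrow> \<exists>N. \<forall>i\<ge>N. \<forall>j\<ge>N. (\<integral>x. \<bar>f i x - f j x\<bar> powr q \<partial>M) < e"
  obtains g where "Lq M q g" "(\<lambda>n. \<integral>x. \<bar>f n x - g x\<bar> powr q \<partial>M) \<longlonglongrightarrow> 0"
proof -
  have [measurable]: "f n \<in> borel_measurable M" for n using L by (simp add: Lq_def)
  have d: "Lq M q (\<lambda>x. f i x - f j x)" for i j using L q by (intro Lq_diff) auto
  have "\<exists>N. \<forall>i\<ge>N. \<forall>j\<ge>N. (\<integral>x. \<bar>f i x - f j x\<bar> \<partial>M) < e" if "e > 0" for e
  proof -
    from Lq_small_imp_L1_small[OF q that] obtain \<delta>
      where \<delta>: "\<delta> > 0" "\<And>f. Lq M q f \<Longrightarrow> (\<integral>x. \<bar>f x\<bar> powr q \<partial>M) < \<delta> \<Longrightarrow> (\<integral>x. \<bar>f x\<bar> \<partial>M) < e" by blast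
    from C[OF \<delta>(1)] show ?thesis using \<delta>(2)[OF d] by blast
  qed
  then obtain r g where r: "strict_mono r" and g[measurable]: "g \<in> borel_measurable M"
      and lim: "AE x in M. (\<lambda>n. f (r n) x) \<longlonglongrightarrow> g x"
    using L1_Cauchy_imp_AE_convergent[of f] Lq_imp_integrable[OF L q] by blast
  have close: "\<exists>N. \<forall>n\<ge>N. integrable M (\<lambda>x. \<bar>f n x - g x\<bar> powr q) \<and> (\<integral>x. \<bar>f n x - g x\<bar> powr q \<partial>M) \<le> e" if "e > 0" for e
  proof -
    from C[OF that] obtain N where N: "\<And>i j. i \<ge> N \<Longrightarrow> j \<ge> N \<Longrightarrow> (\<integral>x. \<bar>f i x - f j x\<bar> powr q \<partial>M) < e" by blast
    have "integrable M (\<lambda>x. \<bar>f n x - g x\<bar> powr q) \<and> (\<integral>x. \<bar>f n x - g x\<bar> powr q \<partial>M) \<le> e" if "n \<ge> N" for n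
    proof (rule fatou_bound[where f = "\<lambda>k x. \<bar>f n x - f (r k) x\<bar> powr q" and N = N])
      show "integrable M (\<lambda>x. \<bar>f n x - f (r k) x\<bar> powr q)" for k using d by (simp add: Lq_def)
      show "AE x in M. (\<lambda>k. \<bar>f n x - f (r k) x\<bar> powr q) \<longlonglongrightarrow> \<bar>f n x - g x\<bar> powr q"
        using lim by eventually_elim (use q in \<open>intro tendsto_powr2 tendsto_intros, auto\<close>)
      show "(\<integral>x. \<bar>f n x - f (r k) x\<bar> powr q \<partial>M) \<le> e" if "k \<ge> N" for k
        using N[of n "r k"] \<open>n \<ge> N\<close> that seq_suble[OF r, of k] by simp
    qed auto
    then show ?thesis by blast
  qed
  from close[of 1] obtain N where "integrable M (\<lambda>x. \<bar>f N x - g x\<bar> powr q)" by auto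
  then have "Lq M q (\<lambda>x. f N x - g x)" by (simp add: Lq_def)
  from Lq_diff[OF L[of N] this] q have Lg: "Lq M q g" by simp
  have "(\<lambda>n. \<integral>x. \<bar>f n x - g x\<bar> powr q \<partial>M) \<longlonglongrightarrow> 0"
  proof (rule LIMSEQ_I)
    fix e :: real assume "e > 0"
    then have "e / 2 > 0" by simp
    from close[OF this] obtain N where N: "\<And>n. n \<ge> N \<Longrightarrow> (\<integral>x. \<bar>f n x - g x\<bar> powr q \<partial>M) \<le> e / 2" by blast
    show "\<exists>N. \<forall>n\<ge>N. norm ((\<integral>x. \<bar>f n x - g x\<bar> powr q \<partial>M) - 0) < e"
      using N \<open>e > 0\<close> by (intro exI[of _ N] allI impI) (force intro: le_less_trans)
  qed
  with Lg that show ?thesis by blast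
qed

text \<open>A substitute for the continuity of the norm that only needs convexity.\<close>

lemma powr_split_limit:
  fixes X Z :: "nat \<Rightarrow> real"
  assumes "\<And>n t. 0 < t \<Longrightarrow> t < 1 \<Longrightarrow> Y \<le> (1 - t) powr (1 - q) * Z n + t powr (1 - q) * X n"
    and "X \<longlonglongrightarrow> 0" "Z \<longlonglongrightarrow> z"
  shows "Y \<le> z"
proof -
  have 1: "Y \<le> (1 - t) powr (1 - q) * z" if "0 < t" "t < 1" for t
  proof -
    have "(\<lambda>n. (1 - t) powr (1 - q) * Z n + t powr (1 - q) * X n) \<longlonglongrightarrow> (1 - t) powr (1 - q) * z + t powr (1 - q) * 0"
      using assms(2,3) by (intro tendsto_intros)
    then show ?thesis using assms(1)[OF that] by (intro LIMSEQ_le_const[of _ _ Y]) auto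
  qed
  have "((\<lambda>t. (1 - t) powr (1 - q) * z) \<longlongrightarrow> (1 - 0) powr (1 - q) * z) (at_right 0)"
    by (intro tendsto_intros) auto
  moreover have "eventually (\<lambda>t. Y \<le> (1 - t) powr (1 - q) * z) (at_right 0)"
    using eventually_at_right_real[of 0 1] by (auto elim!: eventually_mono intro: 1)
  ultimately show ?thesis by (auto intro: tendsto_lowerbound)
qed

lemma integral_powr_split:
  assumes "Lq M q f" "Lq M q g" "q > 1" "0 < t" "t < 1"
  shows "(\<integral>x. \<bar>f x\<bar> powr q \<partial>M) \<le> (1 - t) powr (1 - q) * (\<integral>x. \<bar>g x\<bar> powr q \<partial>M) + t powr (1 - q) * (\<integral>x. \<bar>f x - g x\<bar> powr q \<partial>M)"
proof -
  have i: "integrable M (\<lambda>x. \<bar>f x\<bar> powr q)" "integrable M (\<lambda>x. \<bar>g x\<bar> powr q)" "integrable M (\<lambda>x. \<bar>f x - g x\<bar> powr q)"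
    using assms Lq_diff[of M q f g] by (auto simp: Lq_def)
  have "(\<integral>x. \<bar>f x\<bar> powr q \<partial>M) \<le> (\<integral>x. (1 - t) powr (1 - q) * \<bar>g x\<bar> powr q + t powr (1 - q) * \<bar>f x - g x\<bar> powr q \<partial>M)"
    using i powr_split[OF assms(3-5)] by (intro integral_mono) auto
  with i show ?thesis by simp
qed

text \<open>This replaces the Hahn-Banach theorem and the duality of \<open>L\<^sup>p\<close> and \<open>L\<^sup>q\<close>: the point of the
  closure of \<open>C\<close> nearest to \<open>u\<close> exists by uniform convexity, and its Euler-Lagrange inequality
  provides the separating functional.\<close>

lemma Lq_closure_of_convex:
  assumes pq: "p > 1" "q > 1" "1 / p + 1 / q = 1"
    and u: "Lq M q u" and C: "\<And>c. c \<in> C \<Longrightarrow> Lq M q c" and ne: "C \<noteq> {}"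
    and convex: "\<And>c c' s. c \<in> C \<Longrightarrow> c' \<in> C \<Longrightarrow> 0 \<le> s \<Longrightarrow> s \<le> 1 \<Longrightarrow> (\<lambda>x. (1 - s) * c x + s * c' x) \<in> C"
    and sep: "\<And>w K. Lq M p w \<Longrightarrow> (\<And>c. c \<in> C \<Longrightarrow> (\<integral>x. w x * c x \<partial>M) \<le> K) \<Longrightarrow> (\<integral>x. w x * u x \<partial>M) \<le> K"
    and e: "e > 0"
  shows "\<exists>c\<in>C. (\<integral>x. \<bar>u x - c x\<bar> powr q \<partial>M) < e"
proof -
  define I where "I c = (\<integral>x. \<bar>u x - c x\<bar> powr q \<partial>M)" for c
  define m where "m = (INF c\<in>C. I c)"
  have I0: "I c \<ge> 0" for c by (simp add: I_def)
  have bdd: "bdd_below (I ` C)" by (rule bdd_belowI2[where m = 0]) (rule I0)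
  have m_le: "m \<le> I c" if "c \<in> C" for c unfolding m_def using bdd that by (rule cINF_lower)
  have m0: "m \<ge> 0" unfolding m_def using ne I0 by (intro cINF_greatest) auto
  have "\<exists>c\<in>C. I c < m + 1 / real (Suc n)" for n
    using cINF_less_iff[OF ne bdd, of "m + 1 / real (Suc n)"] by (simp add: m_def)
  then obtain c where c: "\<And>n. c n \<in> C" "\<And>n. I (c n) < m + 1 / real (Suc n)" by metis
  define a where "a n x = u x - c n x" for n x
  have La: "Lq M q (a n)" for n unfolding a_def[abs_def] using u C[OF c(1)] pq by (intro Lq_diff) auto
  have Ia: "I (c n) = (\<integral>x. \<bar>a n x\<bar> powr q \<partial>M)" for n by (simp add: I_def a_def)
  have Ilim: "(\<lambda>n. I (c n)) \<longlonglongrightarrow> m"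
  proof (rule tendsto_sandwich[where f = "\<lambda>_. m" and h = "\<lambda>n. m + 1 / real (Suc n)"])
    show "(\<lambda>n. m + 1 / real (Suc n)) \<longlonglongrightarrow> m" by real_asymp
    show "\<forall>\<^sub>F n in sequentially. m \<le> I (c n)" using m_le c(1) by simp
    show "\<forall>\<^sub>F n in sequentially. I (c n) \<le> m + 1 / real (Suc n)" using c(2) by (simp add: less_imp_le)
  qed simp
  have "\<exists>N. \<forall>i\<ge>N. \<forall>j\<ge>N. (\<integral>x. \<bar>a i x - a j x\<bar> powr q \<partial>M) < \<epsilon>" if \<epsilon>: "\<epsilon> > 0" for \<epsilon>
  proof -
    \<comment> \<open>Since \<gamma> \<le> 1, two late energies sum to at most 2 (m + 1), so \<eta>
      contributes \<epsilon>/2. The gap at their midpoint is at most \<gamma>, and K \<gamma> <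
      \<epsilon>/2.\<close>
    define \<eta> where "\<eta> = \<epsilon> / (4 * (m + 1))"
    have \<eta>: "\<eta> > 0" using \<epsilon> m0 by (simp add: \<eta>_def)
    from uniform_convexity_powr[OF pq(2) \<eta>] obtain K where K: "K \<ge> 0"
      "\<And>a b. \<bar>a - b\<bar> powr q \<le> \<eta> * (\<bar>a\<bar> powr q + \<bar>b\<bar> powr q) + K * ((\<bar>a\<bar> powr q + \<bar>b\<bar> powr q) / 2 - \<bar>(a + b) / 2\<bar> powr q)"
      by blast
    define \<gamma> where "\<gamma> = min 1 (\<epsilon> / (4 * (K + 1)))"
    have \<gamma>: "\<gamma> > 0" using K \<epsilon> by (simp add: \<gamma>_def)
    obtain N where N: "\<And>n. n \<ge> N \<Longrightarrow> \<bar>I (c n) - m\<bar> < \<gamma>"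
      using LIMSEQ_D[OF Ilim \<gamma>] by auto
    have "(\<integral>x. \<bar>a i x - a j x\<bar> powr q \<partial>M) < \<epsilon>" if "i \<ge> N" "j \<ge> N" for i j
    proof -
      \<comment> \<open>The midpoint is again a competitor, so its energy is at least the infimum m;
        this is what makes the convexity gap small.\<close>
      have mid: "(\<lambda>x. (1 - 1/2) * c i x + (1/2) * c j x) \<in> C" by (intro convex c) auto
      have Lm: "Lq M q (\<lambda>x. (1/2) * (a i x + a j x))" using La pq by (intro Lq_cmult Lq_add) auto
      have "I (\<lambda>x. (1 - 1/2) * c i x + (1/2) * c j x) = (\<integral>x. \<bar>(a i x + a j x) / 2\<bar> powr q \<partial>M)"
        unfolding I_def a_def by (intro Bochner_Integration.integral_cong refl arg_cong[where f = "\<lambda>z. \<bar>z\<bar> powr q"]) (simp add: field_simps)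
      with m_le[OF mid] have lower: "m \<le> (\<integral>x. \<bar>(a i x + a j x) / 2\<bar> powr q \<partial>M)" by simp
      have int: "integrable M (\<lambda>x. \<bar>a i x\<bar> powr q)" "integrable M (\<lambda>x. \<bar>a j x\<bar> powr q)"
         "integrable M (\<lambda>x. \<bar>(a i x + a j x) / 2\<bar> powr q)" "integrable M (\<lambda>x. \<bar>a i x - a j x\<bar> powr q)"
        using Lq_integrable[OF La] Lq_integrable[OF Lm] Lq_integrable[OF Lq_diff[OF La La]] pq by auto
      have "(\<integral>x. \<bar>a i x - a j x\<bar> powr q \<partial>M) \<le> (\<integral>x. \<eta> * (\<bar>a i x\<bar> powr q + \<bar>a j x\<bar> powr q)
           + K * ((\<bar>a i x\<bar> powr q + \<bar>a j x\<bar> powr q) / 2 - \<bar>(a i x + a j x) / 2\<bar> powr q) \<partial>M)"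
        using int K(2) by (intro integral_mono) auto
      also have "\<dots> = \<eta> * (I (c i) + I (c j)) + K * ((I (c i) + I (c j)) / 2 - (\<integral>x. \<bar>(a i x + a j x) / 2\<bar> powr q \<partial>M))"
        using int by (simp add: Ia)
      also have "\<dots> \<le> \<eta> * (2 * (m + 1)) + K * \<gamma>"
      proof (intro add_mono mult_left_mono)
        have "I (c i) < m + \<gamma>" "I (c j) < m + \<gamma>" using N[OF that(1)] N[OF that(2)] by auto
        moreover have "\<gamma> \<le> 1" by (simp add: \<gamma>_def)
        moreover have "X + Y \<le> 2 * (m + 1) \<and> (X + Y) / 2 - J \<le> \<gamma>"
          if "X < m + \<gamma>" "Y < m + \<gamma>" "\<gamma> \<le> 1" "m \<le> J" for X Y J :: real
        proof
          show "X + Y \<le> 2 * (m + 1)" using add_strict_mono[OF that(1,2)] that(3) by (simp add: distrib_left)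
          show "(X + Y) / 2 - J \<le> \<gamma>" using add_strict_mono[OF that(1,2)] that(4) by (simp add: field_simps)
        qed
        ultimately show "I (c i) + I (c j) \<le> 2 * (m + 1)"
          "(I (c i) + I (c j)) / 2 - (\<integral>x. \<bar>(a i x + a j x) / 2\<bar> powr q \<partial>M) \<le> \<gamma>" using lower by blast+
      qed (use K \<eta> in auto)
      also have "\<eta> * (2 * (m + 1)) = \<epsilon> / 2" using m0 by (simp add: \<eta>_def field_simps)
      also have "K * \<gamma> < \<epsilon> / 2"
      proof -
        have "K * \<gamma> \<le> K * (\<epsilon> / (4 * (K + 1)))" using K by (intro mult_left_mono) (auto simp: \<gamma>_def)
        also have "\<dots> < \<epsilon> / 2" using K \<epsilon> by (simp add: field_simps add_pos_nonneg)
        finally show ?thesis .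
      qed
      finally show ?thesis by simp
    qed
    then show ?thesis by blast
  qed
  \<comment> \<open>The residuals u - c n converge, so b is the residual of the nearest point of the
    closure, which itself need not lie in \<open>C\<close>.\<close>
  from Lq_complete[OF La pq(2) this] obtain b where b: "Lq M q b" "(\<lambda>n. \<integral>x. \<bar>a n x - b x\<bar> powr q \<partial>M) \<longlonglongrightarrow> 0"
    by blast
  have b_le: "(\<integral>x. \<bar>b x\<bar> powr q \<partial>M) \<le> m"
  proof (rule powr_split_limit[OF _ b(2) Ilim])
    fix n :: nat and t :: real assume "0 < t" "t < 1"
    then show "(\<integral>x. \<bar>b x\<bar> powr q \<partial>M) \<le> (1 - t) powr (1 - q) * I (c n) + t powr (1 - q) * (\<integral>x. \<bar>a n x - b x\<bar> powr q \<partial>M)"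
      using integral_powr_split[OF b(1) La pq(2), of t n] by (simp add: Ia abs_minus_commute)
  qed
  \<comment> \<open>b minimises along every segment towards a residual u - c'. The segments starting
    at the a n consist of residuals of points of \<open>C\<close>, and the bound m passes to the
    limit.\<close>
  have seg: "m \<le> (\<integral>x. \<bar>b x + s * (u x - c' x - b x)\<bar> powr q \<partial>M)" if c': "c' \<in> C" and s: "0 \<le> s" "s \<le> 1" for c' s
  proof -
    let ?f = "\<lambda>n x. a n x + s * (u x - c' x - a n x)" and ?g = "\<lambda>x. b x + s * (u x - c' x - b x)"
    have Lf: "Lq M q (?f n)" for n using La u C[OF c'] pq by (intro Lq_add Lq_cmult Lq_diff) auto
    have Lg: "Lq M q ?g" using b u C[OF c'] pq by (intro Lq_add Lq_cmult Lq_diff) auto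
    have conv: "(\<lambda>n. \<integral>x. \<bar>?f n x - ?g x\<bar> powr q \<partial>M) \<longlonglongrightarrow> 0"
    proof -
      have "\<bar>?f n x - ?g x\<bar> powr q = (1 - s) powr q * \<bar>a n x - b x\<bar> powr q" for n x
      proof -
        have "?f n x - ?g x = (1 - s) * (a n x - b x)" by (simp add: algebra_simps)
        then show ?thesis using s by (simp add: abs_mult powr_mult)
      qed
      then show ?thesis using tendsto_mult_left[OF b(2), of "(1 - s) powr q"] by simp
    qed
    show ?thesis
    proof (rule powr_split_limit[OF _ conv tendsto_const])
      fix n :: nat and t :: real assume t: "0 < t" "t < 1"
      have "?f n x = u x - ((1 - s) * c n x + s * c' x)" for x by (simp add: a_def algebra_simps)
      then have "m \<le> (\<integral>x. \<bar>?f n x\<bar> powr q \<partial>M)"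
        using m_le[OF convex[OF c(1)[of n] c' s]] by (simp add: I_def)
      also have "\<dots> \<le> (1 - t) powr (1 - q) * (\<integral>x. \<bar>?g x\<bar> powr q \<partial>M) + t powr (1 - q) * (\<integral>x. \<bar>?f n x - ?g x\<bar> powr q \<partial>M)"
        using integral_powr_split[OF Lf Lg pq(2) t] .
      finally show "m \<le> \<dots>" .
    qed
  qed
  \<comment> \<open>The derivative at b of the q-th power of the norm, up to the factor q; it lies
    in L^p because (q - 1) p = q.\<close>
  define w where "w x = signed_powr (b x) (q - 1)" for x
  have qp: "(q - 1) * p = q" using pq by (simp add: field_simps)
  have cont: "(\<lambda>x. signed_powr x (q - 1)) \<in> borel_measurable borel"
    using isCont_signed_powr[of "q - 1"] pq by (intro borel_measurable_continuous_onI continuous_at_imp_continuous_on) auto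
  have sp: "Lq M p (\<lambda>x. signed_powr (f x) (q - 1))" if "Lq M q f" for f
    using that measurable_compose[OF Lq_measurable[OF that] cont]
    by (simp add: Lq_def abs_signed_powr powr_powr qp)
  have Lw: "Lq M p w" unfolding w_def[abs_def] by (rule sp[OF b(1)])
  have var: "(\<integral>x. w x * (u x - c' x - b x) \<partial>M) \<ge> 0" if c': "c' \<in> C" for c'
  proof -
    define h where "h x = u x - c' x - b x" for x
    have Lh: "Lq M q h" unfolding h_def[abs_def] using b u C[OF c'] pq by (intro Lq_diff) auto
    define s where "s n = 1 / real (Suc n)" for n
    have s: "s n > 0" "s n \<le> 1" for n by (simp_all add: s_def)
    have slim: "s \<longlonglongrightarrow> 0" unfolding s_def by real_asymp
    define g where "g n x = signed_powr (b x + s n * h x) (q - 1)" for n x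
    have Lbs: "Lq M q (\<lambda>x. b x + s n * h x)" for n using b Lh pq by (intro Lq_add Lq_cmult) auto
    have Lg: "Lq M p (g n)" for n unfolding g_def by (rule sp[OF Lbs])
    have ig: "integrable M (\<lambda>x. g n x * h x)" for n by (rule integrable_mult_Lq[OF Lg Lh pq])
    \<comment> \<open>The tangent is taken at the moved point b + s h and evaluated at b. Minimality
      of b then gives the sign for every s > 0, and w is reached by letting s tend to 0 under the
      integral.\<close>
    have nonneg: "(\<integral>x. g n x * h x \<partial>M) \<ge> 0" for n
    proof -
      have "(\<integral>x. \<bar>b x + s n * h x\<bar> powr q + q * (g n x * (- s n * h x)) \<partial>M) \<le> (\<integral>x. \<bar>b x\<bar> powr q \<partial>M)"
      proof (rule integral_mono)
        show "integrable M (\<lambda>x. \<bar>b x + s n * h x\<bar> powr q + q * (g n x * (- s n * h x)))"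
          using Lq_integrable[OF Lbs] integrable_mult_right[OF ig, of "- q * s n" n] by (simp add: mult_ac)
        show "\<bar>b x + s n * h x\<bar> powr q + q * (g n x * (- s n * h x)) \<le> \<bar>b x\<bar> powr q" for x
          using powr_tangent[OF pq(2), of "b x + s n * h x" "b x"] by (simp add: g_def)
      qed (use b Lq_integrable in auto)
      also have "\<dots> \<le> m" by (rule b_le)
      also have "m \<le> (\<integral>x. \<bar>b x + s n * h x\<bar> powr q \<partial>M)" using seg[OF c', of "s n"] s[of n] by (simp add: h_def)
      also have "(\<integral>x. \<bar>b x + s n * h x\<bar> powr q + q * (g n x * (- s n * h x)) \<partial>M)
          = (\<integral>x. \<bar>b x + s n * h x\<bar> powr q \<partial>M) - (q * s n) * (\<integral>x. g n x * h x \<partial>M)"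
      proof -
        have "(\<integral>x. \<bar>b x + s n * h x\<bar> powr q + q * (g n x * (- s n * h x)) \<partial>M)
          = (\<integral>x. \<bar>b x + s n * h x\<bar> powr q - (q * s n) * (g n x * h x) \<partial>M)"
          by (simp add: mult_ac)
        then show ?thesis using Lq_integrable[OF Lbs] ig by simp
      qed
      finally have "(q * s n) * (\<integral>x. g n x * h x \<partial>M) \<ge> 0" by simp
      moreover have "q * s n > 0" using pq s by simp
      ultimately show ?thesis by (simp add: zero_le_mult_iff)
    qed
    have "(\<lambda>n. \<integral>x. g n x * h x \<partial>M) \<longlonglongrightarrow> (\<integral>x. w x * h x \<partial>M)"
    proof (rule integral_dominated_convergence[where w = "\<lambda>x. \<bar>\<bar>b x\<bar> + \<bar>h x\<bar>\<bar> powr q"])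
      show "(\<lambda>x. g n x * h x) \<in> borel_measurable M" for n using ig by simp
      show "(\<lambda>x. w x * h x) \<in> borel_measurable M"
        by (intro borel_measurable_times Lq_measurable[OF Lw] Lq_measurable[OF Lh])
      have "Lq M q (\<lambda>x. \<bar>b x\<bar>)" "Lq M q (\<lambda>x. \<bar>h x\<bar>)" using b Lh by (simp_all add: Lq_abs)
      then have "Lq M q (\<lambda>x. \<bar>b x\<bar> + \<bar>h x\<bar>)" using pq by (intro Lq_add) auto
      then show "integrable M (\<lambda>x. \<bar>\<bar>b x\<bar> + \<bar>h x\<bar>\<bar> powr q)" by (rule Lq_integrable)
      show "AE x in M. (\<lambda>n. g n x * h x) \<longlonglongrightarrow> w x * h x"
      proof (intro AE_I2 tendsto_mult tendsto_const)
        fix x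
        have "(\<lambda>n. b x + s n * h x) \<longlonglongrightarrow> b x + 0 * h x" using slim by (intro tendsto_intros)
        then have "(\<lambda>n. b x + s n * h x) \<longlonglongrightarrow> b x" by simp
        then show "(\<lambda>n. g n x) \<longlonglongrightarrow> w x" unfolding g_def w_def
          using pq by (intro isCont_tendsto_compose[OF isCont_signed_powr]) auto
      qed
      show "AE x in M. norm (g n x * h x) \<le> \<bar>\<bar>b x\<bar> + \<bar>h x\<bar>\<bar> powr q" for n
      proof (rule AE_I2)
        fix x
        let ?z = "\<bar>b x\<bar> + \<bar>h x\<bar>"
        have "\<bar>s n * h x\<bar> \<le> 1 * \<bar>h x\<bar>" unfolding abs_mult using s[of n] by (intro mult_right_mono) auto
        then have "\<bar>b x + s n * h x\<bar> \<le> ?z" by linarith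
        then have "\<bar>g n x\<bar> \<le> ?z powr (q - 1)" unfolding g_def abs_signed_powr using pq by (intro powr_mono2) auto
        then have "\<bar>g n x\<bar> * \<bar>h x\<bar> \<le> ?z powr (q - 1) * ?z" by (intro mult_mono) auto
        also have "\<dots> = ?z powr q" by (cases "?z = 0") (simp_all add: powr_diff)
        finally show "norm (g n x * h x) \<le> \<bar>?z\<bar> powr q" by (simp add: abs_mult)
      qed
    qed
    then have "0 \<le> (\<integral>x. w x * h x \<partial>M)" by (rule LIMSEQ_le_const) (use nonneg in auto)
    then show ?thesis by (simp add: h_def)
  qed
  have iwu: "integrable M (\<lambda>x. w x * u x)" by (rule integrable_mult_Lq[OF Lw u pq])
  have iwb: "integrable M (\<lambda>x. w x * b x)" by (rule integrable_mult_Lq[OF Lw b(1) pq])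
  have wb: "(\<integral>x. w x * b x \<partial>M) = (\<integral>x. \<bar>b x\<bar> powr q \<partial>M)" by (simp add: w_def signed_powr_mult_self)
  \<comment> \<open>The hypothesis \<open>sep\<close> with this right-hand side as the bound forces
    the integral of \<bar>b\<bar>^q to be at most 0, so the distance to \<open>C\<close> is
    0.\<close>
  have "(\<integral>x. w x * u x \<partial>M) \<le> (\<integral>x. w x * u x \<partial>M) - (\<integral>x. \<bar>b x\<bar> powr q \<partial>M)"
  proof (rule sep[OF Lw])
    fix c' assume c': "c' \<in> C"
    have "integrable M (\<lambda>x. w x * c' x)" by (rule integrable_mult_Lq[OF Lw C[OF c'] pq])
    with var[OF c'] iwu iwb have "(\<integral>x. w x * u x \<partial>M) - (\<integral>x. w x * c' x \<partial>M) - (\<integral>x. w x * b x \<partial>M) \<ge> 0"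
      by (simp add: right_diff_distrib)
    then show "(\<integral>x. w x * c' x \<partial>M) \<le> (\<integral>x. w x * u x \<partial>M) - (\<integral>x. \<bar>b x\<bar> powr q \<partial>M)" using wb by simp
  qed
  moreover obtain c0 where "c0 \<in> C" using ne by blast
  with seg[of c0 0] have "m \<le> (\<integral>x. \<bar>b x\<bar> powr q \<partial>M)" by simp
  ultimately have "m < e" using e by simp
  then show ?thesis unfolding m_def using cINF_less_iff[OF ne bdd] by (auto simp: I_def)
qed

end

section \<open>Vector fields\<close>

lemma K_norm_nonneg [simp]: "0 \<le> K_norm d a"
  by (simp add: K_norm_def)

lemma K_norm_power2: "(K_norm d a)\<^sup>2 = (\<Sum>\<alpha>\<in>K_index d. (a \<alpha>)\<^sup>2)"
  by (simp add: K_norm_def L2_set_def sum_nonneg)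

lemma component_le_K_norm: "\<alpha> \<in> K_index d \<Longrightarrow> \<bar>a \<alpha>\<bar> \<le> K_norm d a"
  unfolding K_norm_def using member_le_L2_set[OF finite_K_index, of \<alpha> d "\<lambda>\<alpha>. \<bar>a \<alpha>\<bar>"]
  by (simp add: L2_set_def)

lemma K_norm_le_sum: "K_norm d a \<le> (\<Sum>\<alpha>\<in>K_index d. \<bar>a \<alpha>\<bar>)"
  unfolding K_norm_def by (rule L2_set_le_sum_abs)

lemma K_norm_triangle: "K_norm d (\<lambda>\<alpha>. a \<alpha> + b \<alpha>) \<le> K_norm d a + K_norm d b"
  unfolding K_norm_def by (rule L2_set_triangle_ineq)

lemma K_norm_cmult: "K_norm d (\<lambda>\<alpha>. c * a \<alpha>) = \<bar>c\<bar> * K_norm d a"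
proof -
  have "(K_norm d (\<lambda>\<alpha>. c * a \<alpha>))\<^sup>2 = (\<bar>c\<bar> * K_norm d a)\<^sup>2"
    by (simp add: K_norm_power2 power_mult_distrib sum_distrib_left)
  then show ?thesis by (simp add: power2_eq_iff_nonneg)
qed

lemma K_norm_convex:
  assumes "K_norm d a \<le> 1" "K_norm d b \<le> 1" "0 \<le> s" "s \<le> 1"
  shows "K_norm d (\<lambda>\<alpha>. (1 - s) * a \<alpha> + s * b \<alpha>) \<le> 1"
proof -
  have "K_norm d (\<lambda>\<alpha>. (1 - s) * a \<alpha> + s * b \<alpha>) \<le> (1 - s) * K_norm d a + s * K_norm d b"
    using K_norm_triangle[of d "\<lambda>\<alpha>. (1 - s) * a \<alpha>" "\<lambda>\<alpha>. s * b \<alpha>"] assms by (simp add: K_norm_cmult)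
  also have "\<dots> \<le> (1 - s) * 1 + s * 1" using assms by (intro add_mono mult_left_mono) auto
  finally show ?thesis by simp
qed

lemma K_norm_minus_commute: "K_norm d (\<lambda>\<alpha>. a \<alpha> - b \<alpha>) = K_norm d (\<lambda>\<alpha>. b \<alpha> - a \<alpha>)"
  using K_norm_cmult[of d "-1" "\<lambda>\<alpha>. a \<alpha> - b \<alpha>"] by simp

lemma K_inner_abs_le: "\<bar>K_inner d a b\<bar> \<le> K_norm d a * K_norm d b"
proof -
  have "\<bar>K_inner d a b\<bar> \<le> (\<Sum>\<alpha>\<in>K_index d. \<bar>a \<alpha>\<bar> * \<bar>b \<alpha>\<bar>)"
    unfolding K_inner_def abs_mult[symmetric] by (rule sum_abs)
  also have "\<dots> \<le> K_norm d a * K_norm d b"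
    unfolding K_norm_def by (rule L2_set_mult_ineq)
  finally show ?thesis .
qed

lemma K_norm_measurable:
  assumes "\<And>\<alpha>. \<alpha> \<in> K_index d \<Longrightarrow> (\<lambda>x. v x \<alpha>) \<in> borel_measurable M"
  shows "(\<lambda>x. K_norm d (v x)) \<in> borel_measurable M"
  unfolding K_norm_def L2_set_def
  by (rule measurable_compose[OF _ borel_measurable_sqrt]) (intro borel_measurable_sum borel_measurable_power assms)

lemma in_L_eq_Lq: "in_L q f \<longleftrightarrow> Lq Q_measure q f"
  by (simp add: in_L_def Lq_def)

lemma Lq_mono:
  assumes "Lq M q f" "g \<in> borel_measurable M" "\<And>x. \<bar>g x\<bar> \<le> \<bar>f x\<bar>" "q \<ge> 0"
  shows "Lq M q g"
proof -
  have "integrable M (\<lambda>x. \<bar>g x\<bar> powr q)"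
  proof (rule Bochner_Integration.integrable_bound[OF Lq_integrable[OF assms(1)]])
    show "(\<lambda>x. \<bar>g x\<bar> powr q) \<in> borel_measurable M" using assms(2) by measurable
    show "AE x in M. norm (\<bar>g x\<bar> powr q) \<le> norm (\<bar>f x\<bar> powr q)"
      using assms(3,4) by (intro AE_I2) (simp add: powr_mono2)
  qed
  with assms(2) show ?thesis by (simp add: Lq_def)
qed

lemma Lq_sum:
  assumes "\<And>a. a \<in> A \<Longrightarrow> Lq M q (f a)" "q > 0" shows "Lq M q (\<lambda>x. \<Sum>a\<in>A. f a x)"
  using assms(1)
  by (induction A rule: infinite_finite_induct) (use assms(2) in \<open>auto intro!: Lq_add simp: Lq_def[of M q "\<lambda>x. 0"]\<close>)

lemma in_L_field_component:
  assumes "in_L_field d q v" "q > 0" "\<alpha> \<in> K_index d"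
  shows "Lq Q_measure q (\<lambda>x. v x \<alpha>)"
proof (rule Lq_mono[where f = "\<lambda>x. K_norm d (v x)"])
  show "Lq Q_measure q (\<lambda>x. K_norm d (v x))"
    using assms(1) by (simp add: in_L_field_def Lq_def K_norm_measurable)
qed (use assms component_le_K_norm[of \<alpha> d] in \<open>auto simp: in_L_field_def\<close>)

lemma in_L_field_iff:
  fixes v :: "'n::finite field"
  assumes "q > 0"
  shows "in_L_field d q v \<longleftrightarrow> (\<forall>\<alpha>\<in>K_index d. Lq Q_measure q (\<lambda>x. v x \<alpha>))"
proof (intro iffI ballI)
  assume L: "\<forall>\<alpha>\<in>K_index d. Lq Q_measure q (\<lambda>x. v x \<alpha>)"
  then have m: "(\<lambda>x. v x \<alpha>) \<in> borel_measurable Q_measure" if "\<alpha> \<in> K_index d" for \<alpha>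
    using that by (simp add: Lq_def)
  have "Lq Q_measure q (\<lambda>x. K_norm d (v x))"
  proof (rule Lq_mono[where f = "\<lambda>x. \<Sum>\<alpha>\<in>K_index d. \<bar>v x \<alpha>\<bar>"])
    show "Lq Q_measure q (\<lambda>x. \<Sum>\<alpha>\<in>K_index d. \<bar>v x \<alpha>\<bar>)"
      using L assms by (intro Lq_sum Lq_abs) auto
    show "\<bar>K_norm d (v x)\<bar> \<le> \<bar>\<Sum>\<alpha>\<in>K_index d. \<bar>v x \<alpha>\<bar>\<bar>" for x
      using K_norm_le_sum[of d "v x"] by (simp add: sum_nonneg)
  qed (use assms m K_norm_measurable in auto)
  with m show "in_L_field d q v" by (simp add: in_L_field_def Lq_def)
next
  fix \<alpha> :: "'n list" assume "in_L_field d q v" "\<alpha> \<in> K_index d"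
  then show "Lq Q_measure q (\<lambda>x. v x \<alpha>)" using assms by (intro in_L_field_component)
qed

lemma Lq_K_norm:
  assumes "in_L_field d q v" shows "Lq Q_measure q (\<lambda>x. K_norm d (v x))"
  using assms by (simp add: in_L_field_def Lq_def K_norm_measurable)

lemma test_function_Lq: "test_function f \<Longrightarrow> q \<ge> 0 \<Longrightarrow> Lq Q_measure q f"
proof -
  assume f: "test_function f" and q: "q \<ge> 0"
  obtain C where "\<And>x. \<bar>f x\<bar> \<le> C" using test_function_bounded[OF f] by blast
  then have "AE x in Q_measure. \<bar>f x\<bar> \<le> C" by simp
  then show "Lq Q_measure q f"
    using finite_measure.Lq_bounded[OF finite_measure_Q smooth_measurable_Q[OF test_function_smooth[OF f]] _ q] by blast
qed

lemma test_field_in_L: "test_field d \<phi> \<Longrightarrow> q > 0 \<Longrightarrow> in_L_field d q \<phi>"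
  by (simp add: in_L_field_iff test_field_def test_function_Lq)

lemma in_L_field_diff: "in_L_field d q v \<Longrightarrow> in_L_field d q w \<Longrightarrow> q > 0 \<Longrightarrow> in_L_field d q (\<lambda>x \<alpha>. v x \<alpha> - w x \<alpha>)"
  by (auto simp: in_L_field_iff intro!: Lq_diff)

lemma bounded_op_B:
  assumes "smooth \<Phi>"
  obtains C where "C \<ge> 0" "\<And>x. x \<in> Q_cube \<Longrightarrow> K_norm d (op_B B \<Phi> x) \<le> C"
proof -
  have "\<exists>C\<ge>0. \<forall>x\<in>cbox 0 1. \<bar>op_B B \<Phi> x \<alpha>\<bar> \<le> C" for \<alpha>
  proof (rule smooth_bounded_on_compact[OF smooth_op_B[OF assms, of B \<alpha>] compact_cbox[of 0 1]])
    fix C assume "C \<ge> 0" "\<And>x. x \<in> cbox 0 1 \<Longrightarrow> \<bar>op_B B \<Phi> x \<alpha>\<bar> \<le> C"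
    then show ?thesis by (intro exI[of _ C]) simp
  qed
  then have "\<exists>C. \<forall>\<alpha>. C \<alpha> \<ge> 0 \<and> (\<forall>x\<in>cbox 0 1. \<bar>op_B B \<Phi> x \<alpha>\<bar> \<le> C \<alpha>)"
    by (intro choice) simp
  then obtain C where "\<forall>\<alpha>. C \<alpha> \<ge> 0 \<and> (\<forall>x\<in>cbox 0 1. \<bar>op_B B \<Phi> x \<alpha>\<bar> \<le> C \<alpha>)" ..
  then have C: "\<And>\<alpha>. C \<alpha> \<ge> 0" "\<And>\<alpha> x. x \<in> cbox 0 1 \<Longrightarrow> \<bar>op_B B \<Phi> x \<alpha>\<bar> \<le> C \<alpha>" by auto
  have "K_norm d (op_B B \<Phi> x) \<le> (\<Sum>\<alpha>\<in>K_index d. C \<alpha>)" if "x \<in> Q_cube" for x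
  proof -
    have "x \<in> cbox 0 1" using that Q_cube_subset by blast
    then have "(\<Sum>\<alpha>\<in>K_index d. \<bar>op_B B \<Phi> x \<alpha>\<bar>) \<le> (\<Sum>\<alpha>\<in>K_index d. C \<alpha>)"
      by (intro sum_mono C)
    with K_norm_le_sum[of d "op_B B \<Phi> x"] show ?thesis by linarith
  qed
  moreover have "(\<Sum>\<alpha>\<in>K_index d. C \<alpha>) \<ge> 0" using C by (simp add: sum_nonneg)
  ultimately show ?thesis using that[of "\<Sum>\<alpha>\<in>K_index d. C \<alpha>"] by simp
qed

lemma integrable_smooth_mult:
  assumes "smooth \<Phi>" "integrable Q_measure f" shows "integrable Q_measure (\<lambda>x. \<Phi> x * f x)"
proof -
  obtain C where C: "C \<ge> 0" "\<And>x. x \<in> cbox 0 1 \<Longrightarrow> \<bar>\<Phi> x\<bar> \<le> C"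
    using smooth_bounded_on_compact[OF assms(1) compact_cbox[of 0 1]] by blast
  show ?thesis
  proof (rule Bochner_Integration.integrable_bound)
    show "integrable Q_measure (\<lambda>x. C * f x)" using assms(2) by simp
    show "(\<lambda>x. \<Phi> x * f x) \<in> borel_measurable Q_measure"
      by (intro borel_measurable_times smooth_measurable_Q assms(1) borel_measurable_integrable assms(2))
    show "AE x in Q_measure. norm (\<Phi> x * f x) \<le> norm (C * f x)"
      using C Q_cube_subset by (intro AE_I2) (auto simp: abs_mult intro!: mult_right_mono)
  qed
qed

lemma integrable_K_inner:
  assumes "smooth \<Phi>" "in_L_field d q v" "q > 1"
  shows "integrable Q_measure (\<lambda>x. K_inner d (op_B B \<Phi> x) (v x))"
  unfolding K_inner_def using assms
  by (intro Bochner_Integration.integrable_sum integrable_smooth_mult smooth_op_B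
      finite_measure.Lq_imp_integrable[OF finite_measure_Q, of q] in_L_field_component) auto

section \<open>Limits of test fields\<close>

text \<open>The identity holds for each \<phi> n, and L^q convergence on the cube implies L^1
  convergence, while \<Phi> and its derivatives are bounded there. Since \<Phi> need not vanish at
  the boundary, the conclusion says weakly that v extended by zero has g extended by zero as its
  adjoint.\<close>

lemma integral_op_B_limit:
  assumes q: "q > 1" and v: "in_L_field d q v" and g: "Lq Q_measure q g"
    and \<phi>: "\<And>n. test_field d (\<phi> n)"
    and 1: "(\<lambda>n. \<integral>x. K_norm d (\<lambda>\<alpha>. v x \<alpha> - \<phi> n x \<alpha>) powr q \<partial>Q_measure) \<longlonglongrightarrow> 0"
    and 2: "(\<lambda>n. \<integral>x. \<bar>g x - test_adjoint d B (\<phi> n) x\<bar> powr q \<partial>Q_measure) \<longlonglongrightarrow> 0"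
    and \<Phi>: "smooth \<Phi>"
  shows "(\<integral>x. K_inner d (op_B B \<Phi> x) (v x) \<partial>Q_measure) = (\<integral>x. \<Phi> x * g x \<partial>Q_measure)"
proof -
  note Lint = finite_measure.Lq_imp_integrable[OF finite_measure_Q _ q]
  have \<phi>L: "in_L_field d q (\<phi> n)" for n using \<phi> q by (intro test_field_in_L) auto
  have dL: "in_L_field d q (\<lambda>x \<alpha>. v x \<alpha> - \<phi> n x \<alpha>)" for n
    using v \<phi>L q by (intro in_L_field_diff) auto
  have aL: "Lq Q_measure q (test_adjoint d B (\<phi> n))" for n
    using q by (intro test_function_Lq test_function_test_adjoint \<phi>) auto
  have gL: "Lq Q_measure q (\<lambda>x. g x - test_adjoint d B (\<phi> n) x)" for n
    using q g aL by (intro Lq_diff) auto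
  have c1: "(\<lambda>n. \<integral>x. \<bar>K_norm d (\<lambda>\<alpha>. v x \<alpha> - \<phi> n x \<alpha>)\<bar> \<partial>Q_measure) \<longlonglongrightarrow> 0"
    using 1 by (intro finite_measure.Lq_tendsto_0_imp_L1[OF finite_measure_Q _ q] Lq_K_norm dL) auto
  have c2: "(\<lambda>n. \<integral>x. \<bar>g x - test_adjoint d B (\<phi> n) x\<bar> \<partial>Q_measure) \<longlonglongrightarrow> 0"
    by (rule finite_measure.Lq_tendsto_0_imp_L1[OF finite_measure_Q gL q 2])
  define L where "L = (\<integral>x. K_inner d (op_B B \<Phi> x) (v x) \<partial>Q_measure)"
  define R where "R = (\<integral>x. \<Phi> x * g x \<partial>Q_measure)"
  define A where "A n = (\<integral>x. \<Phi> x * test_adjoint d B (\<phi> n) x \<partial>Q_measure)" for n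
  obtain C where C: "C \<ge> 0" "\<And>x. x \<in> Q_cube \<Longrightarrow> K_norm d (op_B B \<Phi> x) \<le> C"
    using bounded_op_B[OF \<Phi>] by blast
  obtain D where D: "D \<ge> 0" "\<And>x. x \<in> cbox 0 1 \<Longrightarrow> \<bar>\<Phi> x\<bar> \<le> D"
    using smooth_bounded_on_compact[OF \<Phi> compact_cbox[of 0 1]] by blast
  have L1: "\<bar>L - A n\<bar> \<le> C * (\<integral>x. \<bar>K_norm d (\<lambda>\<alpha>. v x \<alpha> - \<phi> n x \<alpha>)\<bar> \<partial>Q_measure)" for n
  proof -
    have i: "integrable Q_measure (\<lambda>x. K_inner d (op_B B \<Phi> x) (\<lambda>\<alpha>. v x \<alpha> - \<phi> n x \<alpha>))"
      using integrable_K_inner[OF \<Phi> dL q] .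
    have "L - A n = (\<integral>x. K_inner d (op_B B \<Phi> x) (v x) - K_inner d (op_B B \<Phi> x) (\<phi> n x) \<partial>Q_measure)"
      unfolding L_def A_def integral_op_B_test_field[OF \<phi> \<Phi>, symmetric]
      using integrable_K_inner[OF \<Phi> v q] integrable_K_inner[OF \<Phi> \<phi>L q] by simp
    also have "\<dots> = (\<integral>x. K_inner d (op_B B \<Phi> x) (\<lambda>\<alpha>. v x \<alpha> - \<phi> n x \<alpha>) \<partial>Q_measure)"
      by (simp add: K_inner_def right_diff_distrib sum_subtractf)
    finally have "\<bar>L - A n\<bar> \<le> (\<integral>x. \<bar>K_inner d (op_B B \<Phi> x) (\<lambda>\<alpha>. v x \<alpha> - \<phi> n x \<alpha>)\<bar> \<partial>Q_measure)"
      by (simp add: integral_abs_bound)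
    also have "\<dots> \<le> (\<integral>x. C * \<bar>K_norm d (\<lambda>\<alpha>. v x \<alpha> - \<phi> n x \<alpha>)\<bar> \<partial>Q_measure)"
    proof (rule integral_mono)
      show "integrable Q_measure (\<lambda>x. C * \<bar>K_norm d (\<lambda>\<alpha>. v x \<alpha> - \<phi> n x \<alpha>)\<bar>)"
        using Lint[OF Lq_K_norm[OF dL]] by simp
      fix x :: "real^'a" assume "x \<in> space Q_measure"
      then have "K_norm d (op_B B \<Phi> x) * K_norm d (\<lambda>\<alpha>. v x \<alpha> - \<phi> n x \<alpha>) \<le> C * K_norm d (\<lambda>\<alpha>. v x \<alpha> - \<phi> n x \<alpha>)"
        using C by (intro mult_right_mono) auto
      with K_inner_abs_le[of d "op_B B \<Phi> x" "\<lambda>\<alpha>. v x \<alpha> - \<phi> n x \<alpha>"]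
      show "\<bar>K_inner d (op_B B \<Phi> x) (\<lambda>\<alpha>. v x \<alpha> - \<phi> n x \<alpha>)\<bar> \<le> C * \<bar>K_norm d (\<lambda>\<alpha>. v x \<alpha> - \<phi> n x \<alpha>)\<bar>"
        by simp
    qed (use i in simp)
    finally show ?thesis by simp
  qed
  have L2: "(\<lambda>n. C * (\<integral>x. \<bar>K_norm d (\<lambda>\<alpha>. v x \<alpha> - \<phi> n x \<alpha>)\<bar> \<partial>Q_measure)) \<longlonglongrightarrow> 0"
    using tendsto_mult_left[OF c1, of C] by simp
  have "(\<lambda>n. L - A n) \<longlonglongrightarrow> 0" by (rule Lim_null_comparison[OF always_eventually L2]) (use L1 in auto)
  then have AL: "A \<longlonglongrightarrow> L" using tendsto_diff[OF tendsto_const[of L], of "\<lambda>n. L - A n" 0] by simp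
  have R1: "\<bar>R - A n\<bar> \<le> D * (\<integral>x. \<bar>g x - test_adjoint d B (\<phi> n) x\<bar> \<partial>Q_measure)" for n
  proof -
    have i: "integrable Q_measure (\<lambda>x. \<Phi> x * (g x - test_adjoint d B (\<phi> n) x))"
      by (intro integrable_smooth_mult \<Phi> Lint gL)
    have "R - A n = (\<integral>x. \<Phi> x * (g x - test_adjoint d B (\<phi> n) x) \<partial>Q_measure)"
      unfolding R_def A_def using integrable_smooth_mult[OF \<Phi> Lint[OF g]] integrable_smooth_mult[OF \<Phi> Lint[OF aL]]
      by (simp add: right_diff_distrib)
    then have "\<bar>R - A n\<bar> \<le> (\<integral>x. \<bar>\<Phi> x * (g x - test_adjoint d B (\<phi> n) x)\<bar> \<partial>Q_measure)"
      by (simp add: integral_abs_bound)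
    also have "\<dots> \<le> (\<integral>x. D * \<bar>g x - test_adjoint d B (\<phi> n) x\<bar> \<partial>Q_measure)"
    proof (rule integral_mono)
      show "integrable Q_measure (\<lambda>x. D * \<bar>g x - test_adjoint d B (\<phi> n) x\<bar>)" using Lint[OF gL] by simp
      fix x :: "real^'a" assume "x \<in> space Q_measure"
      then show "\<bar>\<Phi> x * (g x - test_adjoint d B (\<phi> n) x)\<bar> \<le> D * \<bar>g x - test_adjoint d B (\<phi> n) x\<bar>"
        unfolding abs_mult using D Q_cube_subset by (intro mult_right_mono) auto
    qed (use i in simp)
    finally show ?thesis by simp
  qed
  have R2: "(\<lambda>n. D * (\<integral>x. \<bar>g x - test_adjoint d B (\<phi> n) x\<bar> \<partial>Q_measure)) \<longlonglongrightarrow> 0"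
    using tendsto_mult_left[OF c2, of D] by simp
  have "(\<lambda>n. R - A n) \<longlonglongrightarrow> 0" by (rule Lim_null_comparison[OF always_eventually R2]) (use R1 in auto)
  then have "A \<longlonglongrightarrow> R" using tendsto_diff[OF tendsto_const[of R], of "\<lambda>n. R - A n" 0] by simp
  with AL have "L = R" by (rule LIMSEQ_unique)
  then show ?thesis by (simp add: L_def R_def)
qed

lemma L_norm_powr: "q > 0 \<Longrightarrow> L_norm q f powr q = (\<integral>x. \<bar>f x\<bar> powr q \<partial>Q_measure)"
  by (simp add: L_norm_def powr_powr)

lemma adjoint_B_diff_test_field:
  assumes q: "q > 1" and v: "in_L_field d q v" and g: "Lq Q_measure q g" "is_adjoint d B v g"
    and \<phi>: "test_field d \<phi>"
  shows "AE x in Q_measure. adjoint_B d B (\<lambda>x \<alpha>. v x \<alpha> - \<phi> x \<alpha>) x = g x - test_adjoint d B \<phi> x"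
    and "integrable Q_measure (adjoint_B d B (\<lambda>x \<alpha>. v x \<alpha> - \<phi> x \<alpha>))"
proof -
  have gi: "integrable Q_measure g" "integrable Q_measure (test_adjoint d B \<phi>)"
    using finite_measure.Lq_imp_integrable[OF finite_measure_Q g(1) q]
    by (auto intro: test_function_integrable test_function_test_adjoint \<phi>)
  then have 1: "integrable Q_measure (\<lambda>x. g x - test_adjoint d B \<phi> x)" by simp
  have 2: "is_adjoint d B (\<lambda>x \<alpha>. v x \<alpha> - \<phi> x \<alpha>) (\<lambda>x. g x - test_adjoint d B \<phi> x)"
    unfolding is_adjoint_def
  proof (intro allI impI)
    fix f :: "real^'a \<Rightarrow> real" assume f: "test_function f"
    note s = test_function_smooth[OF f]
    have \<phi>L: "in_L_field d q \<phi>" using \<phi> q by (intro test_field_in_L) auto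
    have "(\<integral>x. K_inner d (op_B B f x) (\<lambda>\<alpha>. v x \<alpha> - \<phi> x \<alpha>) \<partial>Q_measure)
      = (\<integral>x. K_inner d (op_B B f x) (v x) - K_inner d (op_B B f x) (\<phi> x) \<partial>Q_measure)"
      by (simp add: K_inner_def right_diff_distrib sum_subtractf)
    also have "\<dots> = (\<integral>x. f x * g x \<partial>Q_measure) - (\<integral>x. f x * test_adjoint d B \<phi> x \<partial>Q_measure)"
      using integrable_K_inner[OF s v q] integrable_K_inner[OF s \<phi>L q] g(2) f
        integral_op_B_test_field[OF \<phi> s] by (simp add: is_adjoint_def)
    also have "\<dots> = (\<integral>x. f x * (g x - test_adjoint d B \<phi> x) \<partial>Q_measure)"
      using integrable_smooth_mult[OF s gi(1)] integrable_smooth_mult[OF s gi(2)] by (simp add: right_diff_distrib)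
    finally show "(\<integral>x. K_inner d (op_B B f x) (\<lambda>\<alpha>. v x \<alpha> - \<phi> x \<alpha>) \<partial>Q_measure)
      = (\<integral>x. f x * (g x - test_adjoint d B \<phi> x) \<partial>Q_measure)" .
  qed
  from adjoint_B_eq[OF 1 2]
  show "AE x in Q_measure. adjoint_B d B (\<lambda>x \<alpha>. v x \<alpha> - \<phi> x \<alpha>) x = g x - test_adjoint d B \<phi> x"
    "integrable Q_measure (adjoint_B d B (\<lambda>x \<alpha>. v x \<alpha> - \<phi> x \<alpha>))" by auto
qed

text \<open>The norm refers to a chosen representative of the adjoint of the difference. Replacing
  it by g - \<open>test_adjoint d B \<phi>\<close> turns membership in W0 into two explicit L^q
  convergences.\<close>

lemma W_norm_diff_test_field:
  assumes q: "q > 1" and v: "in_L_field d q v" and g: "Lq Q_measure q g" "is_adjoint d B v g"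
    and \<phi>: "test_field d \<phi>"
  shows "W_norm d q B (\<lambda>x \<alpha>. v x \<alpha> - \<phi> x \<alpha>) powr q
    = (\<integral>x. K_norm d (\<lambda>\<alpha>. v x \<alpha> - \<phi> x \<alpha>) powr q \<partial>Q_measure)
      + (\<integral>x. \<bar>g x - test_adjoint d B \<phi> x\<bar> powr q \<partial>Q_measure)"
proof -
  note ae = adjoint_B_diff_test_field[OF assms]
  have aL: "Lq Q_measure q (test_adjoint d B \<phi>)"
    using q by (intro test_function_Lq test_function_test_adjoint \<phi>) auto
  have "Lq Q_measure q (\<lambda>x. g x - test_adjoint d B \<phi> x)" using q g aL by (intro Lq_diff) auto
  have mg: "g \<in> borel_measurable Q_measure" "test_adjoint d B \<phi> \<in> borel_measurable Q_measure"
    using g aL by (auto simp: Lq_def)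
  have "adjoint_B d B (\<lambda>x \<alpha>. v x \<alpha> - \<phi> x \<alpha>) \<in> borel_measurable Q_measure"
    using ae(2) by simp
  then have "(\<integral>x. \<bar>adjoint_B d B (\<lambda>x \<alpha>. v x \<alpha> - \<phi> x \<alpha>) x\<bar> powr q \<partial>Q_measure)
     = (\<integral>x. \<bar>g x - test_adjoint d B \<phi> x\<bar> powr q \<partial>Q_measure)"
    using mg ae(1) by (intro integral_cong_AE) (auto elim: AE_mp)
  then show ?thesis using q by (simp add: W_norm_def L_norm_powr powr_powr add_nonneg_nonneg)
qed

section \<open>Admissible fields and the construction of v from a subgradient\<close>

definition admissible :: "nat \<Rightarrow> 'n::finite field set" where
  "admissible d = {\<phi>. test_field d \<phi> \<and> (\<forall>x. K_norm d (\<phi> x) \<le> 1)}"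

text \<open>The integrands agree almost everywhere, so the integrals coincide, also where the
  Bochner integral takes its default value 0.\<close>

lemma PV_eq_SUP:
  assumes "w \<in> borel_measurable Q_measure"
  shows "PV d B w = (SUP \<phi>\<in>admissible d. ereal (\<integral>x. w x * test_adjoint d B \<phi> x \<partial>Q_measure))"
  unfolding PV_def admissible_def
proof (rule SUP_cong[OF refl])
  fix \<phi> :: "'a field" assume "\<phi> \<in> {\<phi>. test_field d \<phi> \<and> (\<forall>x. K_norm d (\<phi> x) \<le> 1)}"
  then have \<phi>: "test_field d \<phi>" by simp
  note t = test_function_integrable[OF test_function_test_adjoint[OF \<phi>]]
  have i: "integrable Q_measure (adjoint_B d B \<phi>)"
    by (rule adjoint_B_eq(2)[OF t is_adjoint_test_adjoint[OF \<phi>]])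
  have ae: "AE x in Q_measure. w x * adjoint_B d B \<phi> x = w x * test_adjoint d B \<phi> x"
    using adjoint_B_test_field[OF \<phi>, of B] by eventually_elim simp
  have "(\<integral>x. w x * adjoint_B d B \<phi> x \<partial>Q_measure) = (\<integral>x. w x * test_adjoint d B \<phi> x \<partial>Q_measure)"
    by (rule integral_cong_AE[OF borel_measurable_times borel_measurable_times ae])
      (rule assms borel_measurable_integrable i t)+
  then show "ereal (\<integral>x. w x * adjoint_B d B \<phi> x \<partial>Q_measure) = ereal (\<integral>x. w x * test_adjoint d B \<phi> x \<partial>Q_measure)"
    by simp
qed

lemma test_field_combination:
  assumes "test_field d \<phi>" "test_field d \<psi>"
  shows "test_field d (\<lambda>x \<alpha>. a * \<phi> x \<alpha> + b * \<psi> x \<alpha>)"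
  using assms unfolding test_field_def by (intro ballI test_function_add test_function_cmult) blast+

lemma admissible_convex:
  assumes "\<phi> \<in> admissible d" "\<psi> \<in> admissible d" "0 \<le> s" "s \<le> 1"
  shows "(\<lambda>x \<alpha>. (1 - s) * \<phi> x \<alpha> + s * \<psi> x \<alpha>) \<in> admissible d"
  using assms by (auto simp: admissible_def intro: test_field_combination K_norm_convex)

lemma admissible_zero: "(\<lambda>x \<alpha>. 0) \<in> admissible d"
  by (simp add: admissible_def test_field_def test_function_zero K_norm_def L2_set_def)

text \<open>Nearly minimising a quadratic functional along a decreasing sequence of convex sets yields a
  Cauchy sequence, by the parallelogram identity.\<close>

lemma minimizing_sequence_Cauchy:
  fixes K :: "nat \<Rightarrow> 'x set" and E :: "'x \<Rightarrow> real" and D :: "'x \<Rightarrow> 'x \<Rightarrow> real"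
  assumes ne: "\<And>n. K n \<noteq> {}" and dec: "\<And>m n. m \<le> n \<Longrightarrow> K n \<subseteq> K m"
    and E: "\<And>x. x \<in> K 0 \<Longrightarrow> 0 \<le> E x" "\<And>x. x \<in> K 0 \<Longrightarrow> E x \<le> C"
    and mid: "\<And>n x y. x \<in> K n \<Longrightarrow> y \<in> K n \<Longrightarrow> mid x y \<in> K n"
    and D: "\<And>x y. x \<in> K 0 \<Longrightarrow> y \<in> K 0 \<Longrightarrow> D x y \<le> 2 * E x + 2 * E y - 4 * E (mid x y)"
  obtains X where "\<And>n. X n \<in> K n" "\<And>e. e > 0 \<Longrightarrow> \<exists>N. \<forall>i\<ge>N. \<forall>j\<ge>N. D (X i) (X j) < e"
proof -
  have K0: "x \<in> K 0" if "x \<in> K n" for x n using dec[of 0 n] that by auto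
  define m where "m n = (INF x\<in>K n. E x)" for n
  have bdd: "bdd_below (E ` K n)" for n
    by (rule bdd_belowI2[where m = 0]) (use E(1) K0 in auto)
  have m_le: "m n \<le> E x" if "x \<in> K n" for n x unfolding m_def using bdd that by (rule cINF_lower)
  \<comment> \<open>The infima grow as the sets shrink and stay below C, so they converge; the limit
    replaces an infimum over a possibly empty intersection.\<close>
  have "incseq m"
    unfolding m_def by (intro incseq_SucI cINF_superset_mono ne bdd dec) auto
  moreover have "m n \<le> C" for n
  proof -
    obtain x where "x \<in> K n" using ne by blast
    then show ?thesis using m_le[of x n] E(2)[OF K0] by (meson order_trans)
  qed
  ultimately obtain l where l: "m \<longlonglongrightarrow> l" "\<And>n. m n \<le> l"
    using incseq_convergent[of m C] by blast
  have "\<exists>x\<in>K n. E x < m n + 1 / real (Suc n)" for n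
    using cINF_less_iff[OF ne bdd, of n "m n + 1 / real (Suc n)"] by (simp add: m_def)
  then obtain X where X: "\<And>n. X n \<in> K n" "\<And>n. E (X n) < m n + 1 / real (Suc n)" by metis
  have "\<exists>N. \<forall>i\<ge>N. \<forall>j\<ge>N. D (X i) (X j) < e" if e: "e > 0" for e
  proof -
    \<comment> \<open>Beyond N each energy is at most l + 1/(N+1), and that of the midpoint is at
      least m N. The parallelogram inequality bounds D by the N-th term of this sequence.\<close>
    have "(\<lambda>n. 4 * (l + 1 / real (Suc n)) - 4 * m n) \<longlonglongrightarrow> 4 * (l + 0) - 4 * l"
      using l(1) LIMSEQ_inverse_real_of_nat by (intro tendsto_intros) (simp add: inverse_eq_divide)
    then have "(\<lambda>n. 4 * (l + 1 / real (Suc n)) - 4 * m n) \<longlonglongrightarrow> 0" by simp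
    from order_tendstoD(2)[OF this e] obtain N where N: "4 * (l + 1 / real (Suc N)) - 4 * m N < e"
      by (auto simp: eventually_sequentially)
    have "D (X i) (X j) < e" if ij: "i \<ge> N" "j \<ge> N" for i j
    proof -
      have in_N: "X i \<in> K N" "X j \<in> K N" using dec[OF ij(1)] dec[OF ij(2)] X(1) by auto
      have "E (X k) \<le> l + 1 / real (Suc N)" if "k \<ge> N" for k
      proof -
        have "1 / real (Suc k) \<le> 1 / real (Suc N)" using that by (simp add: frac_le)
        with X(2)[of k] l(2)[of k] show ?thesis by linarith
      qed
      then have "E (X i) \<le> l + 1 / real (Suc N)" "E (X j) \<le> l + 1 / real (Suc N)" using ij by auto
      with D[OF K0 K0, OF in_N] m_le[OF mid[OF in_N]] N show ?thesis by argo
    qed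
    then show ?thesis by blast
  qed
  with X(1) that show ?thesis by blast
qed

text \<open>Adding the tangent inequalities at the midpoint cancels the linear terms. It keeps the
  sublevel sets in \<open>approximating_sequence\<close> stable under midpoints.\<close>

lemma powr_midpoint_le:
  fixes a b :: real assumes "q > 1"
  shows "\<bar>(a + b) / 2\<bar> powr q \<le> (\<bar>a\<bar> powr q + \<bar>b\<bar> powr q) / 2"
proof -
  let ?s = "signed_powr ((a + b) / 2) (q - 1)"
  have "?s * (a - (a + b) / 2) + ?s * (b - (a + b) / 2) = 0" by (simp add: field_simps)
  then have "q * (?s * (a - (a + b) / 2)) + q * (?s * (b - (a + b) / 2)) = 0"
    by (metis distrib_left mult_zero_right)
  then show ?thesis
    using powr_tangent[OF assms, of "(a + b) / 2" a] powr_tangent[OF assms, of "(a + b) / 2" b] by argo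
qed

lemma approximating_sequence:
  fixes B :: "'n::finite coeffs"
  assumes pq: "p > 1" "q > 1" "1 / p + 1 / q = 1" and g: "Lq Q_measure q g"
    and sep: "\<And>w. Lq Q_measure p w \<Longrightarrow> ereal (\<integral>x. w x * g x \<partial>Q_measure) \<le> PV d B w"
  obtains \<phi> where "\<And>n. \<phi> n \<in> admissible d"
    "(\<lambda>n. \<integral>x. \<bar>g x - test_adjoint d B (\<phi> n) x\<bar> powr q \<partial>Q_measure) \<longlonglongrightarrow> 0"
    "\<And>e. e > 0 \<Longrightarrow> \<exists>N. \<forall>i\<ge>N. \<forall>j\<ge>N. (\<integral>x. (K_norm d (\<lambda>\<alpha>. \<phi> i x \<alpha> - \<phi> j x \<alpha>))\<^sup>2 \<partial>Q_measure) < e"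
proof -
  interpret finite_measure "Q_measure :: (real^'n) measure" by (rule finite_measure_Q)
  have adj: "Lq Q_measure q (test_adjoint d B \<phi>)" if "\<phi> \<in> admissible d" for \<phi>
    using that pq by (intro test_function_Lq test_function_test_adjoint) (auto simp: admissible_def)
  have comb: "test_adjoint d B (\<lambda>x \<alpha>. a * \<phi> x \<alpha> + b * \<psi> x \<alpha>) = (\<lambda>x. a * test_adjoint d B \<phi> x + b * test_adjoint d B \<psi> x)"
    if "\<phi> \<in> admissible d" "\<psi> \<in> admissible d" for a b \<phi> \<psi>
    by (rule ext) (use that in \<open>simp add: admissible_def test_adjoint_linear\<close>)
  have dense: "\<exists>c\<in>test_adjoint d B ` admissible d. (\<integral>x. \<bar>g x - c x\<bar> powr q \<partial>Q_measure) < e" if "e > 0" for e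
  proof (rule Lq_closure_of_convex[OF pq g _ _ _ _ that])
    show "test_adjoint d B ` admissible d \<noteq> {}" using admissible_zero by blast
    show "Lq Q_measure q c" if "c \<in> test_adjoint d B ` admissible d" for c using that adj by auto
    show "(\<lambda>x. (1 - s) * c x + s * c' x) \<in> test_adjoint d B ` admissible d"
      if c: "c \<in> test_adjoint d B ` admissible d" "c' \<in> test_adjoint d B ` admissible d" and s: "0 \<le> s" "s \<le> 1" for c c' s
    proof -
      obtain \<phi> \<psi> where \<phi>: "\<phi> \<in> admissible d" "\<psi> \<in> admissible d" "c = test_adjoint d B \<phi>" "c' = test_adjoint d B \<psi>"
        using c by auto
      have "(\<lambda>x. (1 - s) * c x + s * c' x) = test_adjoint d B (\<lambda>x \<alpha>. (1 - s) * \<phi> x \<alpha> + s * \<psi> x \<alpha>)"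
        unfolding \<phi>(3,4) comb[OF \<phi>(1,2)] ..
      then show ?thesis using admissible_convex[OF \<phi>(1,2) s] by (rule image_eqI)
    qed
    show "(\<integral>x. w x * g x \<partial>Q_measure) \<le> K"
      if w: "Lq Q_measure p w" and K: "\<And>c. c \<in> test_adjoint d B ` admissible d \<Longrightarrow> (\<integral>x. w x * c x \<partial>Q_measure) \<le> K" for w K
    proof -
      \<comment> \<open>A common bound for all elements of the convex set is a bound for their
        supremum, which is how \<open>sep\<close> supplies the separation hypothesis.\<close>
      have "PV d B w \<le> ereal K"
        unfolding PV_eq_SUP[OF Lq_measurable[OF w]] by (rule SUP_least) (use K in simp)
      with sep[OF w] have "ereal (\<integral>x. w x * g x \<partial>Q_measure) \<le> ereal K" by (rule order_trans)
      then show ?thesis by simp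
    qed
  qed
  \<comment> \<open>Density makes these sublevel sets nonempty, and they are nested. The bound 1 on
    the fields bounds their energies by the measure of the cube.\<close>
  define K where "K n = {\<phi> \<in> admissible d. (\<integral>x. \<bar>g x - test_adjoint d B \<phi> x\<bar> powr q \<partial>Q_measure) \<le> 1 / real (Suc n)}" for n
  define E :: "'n field \<Rightarrow> real" where "E \<phi> = (\<integral>x. (K_norm d (\<phi> x))\<^sup>2 \<partial>(Q_measure :: (real^'n) measure))" for \<phi>
  define D where "D \<phi> \<psi> = E (\<lambda>x \<alpha>. \<phi> x \<alpha> - \<psi> x \<alpha>)" for \<phi> \<psi>
  \<comment> \<open>Written with 1 - 1/2 so that it is literally the case s = 1/2 of
    \<open>admissible_convex\<close>.\<close>
  define mid :: "'n field \<Rightarrow> 'n field \<Rightarrow> 'n field" where "mid \<phi> \<psi> = (\<lambda>x \<alpha>. (1 - 1/2) * \<phi> x \<alpha> + (1/2) * \<psi> x \<alpha>)" for \<phi> \<psi>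
  have KA: "\<phi> \<in> admissible d" if "\<phi> \<in> K n" for \<phi> n using that by (simp add: K_def)
  have iE: "integrable Q_measure (\<lambda>x. (K_norm d (\<phi> x))\<^sup>2)" if "test_field d \<phi>" for \<phi>
    using Lq_integrable[OF Lq_K_norm[OF test_field_in_L[OF that, of 2]]] by simp
  obtain X where X: "\<And>n. X n \<in> K n" "\<And>e. e > 0 \<Longrightarrow> \<exists>N. \<forall>i\<ge>N. \<forall>j\<ge>N. D (X i) (X j) < e"
  proof (rule minimizing_sequence_Cauchy[of K E "measure Q_measure (space (Q_measure :: (real^'n) measure))" mid D])
    show "K n \<noteq> {}" for n
    proof -
      obtain \<phi> where "\<phi> \<in> admissible d" "(\<integral>x. \<bar>g x - test_adjoint d B \<phi> x\<bar> powr q \<partial>Q_measure) < 1 / real (Suc n)"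
        using dense[of "1 / real (Suc n)"] by auto
      then have "\<phi> \<in> K n" by (simp add: K_def)
      then show ?thesis by blast
    qed
    show "K n \<subseteq> K m" if "m \<le> n" for m n
    proof -
      have "1 / real (Suc n) \<le> 1 / real (Suc m)" using that by (simp add: frac_le)
      then show ?thesis by (auto simp: K_def)
    qed
    show "0 \<le> E \<phi>" for \<phi> by (simp add: E_def)
    show "E \<phi> \<le> measure Q_measure (space (Q_measure :: (real^'n) measure))" if "\<phi> \<in> K 0" for \<phi>
    proof -
      have "test_field d \<phi>" and le: "(K_norm d (\<phi> x))\<^sup>2 \<le> 1" for x
        using KA[OF that] by (auto simp: admissible_def power_le_one)
      then have "E \<phi> \<le> (\<integral>x. 1 \<partial>(Q_measure :: (real^'n) measure))"
        unfolding E_def by (intro integral_mono iE le) auto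
      then show ?thesis by simp
    qed
    show "mid \<phi> \<psi> \<in> K n" if "\<phi> \<in> K n" "\<psi> \<in> K n" for n \<phi> \<psi>
    proof -
      let ?f = "\<lambda>\<phi> x. g x - test_adjoint d B \<phi> x"
      have A: "mid \<phi> \<psi> \<in> admissible d" unfolding mid_def by (intro admissible_convex KA[OF that(1)] KA[OF that(2)]) auto
      have i: "integrable Q_measure (\<lambda>x. \<bar>?f \<xi> x\<bar> powr q)" if "\<xi> \<in> admissible d" for \<xi>
        using Lq_integrable[OF Lq_diff[OF g adj[OF that]]] pq by simp
      have eq: "?f (mid \<phi> \<psi>) x = (?f \<phi> x + ?f \<psi> x) / 2" for x
        unfolding mid_def comb[OF KA[OF that(1)] KA[OF that(2)]] by (simp add: field_simps)
      have "(\<integral>x. \<bar>?f (mid \<phi> \<psi>) x\<bar> powr q \<partial>Q_measure) \<le> (\<integral>x. (\<bar>?f \<phi> x\<bar> powr q + \<bar>?f \<psi> x\<bar> powr q) / 2 \<partial>Q_measure)"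
      proof (rule integral_mono)
        show "\<bar>?f (mid \<phi> \<psi>) x\<bar> powr q \<le> (\<bar>?f \<phi> x\<bar> powr q + \<bar>?f \<psi> x\<bar> powr q) / 2" for x
          unfolding eq by (rule powr_midpoint_le[OF pq(2)])
        show "integrable Q_measure (\<lambda>x. \<bar>?f (mid \<phi> \<psi>) x\<bar> powr q)" by (rule i[OF A])
        show "integrable Q_measure (\<lambda>x. (\<bar>?f \<phi> x\<bar> powr q + \<bar>?f \<psi> x\<bar> powr q) / 2)"
          using i[OF KA[OF that(1)]] i[OF KA[OF that(2)]] by simp
      qed
      also have "\<dots> = ((\<integral>x. \<bar>?f \<phi> x\<bar> powr q \<partial>Q_measure) + (\<integral>x. \<bar>?f \<psi> x\<bar> powr q \<partial>Q_measure)) / 2"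
        using i KA[OF that(1)] KA[OF that(2)] by simp
      also have "\<dots> \<le> (1 / real (Suc n) + 1 / real (Suc n)) / 2"
        using that by (intro divide_right_mono add_mono) (auto simp: K_def)
      also have "\<dots> = 1 / real (Suc n)" by (simp only: field_sum_of_halves add_divide_distrib)
      finally show ?thesis using A by (simp add: K_def)
    qed
    show "D \<phi> \<psi> \<le> 2 * E \<phi> + 2 * E \<psi> - 4 * E (mid \<phi> \<psi>)" if "\<phi> \<in> K 0" "\<psi> \<in> K 0" for \<phi> \<psi>
    proof -
      have t: "test_field d \<phi>" "test_field d \<psi>" using KA that by (auto simp: admissible_def)
      have tm: "test_field d (mid \<phi> \<psi>)" unfolding mid_def by (intro test_field_combination t)
      have "(K_norm d (\<lambda>\<alpha>. a \<alpha> - b \<alpha>))\<^sup>2 = 2 * (K_norm d a)\<^sup>2 + 2 * (K_norm d b)\<^sup>2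
          - 4 * (K_norm d (\<lambda>\<alpha>. (1 - 1/2) * a \<alpha> + (1/2) * b \<alpha>))\<^sup>2" for a b :: "'n list \<Rightarrow> real"
      proof -
        have *: "(a - b)\<^sup>2 = 2 * a\<^sup>2 + 2 * b\<^sup>2 - 4 * ((1 - 1/2) * a + (1/2) * b)\<^sup>2" for a b :: real
          by (simp add: power2_eq_square field_simps)
        show ?thesis unfolding K_norm_power2 * by (simp add: sum.distrib sum_subtractf sum_distrib_left)
      qed
      then have "D \<phi> \<psi> = (\<integral>x. 2 * (K_norm d (\<phi> x))\<^sup>2 + 2 * (K_norm d (\<psi> x))\<^sup>2 - 4 * (K_norm d (mid \<phi> \<psi> x))\<^sup>2 \<partial>Q_measure)"
        unfolding D_def E_def mid_def by simp
      also have "\<dots> = 2 * E \<phi> + 2 * E \<psi> - 4 * E (mid \<phi> \<psi>)"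
        using iE[OF t(1)] iE[OF t(2)] iE[OF tm] by (simp add: E_def)
      finally show ?thesis by simp
    qed
  next
    fix X assume "\<And>n. X n \<in> K n" "\<And>e. e > 0 \<Longrightarrow> \<exists>N. \<forall>i\<ge>N. \<forall>j\<ge>N. D (X i) (X j) < e"
    then show thesis by (rule that)
  qed
  show ?thesis
  proof (rule that[of X])
    show "X n \<in> admissible d" for n using KA X(1) by blast
    show "(\<lambda>n. \<integral>x. \<bar>g x - test_adjoint d B (X n) x\<bar> powr q \<partial>Q_measure) \<longlonglongrightarrow> 0"
    proof (rule tendsto_sandwich[where f = "\<lambda>_. 0" and h = "\<lambda>n. 1 / real (Suc n)"])
      show "\<forall>\<^sub>F n in sequentially. (\<integral>x. \<bar>g x - test_adjoint d B (X n) x\<bar> powr q \<partial>Q_measure) \<le> 1 / real (Suc n)"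
        using X(1) by (simp add: K_def)
      show "(\<lambda>n. 1 / real (Suc n)) \<longlonglongrightarrow> 0" by real_asymp
    qed auto
    show "\<exists>N. \<forall>i\<ge>N. \<forall>j\<ge>N. (\<integral>x. (K_norm d (\<lambda>\<alpha>. X i x \<alpha> - X j x \<alpha>))\<^sup>2 \<partial>Q_measure) < e" if "e > 0" for e
      using X(2)[OF that] by (simp add: D_def E_def)
  qed
qed

text \<open>The energy is quadratic, but W0 is normed by L^q. A subsequence converges almost
  everywhere, its limit inherits the bound 1, and dominated convergence with the constant 2^q
  upgrades the convergence to L^q.\<close>

lemma bounded_L2_limit:
  fixes \<phi> :: "nat \<Rightarrow> 'n::finite field"
  assumes q: "q > 1" and adm: "\<And>n. \<phi> n \<in> admissible d"
    and C: "\<And>e. e > 0 \<Longrightarrow> \<exists>N. \<forall>i\<ge>N. \<forall>j\<ge>N. (\<integral>x. (K_norm d (\<lambda>\<alpha>. \<phi> i x \<alpha> - \<phi> j x \<alpha>))\<^sup>2 \<partial>Q_measure) < e"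
  obtains v r where "strict_mono r" "in_L_field d q v" "AE x in Q_measure. K_norm d (v x) \<le> 1"
    "(\<lambda>n. \<integral>x. K_norm d (\<lambda>\<alpha>. v x \<alpha> - \<phi> (r n) x \<alpha>) powr q \<partial>Q_measure) \<longlonglongrightarrow> 0"
proof -
  interpret finite_measure "Q_measure :: (real^'n) measure" by (rule finite_measure_Q)
  have t: "test_field d (\<phi> n)" for n using adm by (simp add: admissible_def)
  have \<phi>1: "K_norm d (\<phi> n x) \<le> 1" for n x using adm by (simp add: admissible_def)
  have L2: "Lq Q_measure 2 (\<lambda>x. \<phi> n x \<alpha>)" if "\<alpha> \<in> K_index d" for n \<alpha>
    using t that by (intro test_function_Lq) (auto simp: test_field_def)
  have "\<forall>\<alpha>\<in>K_index d. \<exists>g. Lq Q_measure 2 g \<and> (\<lambda>n. \<integral>x. \<bar>\<phi> n x \<alpha> - g x\<bar> powr 2 \<partial>Q_measure) \<longlonglongrightarrow> 0"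
  proof
    fix \<alpha> :: "'n list" assume \<alpha>: "\<alpha> \<in> K_index d"
    have "\<exists>N. \<forall>i\<ge>N. \<forall>j\<ge>N. (\<integral>x. \<bar>\<phi> i x \<alpha> - \<phi> j x \<alpha>\<bar> powr 2 \<partial>Q_measure) < e" if e: "e > 0" for e
    proof -
      have "(\<integral>x. \<bar>\<phi> i x \<alpha> - \<phi> j x \<alpha>\<bar> powr 2 \<partial>Q_measure) \<le> (\<integral>x. (K_norm d (\<lambda>\<alpha>. \<phi> i x \<alpha> - \<phi> j x \<alpha>))\<^sup>2 \<partial>Q_measure)" for i j
      proof (rule integral_mono)
        show "integrable Q_measure (\<lambda>x. \<bar>\<phi> i x \<alpha> - \<phi> j x \<alpha>\<bar> powr 2)"
          using Lq_integrable[OF Lq_diff[OF L2[OF \<alpha>] L2[OF \<alpha>]]] by simp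
        have "test_field d (\<lambda>x \<alpha>. \<phi> i x \<alpha> - \<phi> j x \<alpha>)"
          using test_field_combination[OF t[of i] t[of j], of 1 "-1"] by simp
        from Lq_integrable[OF Lq_K_norm[OF test_field_in_L[OF this, of 2]]]
        show "integrable Q_measure (\<lambda>x. (K_norm d (\<lambda>\<alpha>. \<phi> i x \<alpha> - \<phi> j x \<alpha>))\<^sup>2)" by simp
        show "\<bar>\<phi> i x \<alpha> - \<phi> j x \<alpha>\<bar> powr 2 \<le> (K_norm d (\<lambda>\<alpha>. \<phi> i x \<alpha> - \<phi> j x \<alpha>))\<^sup>2" for x
          using component_le_K_norm[OF \<alpha>, of "\<lambda>\<alpha>. \<phi> i x \<alpha> - \<phi> j x \<alpha>"] power_mono[of "\<bar>\<phi> i x \<alpha> - \<phi> j x \<alpha>\<bar>" _ 2] by simp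
      qed
      with C[OF e] show ?thesis by (meson le_less_trans)
    qed
    from Lq_complete[OF L2[OF \<alpha>] _ this] show "\<exists>g. Lq Q_measure 2 g \<and> (\<lambda>n. \<integral>x. \<bar>\<phi> n x \<alpha> - g x\<bar> powr 2 \<partial>Q_measure) \<longlonglongrightarrow> 0"
      by auto
  qed
  from bchoice[OF this] obtain G where G: "\<And>\<alpha>. \<alpha> \<in> K_index d \<Longrightarrow> Lq Q_measure 2 (G \<alpha>)"
    "\<And>\<alpha>. \<alpha> \<in> K_index d \<Longrightarrow> (\<lambda>n. \<integral>x. \<bar>\<phi> n x \<alpha> - G \<alpha> x\<bar> powr 2 \<partial>Q_measure) \<longlonglongrightarrow> 0" by blast
  define v where "v x \<alpha> = G \<alpha> x" for x \<alpha>
  have vm: "(\<lambda>x. v x \<alpha>) \<in> borel_measurable Q_measure" if "\<alpha> \<in> K_index d" for \<alpha>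
    using G(1)[OF that] by (simp add: v_def Lq_def)
  have \<phi>m: "(\<lambda>x. \<phi> n x \<alpha>) \<in> borel_measurable Q_measure" if "\<alpha> \<in> K_index d" for \<alpha> n
    using L2[OF that] by (simp add: Lq_def)
  define S where "S n x = (K_norm d (\<lambda>\<alpha>. \<phi> n x \<alpha> - v x \<alpha>))\<^sup>2" for n x
  have S_eq: "S n x = (\<Sum>\<alpha>\<in>K_index d. \<bar>\<phi> n x \<alpha> - G \<alpha> x\<bar> powr 2)" for n x
    by (simp add: S_def K_norm_power2 v_def)
  have iS: "integrable Q_measure (\<lambda>x. \<bar>\<phi> n x \<alpha> - G \<alpha> x\<bar> powr 2)" if "\<alpha> \<in> K_index d" for n \<alpha>
    using Lq_integrable[OF Lq_diff[OF L2[OF that] G(1)[OF that]]] by simp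
  have "(\<lambda>n. \<Sum>\<alpha>\<in>K_index d. \<integral>x. \<bar>\<phi> n x \<alpha> - G \<alpha> x\<bar> powr 2 \<partial>Q_measure) \<longlonglongrightarrow> (\<Sum>\<alpha>\<in>(K_index d :: 'n list set). 0)"
    by (intro tendsto_sum G(2))
  then have "(\<lambda>n. \<integral>x. norm (S n x) \<partial>Q_measure) \<longlonglongrightarrow> 0"
    using iS by (simp add: S_eq sum_nonneg Bochner_Integration.integral_sum)
  moreover have "integrable Q_measure (S n)" for n
    unfolding S_eq[abs_def] using iS by (intro Bochner_Integration.integrable_sum) auto
  ultimately obtain r where r: "strict_mono r" "AE x in Q_measure. (\<lambda>n. S (r n) x) \<longlonglongrightarrow> 0"
    using tendsto_L1_AE_subseq[of Q_measure S] by blast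
  have lim: "AE x in Q_measure. (\<lambda>n. K_norm d (\<lambda>\<alpha>. v x \<alpha> - \<phi> (r n) x \<alpha>)) \<longlonglongrightarrow> 0"
    using r(2)
  proof eventually_elim
    case (elim x)
    from tendsto_real_sqrt[OF elim] show ?case
      by (simp add: S_def real_sqrt_abs K_norm_minus_commute[of d "v x"])
  qed
  have v1: "AE x in Q_measure. K_norm d (v x) \<le> 1"
    using lim
  proof eventually_elim
    case (elim x)
    have "K_norm d (v x) \<le> 1 + K_norm d (\<lambda>\<alpha>. v x \<alpha> - \<phi> (r n) x \<alpha>)" for n
      using K_norm_triangle[of d "\<phi> (r n) x" "\<lambda>\<alpha>. v x \<alpha> - \<phi> (r n) x \<alpha>"] \<phi>1[of "r n" x] by simp
    moreover have "(\<lambda>n. 1 + K_norm d (\<lambda>\<alpha>. v x \<alpha> - \<phi> (r n) x \<alpha>)) \<longlonglongrightarrow> 1 + 0"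
      by (intro tendsto_add tendsto_const elim)
    ultimately show ?case using LIMSEQ_le_const by fastforce
  qed
  have vL: "in_L_field d q v"
  proof -
    have "Lq Q_measure q (\<lambda>x. v x \<alpha>)" if "\<alpha> \<in> K_index d" for \<alpha>
    proof (rule Lq_bounded[OF vm[OF that]])
      show "AE x in Q_measure. \<bar>v x \<alpha>\<bar> \<le> 1"
        using v1 by eventually_elim (use component_le_K_norm[OF that] order_trans in blast)
    qed (use q in simp)
    with q show ?thesis by (simp add: in_L_field_iff)
  qed
  have "(\<lambda>n. \<integral>x. K_norm d (\<lambda>\<alpha>. v x \<alpha> - \<phi> (r n) x \<alpha>) powr q \<partial>Q_measure) \<longlonglongrightarrow> (\<integral>x. 0 \<partial>(Q_measure :: (real^'n) measure))"
  proof (rule integral_dominated_convergence[where w = "\<lambda>x. 2 powr q"])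
    show "(\<lambda>x. K_norm d (\<lambda>\<alpha>. v x \<alpha> - \<phi> (r n) x \<alpha>) powr q) \<in> borel_measurable Q_measure" for n
    proof -
      have [measurable]: "(\<lambda>x. K_norm d (\<lambda>\<alpha>. v x \<alpha> - \<phi> (r n) x \<alpha>)) \<in> borel_measurable Q_measure"
        by (intro K_norm_measurable borel_measurable_diff vm \<phi>m)
      show ?thesis by measurable
    qed
    show "AE x in Q_measure. (\<lambda>n. K_norm d (\<lambda>\<alpha>. v x \<alpha> - \<phi> (r n) x \<alpha>) powr q) \<longlonglongrightarrow> 0"
      using lim
    proof eventually_elim
      case (elim x)
      have "(\<lambda>n. K_norm d (\<lambda>\<alpha>. v x \<alpha> - \<phi> (r n) x \<alpha>) powr q) \<longlonglongrightarrow> 0 powr q"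
        using elim q by (intro tendsto_powr2 tendsto_const) auto
      then show ?case by simp
    qed
    show "AE x in Q_measure. norm (K_norm d (\<lambda>\<alpha>. v x \<alpha> - \<phi> (r n) x \<alpha>) powr q) \<le> 2 powr q" for n
      using v1
    proof eventually_elim
      case (elim x)
      have "K_norm d (\<lambda>\<alpha>. v x \<alpha> - \<phi> (r n) x \<alpha>) \<le> K_norm d (v x) + K_norm d (\<phi> (r n) x)"
        using K_norm_triangle[of d "v x" "\<lambda>\<alpha>. - 1 * \<phi> (r n) x \<alpha>"] unfolding K_norm_cmult by simp
      then have "K_norm d (\<lambda>\<alpha>. v x \<alpha> - \<phi> (r n) x \<alpha>) \<le> 2" using elim \<phi>1[of "r n" x] by linarith
      then show ?case using q by (simp add: powr_mono2)
    qed
  qed auto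
  then show ?thesis using that[OF r(1) vL v1] by simp
qed

text \<open>One sequence serves three purposes: its limit is v, the limit of its adjoints identifies
  g as the adjoint of v, and both convergences together place v in W0.\<close>

lemma subdifferential_representation:
  fixes B :: "'n::finite coeffs"
  assumes pq: "p > 1" "q > 1" "1 / p + 1 / q = 1" and g: "Lq Q_measure q g"
    and sep: "\<And>w. Lq Q_measure p w \<Longrightarrow> ereal (\<integral>x. w x * g x \<partial>Q_measure) \<le> PV d B w"
  obtains v where "v \<in> W0_space d q B" "Linf_norm d v \<le> 1" "AE x in Q_measure. g x = adjoint_B d B v x"
proof -
  obtain \<phi> where \<phi>: "\<And>n. \<phi> n \<in> admissible d"
    "(\<lambda>n. \<integral>x. \<bar>g x - test_adjoint d B (\<phi> n) x\<bar> powr q \<partial>Q_measure) \<longlonglongrightarrow> 0"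
    "\<And>e. e > 0 \<Longrightarrow> \<exists>N. \<forall>i\<ge>N. \<forall>j\<ge>N. (\<integral>x. (K_norm d (\<lambda>\<alpha>. \<phi> i x \<alpha> - \<phi> j x \<alpha>))\<^sup>2 \<partial>Q_measure) < e"
    using approximating_sequence[OF pq g sep] by blast
  obtain v r where v: "strict_mono r" "in_L_field d q v" "AE x in Q_measure. K_norm d (v x) \<le> 1"
    "(\<lambda>n. \<integral>x. K_norm d (\<lambda>\<alpha>. v x \<alpha> - \<phi> (r n) x \<alpha>) powr q \<partial>Q_measure) \<longlonglongrightarrow> 0"
    using bounded_L2_limit[OF pq(2) \<phi>(1,3)] by blast
  have t: "test_field d (\<phi> n)" for n using \<phi>(1) by (simp add: admissible_def)
  have lim: "(\<lambda>n. \<integral>x. \<bar>g x - test_adjoint d B (\<phi> (r n)) x\<bar> powr q \<partial>Q_measure) \<longlonglongrightarrow> 0"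
    using LIMSEQ_subseq_LIMSEQ[OF \<phi>(2) v(1)] by (simp add: o_def)
  have adj: "is_adjoint d B v g"
    unfolding is_adjoint_def
    using integral_op_B_limit[OF pq(2) v(2) g t v(4) lim] test_function_smooth by blast
  have gi: "integrable Q_measure g"
    using finite_measure.Lq_imp_integrable[OF finite_measure_Q g pq(2)] .
  have W: "v \<in> W_space d q B" using v(2) g adj by (auto simp: W_space_def in_L_eq_Lq)
  have "\<exists>\<phi>. test_field d \<phi> \<and> W_norm d q B (\<lambda>x \<alpha>. v x \<alpha> - \<phi> x \<alpha>) < e" if e: "e > 0" for e
  proof -
    have "(\<lambda>n. W_norm d q B (\<lambda>x \<alpha>. v x \<alpha> - \<phi> (r n) x \<alpha>) powr q) \<longlonglongrightarrow> 0 + 0"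
      unfolding W_norm_diff_test_field[OF pq(2) v(2) g adj t] by (intro tendsto_add v(4) lim)
    then have "(\<lambda>n. W_norm d q B (\<lambda>x \<alpha>. v x \<alpha> - \<phi> (r n) x \<alpha>) powr q) \<longlonglongrightarrow> 0" by simp
    from order_tendstoD(2)[OF this, of "e powr q"] e
    obtain n where n: "W_norm d q B (\<lambda>x \<alpha>. v x \<alpha> - \<phi> (r n) x \<alpha>) powr q < e powr q"
      by (auto simp: eventually_sequentially)
    have "W_norm d q B (\<lambda>x \<alpha>. v x \<alpha> - \<phi> (r n) x \<alpha>) < e"
    proof (rule ccontr)
      assume "\<not> ?thesis"
      then have "e powr q \<le> W_norm d q B (\<lambda>x \<alpha>. v x \<alpha> - \<phi> (r n) x \<alpha>) powr q"
        using e pq by (intro powr_mono2) auto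
      with n show False by simp
    qed
    with t show ?thesis by blast
  qed
  with W have W0: "v \<in> W0_space d q B" by (simp add: W0_space_def)
  have "(\<lambda>x. K_norm d (v x)) \<in> borel_measurable Q_measure" using Lq_K_norm[OF v(2)] by (simp add: Lq_def)
  then have "Linf_norm d v \<le> 1"
    unfolding Linf_norm_def by (intro esssup_I) (use v(3) in \<open>auto simp: one_ereal_def\<close>)
  moreover have "AE x in Q_measure. g x = adjoint_B d B v x"
    using adjoint_B_eq(1)[OF gi adj] by eventually_elim simp
  ultimately show ?thesis using that W0 by blast
qed

section \<open>Dilation and mollification\<close>

lemma lborel_integral_scale:
  fixes f :: "real^'n::finite \<Rightarrow> real"
  assumes [measurable]: "f \<in> borel_measurable borel" and "t \<noteq> 0"
  shows "(\<integral>x. f x \<partial>lborel) = \<bar>t\<bar> ^ CARD('n) * (\<integral>z. f (a + t *\<^sub>R z) \<partial>lborel)"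
    and "integrable lborel f \<Longrightarrow> integrable lborel (\<lambda>z. f (a + t *\<^sub>R z))"
proof -
  have L: "lborel = density (distr lborel borel (\<lambda>x::real^'n. a + t *\<^sub>R x)) (\<lambda>_. ennreal (\<bar>t\<bar> ^ CARD('n)))"
    using lborel_affine[OF assms(2), of a] by simp
  have "(\<integral>x. f x \<partial>lborel) = (\<integral>x. \<bar>t\<bar> ^ CARD('n) *\<^sub>R f x \<partial>distr lborel borel (\<lambda>x::real^'n. a + t *\<^sub>R x))"
    by (subst L, subst integral_density) auto
  also have "\<dots> = (\<integral>z. \<bar>t\<bar> ^ CARD('n) * f (a + t *\<^sub>R z) \<partial>lborel)"
    by (subst integral_distr) auto
  finally show "(\<integral>x. f x \<partial>lborel) = \<bar>t\<bar> ^ CARD('n) * (\<integral>z. f (a + t *\<^sub>R z) \<partial>lborel)" by simp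
  assume "integrable lborel f"
  then have "integrable (distr lborel borel (\<lambda>x::real^'n. a + t *\<^sub>R x)) (\<lambda>x. \<bar>t\<bar> ^ CARD('n) *\<^sub>R f x)"
    by (subst (asm) L, subst (asm) integrable_density) auto
  then have "integrable lborel (\<lambda>z. \<bar>t\<bar> ^ CARD('n) * f (a + t *\<^sub>R z))"
    by (subst (asm) integrable_distr_eq) auto
  then show "integrable lborel (\<lambda>z. f (a + t *\<^sub>R z))" using assms(2) by simp
qed

text \<open>A small \<eta> makes the a-term negligible; b can afterwards be taken small enough to
  beat the large factor in front of it.\<close>

lemma Youngs_inequality_scaled:
  fixes a b :: real
  assumes pq: "p > 1" "q > 1" "1 / p + 1 / q = 1" and \<eta>: "\<eta> > 0"
  shows "\<bar>a\<bar> * \<bar>b\<bar> \<le> \<eta> powr p * \<bar>a\<bar> powr p + \<eta> powr - q * \<bar>b\<bar> powr q"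
proof -
  have "(\<eta> * \<bar>a\<bar>) * (\<bar>b\<bar> / \<eta>) \<le> (\<eta> * \<bar>a\<bar>) powr p / p + (\<bar>b\<bar> / \<eta>) powr q / q"
    using pq \<eta> by (intro Youngs_inequality) auto
  also have "\<dots> \<le> (\<eta> * \<bar>a\<bar>) powr p / 1 + (\<bar>b\<bar> / \<eta>) powr q / 1"
    using pq by (intro add_mono divide_left_mono) auto
  also have "\<dots> = \<eta> powr p * \<bar>a\<bar> powr p + \<eta> powr - q * \<bar>b\<bar> powr q"
    using \<eta> by (simp add: powr_mult powr_divide powr_minus_divide)
  finally show ?thesis using \<eta> by simp
qed

lemma integral_mult_le_Young:
  assumes pq: "p > 1" "q > 1" "1 / p + 1 / q = 1" and w: "Lq M p w" and h: "Lq M q h" and \<eta>: "\<eta> > 0"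
  shows "\<bar>\<integral>x. w x * h x \<partial>M\<bar> \<le> \<eta> powr p * (\<integral>x. \<bar>w x\<bar> powr p \<partial>M) + \<eta> powr - q * (\<integral>x. \<bar>h x\<bar> powr q \<partial>M)"
proof -
  have "\<bar>\<integral>x. w x * h x \<partial>M\<bar> \<le> (\<integral>x. \<bar>w x * h x\<bar> \<partial>M)" by (rule integral_abs_bound)
  also have "\<dots> \<le> (\<integral>x. \<eta> powr p * \<bar>w x\<bar> powr p + \<eta> powr - q * \<bar>h x\<bar> powr q \<partial>M)"
  proof (rule integral_mono)
    show "integrable M (\<lambda>x. \<bar>w x * h x\<bar>)" by (rule integrable_abs[OF integrable_mult_Lq[OF w h pq]])
    show "\<bar>w x * h x\<bar> \<le> \<eta> powr p * \<bar>w x\<bar> powr p + \<eta> powr - q * \<bar>h x\<bar> powr q" for x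
      unfolding abs_mult by (rule Youngs_inequality_scaled[OF pq \<eta>])
  qed (use Lq_integrable[OF w] Lq_integrable[OF h] in simp)
  finally show ?thesis using Lq_integrable[OF w] Lq_integrable[OF h] by simp
qed

text \<open>The kernel \<open>\<kappa>\<close> is concentrated near the centre \<open>c\<close> of the cube, so that
  \<open>\<kappa> (x - t (z - c))\<close> contracts the cube by the factor \<open>t\<close> towards \<open>c\<close> and then mollifies. The
  margin \<open>1 - t = 4 \<epsilon>\<close> exceeds the radius \<open>\<epsilon>\<close> of the mollifier.\<close>

locale mollifier =
  fixes \<kappa> :: "real^'n::finite \<Rightarrow> real" and \<epsilon> t :: real and c :: "real^'n"
  assumes \<epsilon>: "0 < \<epsilon>" "\<epsilon> \<le> 1 / 8"
    and t_eq: "t = 1 - 4 * \<epsilon>" and c_eq: "c = (\<chi> i. 1 / 2)"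
    and smooth_\<kappa>: "smooth \<kappa>" and \<kappa>_nonneg: "\<And>x. \<kappa> x \<ge> 0"
    and \<kappa>_support: "\<And>x i. \<kappa> x \<noteq> 0 \<Longrightarrow> \<bar>x $ i - c $ i\<bar> \<le> \<epsilon>"
    and \<kappa>_integrable: "integrable lborel \<kappa>" and \<kappa>_integral: "(\<integral>x. \<kappa> x \<partial>lborel) = 1"
begin

section \<open>The kernel, the smoothing operator and its transpose\<close>

sublocale finite_measure "Q_measure :: (real^'n) measure" by (rule finite_measure_Q)

lemma t_bounds: "1 / 2 \<le> t" "t < 1" "0 < t" "t \<noteq> 0"
  using \<epsilon> by (auto simp: t_eq)

lemma c_nth [simp]: "c $ i = 1 / 2"
  by (simp add: c_eq)

text \<open>The factor is the Jacobian of the contraction. The kernel has mass 1 in z over the whole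
  space and mass t^N \<le> 1 in x.\<close>

definition k :: "real^'n \<Rightarrow> real^'n \<Rightarrow> real" where
  "k x z = t ^ CARD('n) * \<kappa> (x - t *\<^sub>R (z - c))"

text \<open>The argument is spelled \<open>1 *\<^sub>R x + b z\<close> so that the parameter
  integral lemmas apply with s = 1.\<close>

definition T :: "(real^'n \<Rightarrow> real) \<Rightarrow> real^'n \<Rightarrow> real" where
  "T m x = t ^ CARD('n) * (\<integral>z. \<kappa> (1 *\<^sub>R x + (- t *\<^sub>R (z - c))) * m z \<partial>Q_measure)"

text \<open>The transpose of \<open>T\<close> under the integral pairing: an average of f over
  points near the contracted point. For z at the boundary these points lie inside the cube, so
  \<open>P f\<close> is smooth but need not vanish there.\<close>

definition P :: "(real^'n \<Rightarrow> real) \<Rightarrow> real^'n \<Rightarrow> real" where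
  "P f z = t ^ CARD('n) * (\<integral>y. f (t *\<^sub>R z + (y - t *\<^sub>R c)) * \<kappa> y \<partial>lborel)"

lemma T_eq: "T m x = (\<integral>z. k x z * m z \<partial>Q_measure)"
  by (simp add: T_def k_def mult.assoc)

lemma k_nonneg: "k x z \<ge> 0"
  using t_bounds \<kappa>_nonneg by (simp add: k_def)

lemma test_function_\<kappa>: "test_function \<kappa>"
proof (rule test_function_of_compact_support[OF smooth_\<kappa>])
  show "compact (cbox (c - (\<chi> i. \<epsilon>)) (c + (\<chi> i. \<epsilon>)))" by simp
  show "cbox (c - (\<chi> i. \<epsilon>)) (c + (\<chi> i. \<epsilon>)) \<subseteq> Q_cube"
  proof
    fix x assume x: "x \<in> cbox (c - (\<chi> i. \<epsilon>)) (c + (\<chi> i. \<epsilon>))"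
    have "1 / 2 - \<epsilon> \<le> x $ i \<and> x $ i \<le> 1 / 2 + \<epsilon>" for i
      using x by (simp add: mem_box_cart)
    moreover have "0 < 1 / 2 - \<epsilon>" "1 / 2 + \<epsilon> < 1" using \<epsilon> by argo+
    ultimately have "0 < x $ i \<and> x $ i < 1" for i by (meson le_less_trans less_le_trans)
    then show "x \<in> Q_cube" by (simp add: Q_cube_def)
  qed
  show "x \<in> cbox (c - (\<chi> i. \<epsilon>)) (c + (\<chi> i. \<epsilon>))" if "\<kappa> x \<noteq> 0" for x
    using \<kappa>_support[OF that] by (simp add: mem_box_cart abs_le_iff algebra_simps)
qed

lemma \<kappa>_measurable [measurable]: "\<kappa> \<in> borel_measurable borel"
  by (rule smooth_borel_measurable[OF smooth_\<kappa>])

lemma k_measurable1: "(\<lambda>z. k x z) \<in> borel_measurable borel"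
  unfolding k_def by measurable

lemma k_measurable2: "(\<lambda>x. k x z) \<in> borel_measurable borel"
  unfolding k_def by measurable

lemma shift_measurable: "(\<lambda>z. - t *\<^sub>R (z - c)) \<in> borel_measurable Q_measure"
  by (intro borel_measurable_Q) measurable

lemma integrable_k_mult:
  assumes "integrable Q_measure m" shows "integrable Q_measure (\<lambda>z. k x z * m z)"
  using integrable_mult_right[OF parameter_integrable[OF assms shift_measurable test_function_\<kappa>, of 1 x], of "t ^ CARD('n)"]
  by (simp add: k_def mult.assoc)

lemma integral_k_lborel: "integrable lborel (\<lambda>z. k x z)" "(\<integral>z. k x z \<partial>lborel) = 1"
proof -
  have eq: "\<kappa> (x - t *\<^sub>R (z - c)) = \<kappa> ((x + t *\<^sub>R c) + (- t) *\<^sub>R z)" for z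
    by (simp add: algebra_simps)
  have nz: "- t \<noteq> 0" using t_bounds by simp
  show "integrable lborel (\<lambda>z. k x z)"
    unfolding k_def eq by (intro integrable_mult_right lborel_integral_scale(2)[OF _ nz] \<kappa>_integrable) measurable
  have "1 = \<bar>- t\<bar> ^ CARD('n) * (\<integral>z. \<kappa> ((x + t *\<^sub>R c) + (- t) *\<^sub>R z) \<partial>lborel)"
    unfolding \<kappa>_integral[symmetric] by (rule lborel_integral_scale(1)[OF _ nz]) measurable
  then show "(\<integral>z. k x z \<partial>lborel) = 1" unfolding k_def eq using t_bounds by simp
qed

lemma integral_k_first: "integrable lborel (\<lambda>x. k x z)" "(\<integral>x. k x z \<partial>lborel) \<le> 1"
proof -
  have eq: "\<kappa> (x - t *\<^sub>R (z - c)) = \<kappa> (- (t *\<^sub>R (z - c)) + x)" for x by simp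
  show "integrable lborel (\<lambda>x. k x z)"
    unfolding k_def eq by (intro integrable_mult_right lborel_integrable_translate \<kappa>_integrable)
  have "(\<integral>x. k x z \<partial>lborel) = t ^ CARD('n)"
    unfolding k_def eq integral_mult_right_zero lborel_integral_translate[OF \<kappa>_measurable] \<kappa>_integral by simp
  then show "(\<integral>x. k x z \<partial>lborel) \<le> 1" using t_bounds by (simp add: power_le_one)
qed

lemma integral_Q_le_lborel:
  fixes f :: "real^'n \<Rightarrow> real"
  assumes "integrable lborel f" "\<And>x. f x \<ge> 0"
  shows "integrable Q_measure f" "(\<integral>x. f x \<partial>Q_measure) \<le> (\<integral>x. f x \<partial>lborel)"
proof -
  let ?g = "\<lambda>x. indicator Q_cube x * f x"
  have [measurable]: "f \<in> borel_measurable borel" using assms(1) by simp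
  have g: "?g \<in> borel_measurable borel" by measurable
  have i: "integrable lborel ?g"
    using integrable_mult_indicator[OF _ assms(1), of Q_cube] by simp
  have iQ: "integrable Q_measure ?g" and eq: "(\<integral>x. ?g x \<partial>Q_measure) = (\<integral>x. ?g x \<partial>lborel)"
    using integral_Q_eq_lborel[OF g] i by auto
  have same: "integrable Q_measure ?g \<longleftrightarrow> integrable Q_measure f" "(\<integral>x. ?g x \<partial>Q_measure) = (\<integral>x. f x \<partial>Q_measure)"
    by (intro Bochner_Integration.integrable_cong Bochner_Integration.integral_cong; simp)+
  show "integrable Q_measure f" using iQ same by simp
  have "(\<integral>x. ?g x \<partial>lborel) \<le> (\<integral>x. f x \<partial>lborel)"
    using i assms by (intro integral_mono) (auto simp: indicator_def)
  with eq same show "(\<integral>x. f x \<partial>Q_measure) \<le> (\<integral>x. f x \<partial>lborel)" by simp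
qed

lemma test_function_T:
  assumes m: "integrable Q_measure m" shows "test_function (T m)"
proof (rule test_function_of_compact_support)
  show "smooth (T m)"
    unfolding T_def by (intro smooth_mult[OF smooth_const] smooth_parameter_integral m shift_measurable test_function_\<kappa>)
  show "compact (cbox (\<chi> i. \<epsilon>) (\<chi> i. 1 - \<epsilon>) :: (real^'n) set)" by simp
  show "(cbox (\<chi> i. \<epsilon>) (\<chi> i. 1 - \<epsilon>) :: (real^'n) set) \<subseteq> Q_cube"
  proof
    fix x :: "real^'n" assume "x \<in> cbox (\<chi> i. \<epsilon>) (\<chi> i. 1 - \<epsilon>)"
    then have "\<epsilon> \<le> x $ i \<and> x $ i \<le> 1 - \<epsilon>" for i by (simp add: mem_box_cart)
    then have "0 < x $ i \<and> x $ i < 1" for i using \<epsilon> by (smt (verit))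
    then show "x \<in> Q_cube" by (simp add: Q_cube_def)
  qed
  show "x \<in> cbox (\<chi> i. \<epsilon>) (\<chi> i. 1 - \<epsilon>)" if "T m x \<noteq> 0" for x
  proof -
    have "\<exists>z\<in>Q_cube. \<kappa> (x - t *\<^sub>R (z - c)) \<noteq> 0"
    proof (rule ccontr)
      assume "\<not> ?thesis"
      then have "T m x = (\<integral>z. 0 \<partial>(Q_measure :: (real^'n) measure))"
        unfolding T_eq by (intro Bochner_Integration.integral_cong) (auto simp: k_def)
      with that show False by simp
    qed
    then obtain z where z: "z \<in> Q_cube" "\<kappa> (x - t *\<^sub>R (z - c)) \<noteq> 0" by blast
    \<comment> \<open>The contracted cube has half side t/2 = 1/2 - 2 \<epsilon>, and the mollifier
      adds \<epsilon>; a margin of \<epsilon> remains.\<close>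
    have "\<epsilon> \<le> x $ i \<and> x $ i \<le> 1 - \<epsilon>" for i
    proof -
      have 1: "\<bar>(x $ i - t * (z $ i - 1 / 2)) - 1 / 2\<bar> \<le> \<epsilon>"
        using \<kappa>_support[OF z(2), of i] by simp
      have "\<bar>z $ i - 1 / 2\<bar> \<le> 1 / 2"
        using z(1) by (auto simp: Q_cube_def abs_le_iff field_simps less_imp_le)
      then have "\<bar>t * (z $ i - 1 / 2)\<bar> \<le> t * (1 / 2)"
        unfolding abs_mult using t_bounds by (intro mult_mono) auto
      then have 2: "\<bar>t * (z $ i - 1 / 2)\<bar> \<le> 1 / 2 - 2 * \<epsilon>" by (simp add: t_eq field_simps)
      from 1 2 show ?thesis unfolding abs_le_iff by argo
    qed
    then show ?thesis by (simp add: mem_box_cart)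
  qed
qed

lemma T_swap:
  assumes m: "integrable Q_measure m" and f: "f \<in> borel_measurable borel" "\<And>x. \<bar>f x\<bar> \<le> C"
  shows "(\<integral>x. f x * T m x \<partial>Q_measure) = (\<integral>z. m z * (\<integral>x. k x z * f x \<partial>Q_measure) \<partial>Q_measure)"
proof -
  let ?M = "Q_measure :: (real^'n) measure"
  interpret pair_sigma_finite ?M ?M ..
  obtain K where K: "\<And>x. \<bar>\<kappa> x\<bar> \<le> K" using test_function_bounded[OF test_function_\<kappa>] by blast
  have [measurable]: "m \<in> borel_measurable ?M" using m by simp
  have [measurable]: "(\<lambda>x. x) \<in> ?M \<rightarrow>\<^sub>M borel" by (rule id_measurable_Q)
  have [measurable]: "f \<in> borel_measurable ?M" by (rule borel_measurable_Q[OF f(1)])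
  \<comment> \<open>The product is built from completed measures, so the projections are first read
    as maps into \<open>borel\<close> before Borel functions are composed with them.\<close>
  have fst': "(\<lambda>p. fst p) \<in> ?M \<Otimes>\<^sub>M ?M \<rightarrow>\<^sub>M borel"
    by (rule measurable_compose[OF measurable_fst id_measurable_Q])
  have snd': "(\<lambda>p. snd p) \<in> ?M \<Otimes>\<^sub>M ?M \<rightarrow>\<^sub>M borel"
    by (rule measurable_compose[OF measurable_snd id_measurable_Q])
  have "(\<lambda>p. fst p - t *\<^sub>R (snd p - c)) \<in> ?M \<Otimes>\<^sub>M ?M \<rightarrow>\<^sub>M borel"
    by (intro borel_measurable_diff borel_measurable_scaleR borel_measurable_const fst' snd')
  then have km: "(\<lambda>p. k (fst p) (snd p)) \<in> borel_measurable (?M \<Otimes>\<^sub>M ?M)"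
    unfolding k_def by (intro borel_measurable_times borel_measurable_const measurable_compose[OF _ \<kappa>_measurable])
  have mm: "(\<lambda>p. m (snd p)) \<in> borel_measurable (?M \<Otimes>\<^sub>M ?M)" by measurable
  have fm: "(\<lambda>p. f (fst p)) \<in> borel_measurable (?M \<Otimes>\<^sub>M ?M)"
    by (rule measurable_compose[OF fst' f(1)])
  have i: "integrable (?M \<Otimes>\<^sub>M ?M) (\<lambda>(x, z). f x * (k x z * m z))"
  proof (rule Bochner_Integration.integrable_bound[where f = "\<lambda>p. (C * (t ^ CARD('n) * K)) * m (snd p)"])
    have "integrable (?M \<Otimes>\<^sub>M ?M) (\<lambda>p. m (snd p))"
    proof (rule Fubini_integrable[OF mm])
      show "integrable ?M (\<lambda>x. \<integral>y. norm (m (snd (x, y))) \<partial>?M)" by simp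
      show "AE x in ?M. integrable ?M (\<lambda>y. m (snd (x, y)))" using m by simp
    qed
    then show "integrable (?M \<Otimes>\<^sub>M ?M) (\<lambda>p. (C * (t ^ CARD('n) * K)) * m (snd p))" by simp
    show "(\<lambda>(x, z). f x * (k x z * m z)) \<in> borel_measurable (?M \<Otimes>\<^sub>M ?M)"
      unfolding split_beta by (intro borel_measurable_times km mm fm)
    show "AE p in ?M \<Otimes>\<^sub>M ?M. norm ((\<lambda>(x, z). f x * (k x z * m z)) p) \<le> norm ((C * (t ^ CARD('n) * K)) * m (snd p))"
    proof (rule AE_I2)
      fix p :: "(real^'n) \<times> (real^'n)"
      obtain x z where p: "p = (x, z)" by fastforce
      have C0: "0 \<le> C" "0 \<le> K" using order_trans[OF abs_ge_zero f(2)] order_trans[OF abs_ge_zero K] by auto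
      have "\<bar>k x z\<bar> \<le> t ^ CARD('n) * K"
        unfolding k_def abs_mult using K t_bounds by (intro mult_mono) auto
      then have "\<bar>f x\<bar> * (\<bar>k x z\<bar> * \<bar>m z\<bar>) \<le> C * ((t ^ CARD('n) * K) * \<bar>m z\<bar>)"
        using C0 f(2) t_bounds by (intro mult_mono) auto
      then show "norm ((\<lambda>(x, z). f x * (k x z * m z)) p) \<le> norm ((C * (t ^ CARD('n) * K)) * m (snd p))"
        using C0 t_bounds by (simp add: p abs_mult mult.assoc)
    qed
  qed
  have "(\<integral>x. f x * T m x \<partial>?M) = (\<integral>x. (\<integral>z. f x * (k x z * m z) \<partial>?M) \<partial>?M)"
    by (simp add: T_eq)
  also have "\<dots> = (\<integral>z. (\<integral>x. f x * (k x z * m z) \<partial>?M) \<partial>?M)"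
    using Fubini_integral[OF i] by simp
  also have "\<dots> = (\<integral>z. (\<integral>x. m z * (k x z * f x) \<partial>?M) \<partial>?M)"
    by (simp add: mult_ac)
  also have "\<dots> = (\<integral>z. m z * (\<integral>x. k x z * f x \<partial>?M) \<partial>?M)"
    by simp
  finally show ?thesis .
qed

text \<open>f vanishes off the cube, so the integral runs over the whole space, where x = t (z - c)
  + y may be substituted.\<close>

lemma P_eq:
  assumes f: "test_function f" shows "(\<integral>x. k x z * f x \<partial>Q_measure) = P f z"
proof -
  have fm: "f \<in> borel_measurable borel" by (rule smooth_borel_measurable[OF test_function_smooth[OF f]])
  have "(\<integral>x. k x z * f x \<partial>Q_measure) = (\<integral>x. k x z * f x \<partial>lborel)"
    by (rule integral_Q_eq_lborel(1)) (auto intro!: borel_measurable_times k_measurable2 fm simp: test_function_eq_0[OF f])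
  also have "\<dots> = (\<integral>x. k (t *\<^sub>R (z - c) + x) z * f (t *\<^sub>R (z - c) + x) \<partial>lborel)"
    by (rule lborel_integral_translate[symmetric]) (intro borel_measurable_times k_measurable2 fm)
  also have "\<dots> = (\<integral>y. t ^ CARD('n) * (f (t *\<^sub>R z + (y - t *\<^sub>R c)) * \<kappa> y) \<partial>lborel)"
    by (simp add: k_def algebra_simps)
  also have "\<dots> = P f z" by (simp only: P_def integral_mult_right_zero)
  finally show ?thesis .
qed

lemma T_swap_test_function:
  assumes "integrable Q_measure m" "test_function f"
  shows "(\<integral>x. f x * T m x \<partial>Q_measure) = (\<integral>z. m z * P f z \<partial>Q_measure)"
proof -
  obtain C where C: "\<And>x. \<bar>f x\<bar> \<le> C" using test_function_bounded[OF assms(2)] by blast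
  show ?thesis
    using T_swap[OF assms(1) smooth_borel_measurable[OF test_function_smooth[OF assms(2)]] C] P_eq[OF assms(2)] by simp
qed

lemma smooth_P:
  assumes "test_function f" shows "smooth (P f)"
  unfolding P_def
  by (intro smooth_mult[OF smooth_const] smooth_parameter_integral \<kappa>_integrable assms) measurable

lemma partial_derivs_P:
  assumes "test_function f"
  shows "partial_derivs \<beta> (P f) z = t ^ length \<beta> * P (partial_derivs \<beta> f) z"
proof -
  have b: "(\<lambda>y. y - t *\<^sub>R c) \<in> lborel \<rightarrow>\<^sub>M borel" by measurable
  show ?thesis
    unfolding P_def[abs_def]
    by (simp add: partial_derivs_cmult[OF smooth_parameter_integral[OF \<kappa>_integrable b assms]]
      parameter_integral_partial_derivs[OF \<kappa>_integrable b assms])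
qed

text \<open>Each derivative of \<open>P f\<close> yields a factor t, so order h yields t^h. The
  weight of a component cancels this discrepancy between orders, and all orders combine into the
  single operator applied to \<open>P f\<close>.\<close>

definition mollify :: "'n field \<Rightarrow> 'n field" where
  "mollify v x \<alpha> = t ^ length \<alpha> * T (\<lambda>z. v z \<alpha>) x"

lemma test_field_mollify:
  assumes "\<And>\<alpha>. \<alpha> \<in> K_index d \<Longrightarrow> integrable Q_measure (\<lambda>z. v z \<alpha>)"
  shows "test_field d (mollify v)"
  unfolding test_field_def mollify_def using assms by (auto intro!: test_function_cmult test_function_T)

text \<open>By duality: pairing the value \<psi> with itself moves the weights onto \<psi>, giving a
  vector a no longer than \<psi>. Cauchy-Schwarz under a kernel of mass at most 1 yields
  \<bar>\<psi>\<bar>^2 \<le> \<bar>\<psi>\<bar>.\<close>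

lemma K_norm_mollify:
  assumes v: "\<And>\<alpha>. \<alpha> \<in> K_index d \<Longrightarrow> integrable Q_measure (\<lambda>z. v z \<alpha>)"
    and v1: "AE z in Q_measure. K_norm d (v z) \<le> 1"
  shows "K_norm d (mollify v x) \<le> 1"
proof -
  define \<psi> where "\<psi> = mollify v x"
  define a where "a \<alpha> = t ^ length \<alpha> * \<psi> \<alpha>" for \<alpha>
  have i: "integrable Q_measure (\<lambda>z. k x z * v z \<alpha>)" if "\<alpha> \<in> K_index d" for \<alpha>
    using integrable_k_mult[OF v[OF that]] .
  have a: "K_norm d a \<le> K_norm d \<psi>"
    unfolding K_norm_def L2_set_def a_def
  proof (intro real_sqrt_le_mono sum_mono)
    fix \<alpha> show "(t ^ length \<alpha> * \<psi> \<alpha>)\<^sup>2 \<le> (\<psi> \<alpha>)\<^sup>2"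
      unfolding power_mult_distrib using t_bounds by (intro mult_left_le_one_le) (auto simp: power_le_one)
  qed
  have ik: "integrable Q_measure (\<lambda>z. k x z)" "(\<integral>z. k x z \<partial>Q_measure) \<le> 1"
    using integral_Q_le_lborel[OF integral_k_lborel(1) k_nonneg, of x] integral_k_lborel(2)[of x] by auto
  have "(K_norm d \<psi>)\<^sup>2 = (\<Sum>\<alpha>\<in>K_index d. a \<alpha> * (\<integral>z. k x z * v z \<alpha> \<partial>Q_measure))"
    unfolding K_norm_power2 by (intro sum.cong refl) (simp add: a_def \<psi>_def mollify_def T_eq power2_eq_square)
  also have "\<dots> = (\<integral>z. (\<Sum>\<alpha>\<in>K_index d. a \<alpha> * (k x z * v z \<alpha>)) \<partial>Q_measure)"
    using i by (simp add: Bochner_Integration.integral_sum)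
  also have "\<dots> = (\<integral>z. k x z * K_inner d a (v z) \<partial>Q_measure)"
    by (simp add: K_inner_def sum_distrib_left mult_ac)
  also have "\<dots> \<le> (\<integral>z. k x z * K_norm d \<psi> \<partial>Q_measure)"
  proof (rule integral_mono_AE)
    have "integrable Q_measure (\<lambda>z. \<Sum>\<alpha>\<in>K_index d. a \<alpha> * (k x z * v z \<alpha>))"
      using i by (intro Bochner_Integration.integrable_sum integrable_mult_right)
    then show "integrable Q_measure (\<lambda>z. k x z * K_inner d a (v z))"
      by (simp add: K_inner_def sum_distrib_left mult_ac)
    show "integrable Q_measure (\<lambda>z. k x z * K_norm d \<psi>)" using ik by simp
    show "AE z in Q_measure. k x z * K_inner d a (v z) \<le> k x z * K_norm d \<psi>"
      using v1
    proof eventually_elim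
      case (elim z)
      have "K_inner d a (v z) \<le> K_norm d a * K_norm d (v z)" using K_inner_abs_le[of d a "v z"] by linarith
      also have "\<dots> \<le> K_norm d \<psi> * 1" using a elim by (intro mult_mono) auto
      finally show ?case using k_nonneg by (intro mult_left_mono) auto
    qed
  qed
  also have "\<dots> \<le> 1 * K_norm d \<psi>" using mult_right_mono[OF ik(2) K_norm_nonneg[of d \<psi>]] by simp
  finally have "K_norm d \<psi> * K_norm d \<psi> \<le> 1 * K_norm d \<psi>" by (simp add: power2_eq_square)
  then have "K_norm d \<psi> \<le> 1"
    using K_norm_nonneg[of d \<psi>] by (metis mult_le_cancel_right_pos order_le_less zero_le_one)
  then show ?thesis by (simp add: \<psi>_def)
qed

text \<open>Transposing \<open>T\<close> turns the pairing of \<open>mollify v\<close> with the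
  derivatives of f into that of v with the derivatives of \<open>P f\<close>. The hypothesis
  \<open>ext\<close> is used at \<Phi> = \<open>P f\<close>, and transposing back gives
  \<open>T g\<close>.\<close>

lemma is_adjoint_mollify:
  assumes v: "\<And>\<alpha>. \<alpha> \<in> K_index d \<Longrightarrow> integrable Q_measure (\<lambda>z. v z \<alpha>)" and g: "integrable Q_measure g"
    and ext: "\<And>\<Phi>. smooth \<Phi> \<Longrightarrow> (\<integral>x. K_inner d (op_B B \<Phi> x) (v x) \<partial>Q_measure) = (\<integral>x. \<Phi> x * g x \<partial>Q_measure)"
  shows "is_adjoint d B (mollify v) (T g)"
  unfolding is_adjoint_def
proof (intro allI impI)
  fix f :: "real^'n \<Rightarrow> real" assume f: "test_function f"
  have tT: "test_function (T (\<lambda>z. v z \<alpha>))" if "\<alpha> \<in> K_index d" for \<alpha> using test_function_T[OF v[OF that]] .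
  have i1: "integrable Q_measure (\<lambda>x. partial_derivs \<beta> f x * T (\<lambda>z. v z \<alpha>) x)" if "\<alpha> \<in> K_index d" for \<alpha> \<beta>
    by (intro test_function_integrable test_function_mult test_function_partial_derivs f test_function_smooth tT that)
  have i2: "integrable Q_measure (\<lambda>z. partial_derivs \<beta> (P f) z * v z \<alpha>)" if "\<alpha> \<in> K_index d" for \<alpha> \<beta>
    by (intro integrable_smooth_mult smooth_partial_derivs smooth_P f v that)
  have "(\<integral>x. K_inner d (op_B B f x) (mollify v x) \<partial>Q_measure)
     = (\<integral>x. (\<Sum>\<alpha>\<in>K_index d. \<Sum>\<beta> | length \<beta> = length \<alpha>.
         (B (length \<alpha>) \<alpha> \<beta> * t ^ length \<alpha>) * (partial_derivs \<beta> f x * T (\<lambda>z. v z \<alpha>) x)) \<partial>Q_measure)"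
    by (simp add: K_inner_def op_B_def mollify_def sum_distrib_right sum_distrib_left mult_ac)
  also have "\<dots> = (\<Sum>\<alpha>\<in>K_index d. \<Sum>\<beta> | length \<beta> = length \<alpha>.
         (B (length \<alpha>) \<alpha> \<beta> * t ^ length \<alpha>) * (\<integral>x. partial_derivs \<beta> f x * T (\<lambda>z. v z \<alpha>) x \<partial>Q_measure))"
    by (subst Bochner_Integration.integral_sum, intro Bochner_Integration.integrable_sum integrable_mult_right i1, assumption)
      (simp add: i1 Bochner_Integration.integral_sum)
  also have "\<dots> = (\<Sum>\<alpha>\<in>K_index d. \<Sum>\<beta> | length \<beta> = length \<alpha>.
         B (length \<alpha>) \<alpha> \<beta> * (\<integral>z. partial_derivs \<beta> (P f) z * v z \<alpha> \<partial>Q_measure))"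
  proof (intro sum.cong refl)
    fix \<alpha> \<beta> :: "'n list" assume \<alpha>: "\<alpha> \<in> K_index d" and "\<beta> \<in> {\<beta>. length \<beta> = length \<alpha>}"
    then have len: "length \<beta> = length \<alpha>" by simp
    have "(\<integral>x. partial_derivs \<beta> f x * T (\<lambda>z. v z \<alpha>) x \<partial>Q_measure) = (\<integral>z. v z \<alpha> * P (partial_derivs \<beta> f) z \<partial>Q_measure)"
      by (rule T_swap_test_function[OF v[OF \<alpha>] test_function_partial_derivs[OF f]])
    then have "t ^ length \<alpha> * (\<integral>x. partial_derivs \<beta> f x * T (\<lambda>z. v z \<alpha>) x \<partial>Q_measure)
        = (\<integral>z. t ^ length \<beta> * (v z \<alpha> * P (partial_derivs \<beta> f) z) \<partial>Q_measure)"
      by (simp add: len)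
    also have "\<dots> = (\<integral>z. partial_derivs \<beta> (P f) z * v z \<alpha> \<partial>Q_measure)"
      by (simp add: partial_derivs_P[OF f] mult_ac)
    finally show "(B (length \<alpha>) \<alpha> \<beta> * t ^ length \<alpha>) * (\<integral>x. partial_derivs \<beta> f x * T (\<lambda>z. v z \<alpha>) x \<partial>Q_measure)
        = B (length \<alpha>) \<alpha> \<beta> * (\<integral>z. partial_derivs \<beta> (P f) z * v z \<alpha> \<partial>Q_measure)"
      by (simp add: mult.assoc)
  qed
  also have "\<dots> = (\<integral>z. (\<Sum>\<alpha>\<in>K_index d. \<Sum>\<beta> | length \<beta> = length \<alpha>.
         B (length \<alpha>) \<alpha> \<beta> * (partial_derivs \<beta> (P f) z * v z \<alpha>)) \<partial>Q_measure)"
    by (subst Bochner_Integration.integral_sum, intro Bochner_Integration.integrable_sum integrable_mult_right i2, assumption)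
      (simp add: i2 Bochner_Integration.integral_sum)
  also have "\<dots> = (\<integral>z. K_inner d (op_B B (P f) z) (v z) \<partial>Q_measure)"
    by (simp add: K_inner_def op_B_def sum_distrib_right sum_distrib_left mult_ac)
  also have "\<dots> = (\<integral>z. P f z * g z \<partial>Q_measure)" by (rule ext[OF smooth_P[OF f]])
  also have "\<dots> = (\<integral>x. f x * T g x \<partial>Q_measure)"
    using T_swap_test_function[OF g f] by (simp add: mult.commute)
  finally show "(\<integral>x. K_inner d (op_B B f x) (mollify v x) \<partial>Q_measure) = (\<integral>x. f x * T g x \<partial>Q_measure)" .
qed

text \<open>\<open>mollify v\<close> is a competitor in the supremum, and by uniqueness
  \<open>T g\<close> represents its adjoint.\<close>

lemma PV_mollify:
  assumes v: "\<And>\<alpha>. \<alpha> \<in> K_index d \<Longrightarrow> integrable Q_measure (\<lambda>z. v z \<alpha>)"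
    and v1: "AE z in Q_measure. K_norm d (v z) \<le> 1" and g: "integrable Q_measure g"
    and ext: "\<And>\<Phi>. smooth \<Phi> \<Longrightarrow> (\<integral>x. K_inner d (op_B B \<Phi> x) (v x) \<partial>Q_measure) = (\<integral>x. \<Phi> x * g x \<partial>Q_measure)"
    and w: "w \<in> borel_measurable Q_measure"
  shows "ereal (\<integral>x. w x * T g x \<partial>Q_measure) \<le> PV d B w"
proof -
  have adm: "mollify v \<in> admissible d"
    using test_field_mollify[OF v] K_norm_mollify[OF v v1] by (simp add: admissible_def)
  then have t: "test_field d (mollify v)" by (simp add: admissible_def)
  have iT: "integrable Q_measure (T g)" and it: "integrable Q_measure (test_adjoint d B (mollify v))"
    by (intro test_function_integrable test_function_T g test_function_test_adjoint t)+
  have ae: "AE x in Q_measure. T g x = test_adjoint d B (mollify v) x"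
    by (rule adjoint_unique[OF iT is_adjoint_mollify[OF v g ext] it is_adjoint_test_adjoint[OF t]])
  then have ae': "AE x in Q_measure. w x * T g x = w x * test_adjoint d B (mollify v) x"
    by eventually_elim simp
  have "(\<integral>x. w x * T g x \<partial>Q_measure) = (\<integral>x. w x * test_adjoint d B (mollify v) x \<partial>Q_measure)"
    by (rule integral_cong_AE[OF borel_measurable_times borel_measurable_times ae'])
      (rule w borel_measurable_integrable iT it)+
  then show ?thesis unfolding PV_eq_SUP[OF w] using adm by (intro SUP_upper2[of "mollify v"]) auto
qed

text \<open>Schur's test in Young form: the mass bound in z controls the w-term pointwise, and the
  bound in x, through \<open>T_swap\<close> with the constant 1, controls the h-term. The estimate
  is uniform in \<epsilon>.\<close>

lemma integral_mult_T_le: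
  assumes pq: "p > 1" "q > 1" "1 / p + 1 / q = 1" and w: "Lq Q_measure p w" and h: "Lq Q_measure q h"
    and \<eta>: "\<eta> > 0"
  shows "\<bar>\<integral>x. w x * T h x \<partial>Q_measure\<bar>
    \<le> \<eta> powr p * (\<integral>x. \<bar>w x\<bar> powr p \<partial>Q_measure) + \<eta> powr - q * (\<integral>x. \<bar>h x\<bar> powr q \<partial>Q_measure)"
proof -
  note hi = Lq_imp_integrable[OF h pq(2)]
  note hq = Lq_integrable[OF h]
  have ptw: "\<bar>w x * T h x\<bar> \<le> \<eta> powr p * \<bar>w x\<bar> powr p + \<eta> powr - q * T (\<lambda>z. \<bar>h z\<bar> powr q) x" for x
  proof -
    have ik: "integrable Q_measure (\<lambda>z. k x z)" "(\<integral>z. k x z \<partial>Q_measure) \<le> 1"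
      using integral_Q_le_lborel[OF integral_k_lborel(1) k_nonneg, of x] integral_k_lborel(2)[of x] by auto
    have "\<bar>w x * T h x\<bar> = \<bar>\<integral>z. w x * (k x z * h z) \<partial>Q_measure\<bar>" by (simp add: T_eq)
    also have "\<dots> \<le> (\<integral>z. \<bar>w x * (k x z * h z)\<bar> \<partial>Q_measure)" by (rule integral_abs_bound)
    also have "\<dots> \<le> (\<integral>z. k x z * (\<eta> powr p * \<bar>w x\<bar> powr p) + \<eta> powr - q * (k x z * \<bar>h z\<bar> powr q) \<partial>Q_measure)"
    proof (rule integral_mono)
      show "integrable Q_measure (\<lambda>z. \<bar>w x * (k x z * h z)\<bar>)"
        by (intro integrable_abs integrable_mult_right integrable_k_mult hi)
      show "integrable Q_measure (\<lambda>z. k x z * (\<eta> powr p * \<bar>w x\<bar> powr p) + \<eta> powr - q * (k x z * \<bar>h z\<bar> powr q))"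
        by (intro Bochner_Integration.integrable_add integrable_mult_right integrable_mult_left integrable_k_mult hq ik)
      fix z
      have "\<bar>w x\<bar> * \<bar>h z\<bar> \<le> \<eta> powr p * \<bar>w x\<bar> powr p + \<eta> powr - q * \<bar>h z\<bar> powr q"
        using pq \<eta> by (rule Youngs_inequality_scaled)
      then have "k x z * (\<bar>w x\<bar> * \<bar>h z\<bar>) \<le> k x z * (\<eta> powr p * \<bar>w x\<bar> powr p + \<eta> powr - q * \<bar>h z\<bar> powr q)"
        by (intro mult_left_mono k_nonneg)
      then show "\<bar>w x * (k x z * h z)\<bar> \<le> k x z * (\<eta> powr p * \<bar>w x\<bar> powr p) + \<eta> powr - q * (k x z * \<bar>h z\<bar> powr q)"
        using k_nonneg[of x z] by (simp add: abs_mult algebra_simps)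
    qed
    also have "\<dots> = (\<integral>z. k x z \<partial>Q_measure) * (\<eta> powr p * \<bar>w x\<bar> powr p) + \<eta> powr - q * T (\<lambda>z. \<bar>h z\<bar> powr q) x"
      using ik integrable_k_mult[OF hq] by (simp add: T_eq)
    also have "\<dots> \<le> 1 * (\<eta> powr p * \<bar>w x\<bar> powr p) + \<eta> powr - q * T (\<lambda>z. \<bar>h z\<bar> powr q) x"
      using ik by (intro add_right_mono mult_right_mono) auto
    finally show ?thesis by simp
  qed
  have iT: "integrable Q_measure (T (\<lambda>z. \<bar>h z\<bar> powr q))"
    by (intro test_function_integrable test_function_T hq)
  have "Lq Q_measure q (T h)" using pq by (intro test_function_Lq test_function_T hi) auto
  then have iwT: "integrable Q_measure (\<lambda>x. w x * T h x)" using w pq by (intro integrable_mult_Lq)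
  have TT: "(\<integral>x. T (\<lambda>z. \<bar>h z\<bar> powr q) x \<partial>Q_measure) \<le> (\<integral>z. \<bar>h z\<bar> powr q \<partial>Q_measure)"
  proof -
    have "(\<integral>x. T (\<lambda>z. \<bar>h z\<bar> powr q) x \<partial>Q_measure) = (\<integral>z. \<bar>h z\<bar> powr q * (\<integral>x. k x z \<partial>Q_measure) \<partial>Q_measure)"
      using T_swap[OF hq, of "\<lambda>x. 1" 1] by simp
    also have "\<dots> \<le> (\<integral>z. \<bar>h z\<bar> powr q \<partial>Q_measure)"
    proof (rule integral_mono_AE')
      show "integrable Q_measure (\<lambda>z. \<bar>h z\<bar> powr q)" by (rule hq)
      have J: "0 \<le> (\<integral>x. k x z \<partial>Q_measure)" "(\<integral>x. k x z \<partial>Q_measure) \<le> 1" for z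
        using integral_Q_le_lborel(2)[OF integral_k_first(1) k_nonneg, of z] integral_k_first(2)[of z] k_nonneg
        by (auto intro: Bochner_Integration.integral_nonneg)
      show "AE z in Q_measure. \<bar>h z\<bar> powr q * (\<integral>x. k x z \<partial>Q_measure) \<le> \<bar>h z\<bar> powr q"
        using J by (intro AE_I2 mult_left_le) auto
      show "AE z in Q_measure. 0 \<le> \<bar>h z\<bar> powr q" by simp
    qed
    finally show ?thesis .
  qed
  have "\<bar>\<integral>x. w x * T h x \<partial>Q_measure\<bar> \<le> (\<integral>x. \<bar>w x * T h x\<bar> \<partial>Q_measure)" by (rule integral_abs_bound)
  also have "\<dots> \<le> (\<integral>x. \<eta> powr p * \<bar>w x\<bar> powr p + \<eta> powr - q * T (\<lambda>z. \<bar>h z\<bar> powr q) x \<partial>Q_measure)"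
    using iwT iT Lq_integrable[OF w] ptw by (intro integral_mono) auto
  also have "\<dots> = \<eta> powr p * (\<integral>x. \<bar>w x\<bar> powr p \<partial>Q_measure) + \<eta> powr - q * (\<integral>x. T (\<lambda>z. \<bar>h z\<bar> powr q) x \<partial>Q_measure)"
    using iT Lq_integrable[OF w] by simp
  also have "\<dots> \<le> \<eta> powr p * (\<integral>x. \<bar>w x\<bar> powr p \<partial>Q_measure) + \<eta> powr - q * (\<integral>x. \<bar>h x\<bar> powr q \<partial>Q_measure)"
    using TT by (intro add_left_mono mult_left_mono) auto
  finally show ?thesis .
qed

text \<open>The kernel moves each coordinate by at most 9 \<epsilon>, and the dimension enters by
  bounding the norm by the sum of coordinates. As f vanishes off the cube, the average may be taken
  over the whole space, where the kernel has mass exactly 1.\<close>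

lemma T_test_function_close:
  assumes f: "test_function f" and L: "\<And>x y. \<bar>f x - f y\<bar> \<le> L * norm (x - y)" and x: "x \<in> Q_cube"
  shows "\<bar>T f x - f x\<bar> \<le> 9 * L * real CARD('n) * \<epsilon>"
proof -
  have fm: "f \<in> borel_measurable borel" by (rule smooth_borel_measurable[OF test_function_smooth[OF f]])
  have kf: "(\<lambda>z. k x z * f z) \<in> borel_measurable borel" by (intro borel_measurable_times k_measurable1 fm)
  have "integrable Q_measure (\<lambda>z. k x z * f z)" by (intro integrable_k_mult test_function_integrable f)
  then have i1: "integrable lborel (\<lambda>z. k x z * f z)"
    using integral_Q_eq_lborel(2)[OF kf] test_function_eq_0[OF f] by simp
  have "T f x - f x = (\<integral>z. k x z * f z \<partial>lborel) - f x * (\<integral>z. k x z \<partial>lborel)"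
    unfolding T_eq using integral_Q_eq_lborel(1)[OF kf] test_function_eq_0[OF f] integral_k_lborel(2) by simp
  also have "\<dots> = (\<integral>z. k x z * f z - f x * k x z \<partial>lborel)"
    using i1 integral_k_lborel(1) by simp
  finally have "\<bar>T f x - f x\<bar> \<le> (\<integral>z. \<bar>k x z * f z - f x * k x z\<bar> \<partial>lborel)"
    by (simp add: integral_abs_bound)
  also have "\<dots> \<le> (\<integral>z. k x z * (9 * L * real CARD('n) * \<epsilon>) \<partial>lborel)"
  proof (rule integral_mono)
    show "integrable lborel (\<lambda>z. \<bar>k x z * f z - f x * k x z\<bar>)"
      using i1 integral_k_lborel(1) by simp
    show "integrable lborel (\<lambda>z. k x z * (9 * L * real CARD('n) * \<epsilon>))" using integral_k_lborel(1) by simp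
    fix z
    show "\<bar>k x z * f z - f x * k x z\<bar> \<le> k x z * (9 * L * real CARD('n) * \<epsilon>)"
    proof (cases "k x z = 0")
      case False
      then have \<kappa>: "\<kappa> (x - t *\<^sub>R (z - c)) \<noteq> 0" by (simp add: k_def)
      have L0: "L \<ge> 0" using L[of "axis undefined 1" 0] by (simp add: norm_axis_1)
      \<comment> \<open>Relative to the centre, Z - X = - (X - t Z) + (1 - t) Z. The first term is
        at most \<epsilon>, and the second at most 4 \<epsilon> times 2.\<close>
      have comp: "\<bar>(z - x) $ i\<bar> \<le> 9 * \<epsilon>" for i
      proof -
        define X Z where "X = x $ i - 1 / 2" and "Z = z $ i - 1 / 2"
        have 1: "\<bar>X - t * Z\<bar> \<le> \<epsilon>" using \<kappa>_support[OF \<kappa>, of i] by (simp add: X_def Z_def algebra_simps)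
        have 2: "\<bar>X\<bar> \<le> 1 / 2" using x by (auto simp: Q_cube_def X_def abs_le_iff field_simps less_imp_le)
        have "t * \<bar>Z\<bar> = \<bar>t * Z\<bar>" using t_bounds by (simp add: abs_mult)
        also have "\<bar>t * Z\<bar> \<le> \<bar>X\<bar> + \<bar>X - t * Z\<bar>" by linarith
        also have "\<dots> \<le> 1 / 2 + \<epsilon>" by (intro add_mono 1 2)
        also have "\<dots> \<le> 1" using \<epsilon> by argo
        finally have "(1 / 2) * \<bar>Z\<bar> \<le> 1" using t_bounds mult_right_mono[of "1/2" t "\<bar>Z\<bar>"] by simp
        then have "\<bar>Z\<bar> \<le> 2" by simp
        then have "(4 * \<epsilon>) * \<bar>Z\<bar> \<le> (4 * \<epsilon>) * 2" using \<epsilon> by (intro mult_left_mono) auto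
        then have 3: "\<bar>(4 * \<epsilon>) * Z\<bar> \<le> 8 * \<epsilon>" using \<epsilon> by (simp add: abs_mult)
        have "(z - x) $ i = - (X - t * Z) + (4 * \<epsilon>) * Z" by (simp add: X_def Z_def t_eq algebra_simps)
        with 1 3 show ?thesis by (smt (verit))
      qed
      have "norm (z - x) \<le> (\<Sum>i\<in>UNIV. \<bar>(z - x) $ i\<bar>)" by (rule norm_le_l1_cart)
      also have "\<dots> \<le> (\<Sum>i\<in>(UNIV::'n set). 9 * \<epsilon>)" by (intro sum_mono comp)
      finally have "L * norm (z - x) \<le> L * (real CARD('n) * (9 * \<epsilon>))" using L0 by (intro mult_left_mono) auto
      with L[of z x] have "\<bar>f z - f x\<bar> \<le> 9 * L * real CARD('n) * \<epsilon>" by (simp add: mult_ac)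
      then have "k x z * \<bar>f z - f x\<bar> \<le> k x z * (9 * L * real CARD('n) * \<epsilon>)" by (intro mult_left_mono k_nonneg)
      moreover have "\<bar>k x z * f z - f x * k x z\<bar> = k x z * \<bar>f z - f x\<bar>"
      proof -
        have "k x z * f z - f x * k x z = k x z * (f z - f x)" by (simp add: algebra_simps)
        then show ?thesis using k_nonneg by (simp add: abs_mult)
      qed
      ultimately show ?thesis by simp
    qed simp
  qed
  also have "\<dots> = 9 * L * real CARD('n) * \<epsilon>" using integral_k_lborel(2) by simp
  finally show ?thesis .
qed

lemma T_diff:
  assumes "integrable Q_measure f" "integrable Q_measure g"
  shows "T (\<lambda>x. f x - g x) x = T f x - T g x"
  unfolding T_eq using integrable_k_mult[OF assms(1)] integrable_k_mult[OF assms(2)]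
  by (simp add: right_diff_distrib)

end

lemma mollifier_exists_center:
  assumes "0 < e" "e \<le> 1 / 8"
  obtains \<kappa> :: "real^'n::finite \<Rightarrow> real" where "mollifier \<kappa> e (1 - 4 * e) (\<chi> i. 1 / 2)"
proof -
  obtain \<kappa> :: "real^'n \<Rightarrow> real" where \<kappa>: "smooth \<kappa>" "\<And>x. \<kappa> x \<ge> 0"
    "\<And>x i. \<kappa> x \<noteq> 0 \<Longrightarrow> \<bar>x $ i - (\<chi> i. 1 / 2) $ i\<bar> \<le> e"
    "integrable lborel \<kappa>" "(\<integral>x. \<kappa> x \<partial>lborel) = 1"
    by (rule mollifier_exists[OF assms(1), of "\<chi> i. 1 / 2"]) blast
  then have "mollifier \<kappa> e (1 - 4 * e) (\<chi> i. 1 / 2)"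
    using assms by (intro mollifier.intro) auto
  then show ?thesis by (rule that)
qed

section \<open>The support function of the limit set\<close>

text \<open>Bound the pairing with g by that with \<open>T g\<close>, which
  \<open>PV_mollify\<close> controls. Writing g = f + h with f the adjoint of a test field,
  smoothing is uniformly close to the identity on the Lipschitz f, while h and \<open>T h\<close>
  are both small against w. The choices are made in the order \<eta>, n, L, e.\<close>

lemma integral_le_PV:
  fixes B :: "'n::finite coeffs"
  assumes pq: "p > 1" "q > 1" "1 / p + 1 / q = 1"
    and v: "in_L_field d q v" and v1: "AE x in Q_measure. K_norm d (v x) \<le> 1" and g: "Lq Q_measure q g"
    and \<phi>: "\<And>n. test_field d (\<phi> n)"
    and lim_v: "(\<lambda>n. \<integral>x. K_norm d (\<lambda>\<alpha>. v x \<alpha> - \<phi> n x \<alpha>) powr q \<partial>Q_measure) \<longlonglongrightarrow> 0"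
    and lim_g: "(\<lambda>n. \<integral>x. \<bar>g x - test_adjoint d B (\<phi> n) x\<bar> powr q \<partial>Q_measure) \<longlonglongrightarrow> 0"
    and w: "Lq Q_measure p w"
  shows "ereal (\<integral>x. w x * g x \<partial>Q_measure) \<le> PV d B w"
proof (rule ereal_le_epsilon2)
  fix \<delta> :: real assume \<delta>: "\<delta> > 0"
  note Lint = finite_measure.Lq_imp_integrable[OF finite_measure_Q]
  define W where "W = (\<integral>x. \<bar>w x\<bar> powr p \<partial>Q_measure)"
  have W: "W \<ge> 0" by (simp add: W_def)
  define A where "A = (\<integral>x. \<bar>w x\<bar> \<partial>Q_measure)"
  have A: "A \<ge> 0" by (simp add: A_def)
  \<comment> \<open>Depends on w alone and makes the w-term of Young's inequality at most
    \<delta>/6; the index n then does the same for the h-term.\<close>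
  define \<eta> where "\<eta> = (\<delta> / (6 * (W + 1))) powr (1 / p)"
  have \<eta>: "\<eta> > 0" using \<delta> W by (simp add: \<eta>_def)
  have "\<eta> powr p = \<delta> / (6 * (W + 1))" using \<delta> W pq by (simp add: \<eta>_def powr_powr)
  then have \<eta>W: "\<eta> powr p * W \<le> \<delta> / 6"
  proof -
    assume "\<eta> powr p = \<delta> / (6 * (W + 1))"
    then have "\<eta> powr p * W = \<delta> / 6 * (W / (W + 1))" by simp
    also have "\<dots> \<le> \<delta> / 6" using \<delta> W by (intro mult_left_le) auto
    finally show ?thesis .
  qed
  have "eventually (\<lambda>n. (\<integral>x. \<bar>g x - test_adjoint d B (\<phi> n) x\<bar> powr q \<partial>Q_measure) < \<delta> / 6 * \<eta> powr q) sequentially"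
    by (rule order_tendstoD(2)[OF lim_g]) (use \<delta> \<eta> in simp)
  then obtain n where n: "(\<integral>x. \<bar>g x - test_adjoint d B (\<phi> n) x\<bar> powr q \<partial>Q_measure) < \<delta> / 6 * \<eta> powr q"
    by (auto simp: eventually_sequentially)
  define f where "f = test_adjoint d B (\<phi> n)"
  have f: "test_function f" unfolding f_def by (rule test_function_test_adjoint[OF \<phi>])
  define h where "h x = g x - f x" for x
  have Lf: "Lq Q_measure q f" using f pq by (intro test_function_Lq) auto
  have Lh: "Lq Q_measure q h" unfolding h_def[abs_def] using g Lf pq by (intro Lq_diff) auto
  have H: "\<eta> powr - q * (\<integral>x. \<bar>h x\<bar> powr q \<partial>Q_measure) \<le> \<delta> / 6"
  proof -
    have "\<eta> powr - q * (\<integral>x. \<bar>h x\<bar> powr q \<partial>Q_measure) \<le> \<eta> powr - q * (\<delta> / 6 * \<eta> powr q)"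
      using n by (intro mult_left_mono) (auto simp: h_def f_def)
    also have "\<dots> = \<delta> / 6" using \<eta> by (simp add: powr_minus)
    finally show ?thesis .
  qed
  obtain L where L: "L \<ge> 0" "\<And>x y. \<bar>f x - f y\<bar> \<le> L * norm (x - y)" using test_function_lipschitz[OF f] by blast
  define G where "G = 9 * L * real CARD('n)"
  have G: "G \<ge> 0" using L by (simp add: G_def)
  \<comment> \<open>The radius is chosen after the Lipschitz constant of f. The three errors are at
    most \<delta>/3, \<delta>/3 and \<delta>/6.\<close>
  define e where "e = min (1 / 8) (\<delta> / (6 * (G * A + 1)))"
  have GA: "G * A \<ge> 0" using G A by simp
  have e: "0 < e" using \<delta> GA by (simp add: e_def)
  have e': "e \<le> 1 / 8" unfolding e_def by (rule min.cobounded1)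
  have GAe: "G * A * e \<le> \<delta> / 6"
  proof -
    have "G * A * e \<le> G * A * (\<delta> / (6 * (G * A + 1)))" using GA by (intro mult_left_mono) (auto simp: e_def)
    also have "\<dots> \<le> \<delta> / 6" using \<delta> GA by (simp add: field_simps)
    finally show ?thesis .
  qed
  obtain \<kappa> :: "real^'n \<Rightarrow> real" where "mollifier \<kappa> e (1 - 4 * e) (\<chi> i. 1 / 2)" using mollifier_exists_center[OF e e'] .
  then interpret mollifier \<kappa> e "1 - 4 * e" "\<chi> i. 1 / 2" .
  have vi: "integrable Q_measure (\<lambda>z. v z \<alpha>)" if "\<alpha> \<in> K_index d" for \<alpha>
    using Lint[OF in_L_field_component[OF v _ that] pq(2)] pq by simp
  have gi: "integrable Q_measure g" and fi: "integrable Q_measure f" and hi: "integrable Q_measure h"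
    using Lint[OF _ pq(2)] g Lf Lh by auto
  have LT: "Lq Q_measure q (T m)" if "integrable Q_measure m" for m
    using pq by (intro test_function_Lq test_function_T that) auto
  note wi = integrable_mult_Lq[OF w _ pq]
  have le: "ereal (\<integral>x. w x * T g x \<partial>Q_measure) \<le> PV d B w"
    using integral_op_B_limit[OF pq(2) v g \<phi> lim_v lim_g]
    by (intro PV_mollify[OF vi v1 gi _ Lq_measurable[OF w]])
  have b1: "\<bar>\<integral>x. w x * h x \<partial>Q_measure\<bar> \<le> \<delta> / 6 + \<delta> / 6"
    using integral_mult_le_Young[OF pq w Lh \<eta>] \<eta>W H unfolding W_def by (meson add_mono order_trans)
  have b2: "\<bar>\<integral>x. w x * T h x \<partial>Q_measure\<bar> \<le> \<delta> / 6 + \<delta> / 6"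
    using integral_mult_T_le[OF pq w Lh \<eta>] \<eta>W H unfolding W_def by (meson add_mono order_trans)
  have b3: "\<bar>\<integral>x. w x * (T f x - f x) \<partial>Q_measure\<bar> \<le> \<delta> / 6"
  proof -
    have i: "integrable Q_measure (\<lambda>x. w x * (T f x - f x))"
      using pq by (intro wi Lq_diff LT fi Lf) auto
    have "\<bar>\<integral>x. w x * (T f x - f x) \<partial>Q_measure\<bar> \<le> (\<integral>x. \<bar>w x * (T f x - f x)\<bar> \<partial>Q_measure)"
      by (rule integral_abs_bound)
    also have "\<dots> \<le> (\<integral>x. \<bar>w x\<bar> * (G * e) \<partial>Q_measure)"
    proof (rule integral_mono)
      show "integrable Q_measure (\<lambda>x. \<bar>w x\<bar> * (G * e))" using Lint[OF w pq(1)] by simp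
      show "\<bar>w x * (T f x - f x)\<bar> \<le> \<bar>w x\<bar> * (G * e)" if "x \<in> space Q_measure" for x
        unfolding abs_mult using T_test_function_close[OF f L(2), of x] that
        by (intro mult_left_mono) (auto simp: G_def)
    qed (use i in simp)
    also have "\<dots> = G * A * e" by (simp add: A_def)
    also note GAe
    finally show ?thesis .
  qed
  have "(\<integral>x. w x * g x \<partial>Q_measure) - (\<integral>x. w x * T g x \<partial>Q_measure)
    = (\<integral>x. w x * h x \<partial>Q_measure) - (\<integral>x. w x * T h x \<partial>Q_measure) - (\<integral>x. w x * (T f x - f x) \<partial>Q_measure)"
  proof -
    have "(\<integral>x. w x * h x \<partial>Q_measure) = (\<integral>x. w x * g x \<partial>Q_measure) - (\<integral>x. w x * f x \<partial>Q_measure)"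
      unfolding h_def using wi[OF g] wi[OF Lf] by (simp add: right_diff_distrib)
    moreover have "(\<integral>x. w x * T h x \<partial>Q_measure) = (\<integral>x. w x * T g x \<partial>Q_measure) - (\<integral>x. w x * T f x \<partial>Q_measure)"
      unfolding h_def[abs_def] T_diff[OF gi fi] using wi[OF LT[OF gi]] wi[OF LT[OF fi]] by (simp add: right_diff_distrib)
    moreover have "(\<integral>x. w x * (T f x - f x) \<partial>Q_measure) = (\<integral>x. w x * T f x \<partial>Q_measure) - (\<integral>x. w x * f x \<partial>Q_measure)"
      using wi[OF LT[OF fi]] wi[OF Lf] by (simp add: right_diff_distrib)
    ultimately show ?thesis by simp
  qed
  then have "(\<integral>x. w x * g x \<partial>Q_measure) \<le> (\<integral>x. w x * T g x \<partial>Q_measure) + \<delta>"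
    using b1 b2 b3 \<delta> unfolding abs_le_iff by argo
  then have "ereal (\<integral>x. w x * g x \<partial>Q_measure) \<le> ereal (\<integral>x. w x * T g x \<partial>Q_measure) + ereal \<delta>" by simp
  also have "\<dots> \<le> PV d B w + ereal \<delta>" by (rule add_right_mono[OF le])
  finally show "ereal (\<integral>x. w x * g x \<partial>Q_measure) \<le> PV d B w + ereal \<delta>" .
qed

lemma W0_space_integral_le_PV:
  fixes B :: "'n::finite coeffs"
  assumes pq: "p > 1" "q > 1" "1 / p + 1 / q = 1"
    and v: "v \<in> W0_space d q B" and v1: "Linf_norm d v \<le> 1" and w: "Lq Q_measure p w"
  shows "ereal (\<integral>x. w x * adjoint_B d B v x \<partial>Q_measure) \<le> PV d B w"
proof -
  from v obtain g where vL: "in_L_field d q v" and g: "Lq Q_measure q g" "is_adjoint d B v g"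
    by (auto simp: W0_space_def W_space_def in_L_eq_Lq)
  have gi: "integrable Q_measure g" by (rule finite_measure.Lq_imp_integrable[OF finite_measure_Q g(1) pq(2)])
  have "\<exists>\<phi>. test_field d \<phi> \<and> W_norm d q B (\<lambda>x \<alpha>. v x \<alpha> - \<phi> x \<alpha>) < 1 / real (Suc n)" for n
  proof -
    have "0 < 1 / real (Suc n)" by simp
    then show ?thesis using v unfolding W0_space_def by blast
  qed
  then obtain \<phi> where \<phi>: "\<And>n. test_field d (\<phi> n)" "\<And>n. W_norm d q B (\<lambda>x \<alpha>. v x \<alpha> - \<phi> n x \<alpha>) < 1 / real (Suc n)"
    by metis
  define a where "a n = (\<integral>x. K_norm d (\<lambda>\<alpha>. v x \<alpha> - \<phi> n x \<alpha>) powr q \<partial>Q_measure)" for n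
  define b where "b n = (\<integral>x. \<bar>g x - test_adjoint d B (\<phi> n) x\<bar> powr q \<partial>Q_measure)" for n
  have ab0: "a n \<ge> 0" "b n \<ge> 0" for n by (simp_all add: a_def b_def)
  have ab: "a n + b n \<le> (1 / real (Suc n)) powr q" for n
  proof -
    have "a n + b n = W_norm d q B (\<lambda>x \<alpha>. v x \<alpha> - \<phi> n x \<alpha>) powr q"
      unfolding a_def b_def by (rule W_norm_diff_test_field[OF pq(2) vL g \<phi>(1), symmetric])
    also have "\<dots> \<le> (1 / real (Suc n)) powr q"
      using \<phi>(2)[of n] pq by (intro powr_mono2) (auto simp: W_norm_def)
    finally show ?thesis .
  qed
  have "a n \<le> (1 / real (Suc n)) powr q" "b n \<le> (1 / real (Suc n)) powr q" for n
    using ab[of n] ab0[of n] by linarith+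
  note le = this
  have lim: "(\<lambda>n. (1 / real (Suc n)) powr q) \<longlonglongrightarrow> 0" using pq(2) by real_asymp
  have "a \<longlonglongrightarrow> 0"
    by (rule tendsto_sandwich[OF _ _ tendsto_const lim]) (intro always_eventually allI ab0 le)+
  moreover have "b \<longlonglongrightarrow> 0"
    by (rule tendsto_sandwich[OF _ _ tendsto_const lim]) (intro always_eventually allI ab0 le)+
  moreover have "AE x in Q_measure. K_norm d (v x) \<le> 1"
    using esssup_AE[of "\<lambda>x. ereal (K_norm d (v x))" Q_measure]
  proof eventually_elim
    case (elim x)
    then have "ereal (K_norm d (v x)) \<le> 1" using v1 unfolding Linf_norm_def by (rule order_trans)
    then show ?case by (simp add: one_ereal_def)
  qed
  ultimately have "ereal (\<integral>x. w x * g x \<partial>Q_measure) \<le> PV d B w"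
    using integral_le_PV[OF pq vL _ g(1) \<phi>(1) _ _ w, where B = B] by (simp add: a_def[abs_def] b_def[abs_def])
  moreover have "(\<integral>x. w x * adjoint_B d B v x \<partial>Q_measure) = (\<integral>x. w x * g x \<partial>Q_measure)"
  proof -
    have ae: "AE x in Q_measure. w x * adjoint_B d B v x = w x * g x"
      using adjoint_B_eq(1)[OF gi g(2)] by eventually_elim simp
    show ?thesis
      by (rule integral_cong_AE[OF borel_measurable_times borel_measurable_times ae])
        (rule Lq_measurable[OF w] Lq_measurable[OF g(1)] borel_measurable_integrable adjoint_B_eq(2)[OF gi g(2)])+
  qed
  ultimately show ?thesis by simp
qed

section \<open>Sign and homogeneity of PV, and the equivalence\<close>

lemma PV_nonneg:
  fixes B :: "'n::finite coeffs"
  shows "0 \<le> PV d B u"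
proof -
  have "test_adjoint d B (\<lambda>x \<alpha>. 0) = (\<lambda>x. 0)"
  proof
    fix x :: "real^'n"
    have "test_field d ((\<lambda>x \<alpha>. 0) :: 'n field)" by (simp add: test_field_def test_function_zero)
    from test_adjoint_linear[OF this this, of B 0 0 x] show "test_adjoint d B (\<lambda>x \<alpha>. 0) x = 0" by simp
  qed
  have t: "test_field d ((\<lambda>x \<alpha>. 0) :: 'n field)" by (simp add: test_field_def test_function_zero)
  have ae: "AE x in Q_measure. adjoint_B d B (\<lambda>x \<alpha>. 0) x = 0"
    using adjoint_B_test_field[OF t, of B] \<open>test_adjoint d B (\<lambda>x \<alpha>. 0) = (\<lambda>x. 0)\<close> by simp
  have "(\<integral>x. u x * adjoint_B d B (\<lambda>x \<alpha>. 0) x \<partial>Q_measure) = 0"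
    by (rule integral_eq_zero_AE) (use ae in eventually_elim, simp)
  then show ?thesis
    unfolding PV_def using admissible_zero[of d]
    by (intro SUP_upper2[of "\<lambda>x \<alpha>. 0"]) (auto simp: admissible_def zero_ereal_def)
qed

lemma PV_double_le:
  assumes "PV d B u = ereal r" shows "PV d B (\<lambda>x. 2 * u x) \<le> ereal (2 * r)"
  unfolding PV_def
proof (rule SUP_least)
  fix \<phi> :: "'a field" assume \<phi>: "\<phi> \<in> {\<phi>. test_field d \<phi> \<and> (\<forall>x. K_norm d (\<phi> x) \<le> 1)}"
  then have "ereal (\<integral>x. u x * adjoint_B d B \<phi> x \<partial>Q_measure) \<le> ereal r"
    unfolding assms[symmetric] PV_def by (rule SUP_upper)
  then show "ereal (\<integral>x. 2 * u x * adjoint_B d B \<phi> x \<partial>Q_measure) \<le> ereal (2 * r)"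
    by (simp add: mult.assoc)
qed

lemma PV_zero: "PV d B (\<lambda>x. 0) \<le> 0"
  unfolding PV_def by (rule SUP_least) (simp add: zero_ereal_def)

theorem theorem3p8:
  fixes d :: nat and B :: "'n::finite coeffs" and p q :: real
    and u u' :: "real^'n \<Rightarrow> real"
  assumes "d \<ge> 1"
    and "1 < p"
    and "q = p / (p - 1)"
    and "in_L p u"
    and "in_L q u'"
  shows "u' \<in> subdiff_PV d B p q u \<longleftrightarrow>
    u \<in> BV_space d B \<and>
    (\<exists>v. v \<in> W0_space d q B \<and>
         Linf_norm d v \<le> 1 \<and>
         (AE x in Q_measure. u' x = adjoint_B d B v x) \<and>
         PV d B u = ereal (\<integral>x. u x * adjoint_B d B v x \<partial>Q_measure))"
proof -
  have q: "q > 1" using assms(2,3) by (simp add: less_divide_eq)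
  have pq: "1 / p + 1 / q = 1" using assms(2) unfolding assms(3) by (simp add: diff_divide_distrib)
  note pq = assms(2) q pq
  have u: "Lq Q_measure p u" and u': "Lq Q_measure q u'" using assms(4,5) by (simp_all add: in_L_eq_Lq)
  have uu': "integrable Q_measure (\<lambda>x. w x * u' x)" if "Lq Q_measure p w" for w
    by (rule integrable_mult_Lq[OF that u' pq])
  have diff: "(\<integral>x. (w x - u x) * u' x \<partial>Q_measure) = (\<integral>x. w x * u' x \<partial>Q_measure) - (\<integral>x. u x * u' x \<partial>Q_measure)"
    if "Lq Q_measure p w" for w
    using uu'[OF that] uu'[OF u] by (simp add: left_diff_distrib)
  have cong: "(\<integral>x. w x * u' x \<partial>Q_measure) = (\<integral>x. w x * adjoint_B d B v x \<partial>Q_measure)"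
    if v: "v \<in> W0_space d q B" and ae: "AE x in Q_measure. u' x = adjoint_B d B v x" and w: "Lq Q_measure p w" for v w
  proof -
    from v obtain g where g: "Lq Q_measure q g" "is_adjoint d B v g"
      by (auto simp: W0_space_def W_space_def in_L_eq_Lq)
    have i: "integrable Q_measure (adjoint_B d B v)"
      by (rule adjoint_B_eq(2)[OF finite_measure.Lq_imp_integrable[OF finite_measure_Q g(1) q] g(2)])
    have ae': "AE x in Q_measure. w x * u' x = w x * adjoint_B d B v x" using ae by eventually_elim simp
    show ?thesis
      by (rule integral_cong_AE[OF borel_measurable_times borel_measurable_times ae'])
        (rule Lq_measurable[OF w] Lq_measurable[OF u'] borel_measurable_integrable i)+
  qed
  show ?thesis
  proof
    assume sub: "u' \<in> subdiff_PV d B p q u"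
    then have fin: "PV d B u < \<infinity>"
      and le: "\<And>w. Lq Q_measure p w \<Longrightarrow> ereal (\<integral>x. (w x - u x) * u' x \<partial>Q_measure) + PV d B u \<le> PV d B w"
      by (auto simp: subdiff_PV_def in_L_eq_Lq)
    from fin PV_nonneg[of d B u] obtain r where r: "PV d B u = ereal r" by (cases "PV d B u") auto
    have "integrable Q_measure u" using finite_measure.Lq_imp_integrable[OF finite_measure_Q u assms(2)] .
    then have BV: "u \<in> BV_space d B" using fin by (simp add: BV_space_def in_L_def)
    define s where "s = (\<integral>x. u x * u' x \<partial>Q_measure)"
    \<comment> \<open>The subgradient inequality at w = 2 u gives one half of PV u = s; the choice w
      = 0 below gives the other.\<close>
    have "ereal ((\<integral>x. 2 * u x * u' x \<partial>Q_measure) - s) + ereal r \<le> ereal (2 * r)"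
      using le[OF Lq_cmult[OF u], of 2] PV_double_le[OF r] unfolding diff[OF Lq_cmult[OF u]] r s_def
      by (rule order_trans)
    then have "s \<le> r" by (simp add: s_def mult.assoc)
    moreover have L0: "Lq Q_measure p (\<lambda>x :: real^'n. 0)" using Lq_cmult[OF u, of 0] by simp
    from le[OF L0] PV_zero have "ereal ((\<integral>x. 0 * u' x \<partial>Q_measure) - s) + ereal r \<le> 0"
      unfolding diff[OF L0] r s_def by (rule order_trans)
    then have "r \<le> s" by (simp add: zero_ereal_def)
    ultimately have rs: "r = s" by simp
    have sep: "ereal (\<integral>x. w x * u' x \<partial>Q_measure) \<le> PV d B w" if w: "Lq Q_measure p w" for w
      using le[OF w] unfolding diff[OF w] r rs s_def by simp
    obtain v where v: "v \<in> W0_space d q B" "Linf_norm d v \<le> 1" "AE x in Q_measure. u' x = adjoint_B d B v x"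
      using subdifferential_representation[OF pq u' sep] by blast
    moreover have "PV d B u = ereal (\<integral>x. u x * adjoint_B d B v x \<partial>Q_measure)"
      using cong[OF v(1,3) u] r rs s_def by simp
    ultimately show "u \<in> BV_space d B \<and> (\<exists>v. v \<in> W0_space d q B \<and> Linf_norm d v \<le> 1 \<and>
         (AE x in Q_measure. u' x = adjoint_B d B v x) \<and>
         PV d B u = ereal (\<integral>x. u x * adjoint_B d B v x \<partial>Q_measure))" using BV by blast
  next
    assume "u \<in> BV_space d B \<and> (\<exists>v. v \<in> W0_space d q B \<and> Linf_norm d v \<le> 1 \<and>
         (AE x in Q_measure. u' x = adjoint_B d B v x) \<and>
         PV d B u = ereal (\<integral>x. u x * adjoint_B d B v x \<partial>Q_measure))"
    then obtain v where fin: "PV d B u < \<infinity>" and v: "v \<in> W0_space d q B" "Linf_norm d v \<le> 1"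
      "AE x in Q_measure. u' x = adjoint_B d B v x"
      and PVu: "PV d B u = ereal (\<integral>x. u x * adjoint_B d B v x \<partial>Q_measure)"
      by (auto simp: BV_space_def)
    \<comment> \<open>PV u cancels the pairing of u with u', which leaves the bound of the pairing
      of w with u' by PV w.\<close>
    have "ereal (\<integral>x. (w x - u x) * u' x \<partial>Q_measure) + PV d B u \<le> PV d B w" if w: "Lq Q_measure p w" for w
      using W0_space_integral_le_PV[OF pq v(1,2) w]
      unfolding PVu diff[OF w] cong[OF v(1,3) w] cong[OF v(1,3) u] by simp
    with fin assms(5) show "u' \<in> subdiff_PV d B p q u" by (simp add: subdiff_PV_def in_L_eq_Lq)
  qed
qed

end
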